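(* Let $(\mathcal X,d,\mu)$ be a space of homogeneous type with doubling order $D$, and let $\{T_t\}_{t>0}$, $\{S_t\}_{t>0}$ be families of sublinear operators. (a) If $\{T_t\}_{t>0}$ satisfies $L^p(\mu)-L^p(\mu)$ off-diagonal estimates on balls, then $T_t:L^p(\mu)\to L^p(\mu)$ is bounded uniformly in $t>0$. (b) Let $1\le p\le q\le r\le\infty$. If $\{T_t\}_{t>0}$ satisfies $L^q(\mu)-L^r(\mu)$ off-diagonal estimates on balls and $\{S_t\}_{t>0}$ satisfies $L^p(\mu)-L^q(\mu)$ off-diagonal estimates on balls, then $\{T_t\circ S_t\}_{t>0}$ satisfies $L^p(\mu)-L^r(\mu)$ off-diagonal estimates on balls. Furthermore, if $\theta_1,\theta_2$ are the exponents in the estimates for $T_t$ and $\gamma_1,\gamma_2$ are those for $S_t$, then $T_t\circ S_t$ satisfies the corresponding inequalities with first exponent $\alpha_1=\max\{\theta_1,\gamma_1,D/r\}$ and second exponent $\alpha_2=\max\{\theta_1,\theta_2\}+\max\{\gamma_1+D/q,\gamma_2\}$ when $\theta_1\ne\theta_2$ and $\gamma_1+D/q\neq\gamma_2$; otherwise $\alpha_2$ is any number strictly bigger than this value.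
   Context: A space of homogeneous type $(\mathcal X,d,\mu)$ is a nonempty set $\mathcal X$ with a distance $d$ and a nonnegative Borel measure $\mu$ such that for some $C_0$, $\mu(B(x,2r))\le C_0\,\mu(B(x,r))<\infty$ for all $x\in\mathcal X$, $r>0$, where $B(x,r)=\{y:d(x,y)<r\}$. With $C_0$ the smallest such constant, $D=\log_2C_0$ is the doubling order (so $\mu(\lambda B)\le C_\mu\lambda^D\mu(B)$ for $\lambda\ge1$). For a ball $B=B(x_B,r_B)$ write $\lambda B=B(x_B,\lambda r_B)$ and $C_j(B)=2^{j+1}B\setminus 2^jB$ for $j\ge2$. Put $\Upsilon(s)=\max\{s,s^{-1}\}$ for $s>0$; $\chi_E$ is the indicator function of $E$. For $1\le p\le q\le\infty$, $\{T_t\}_{t>0}$ satisfies $L^p(\mu)-L^q(\mu)$ off-diagonal estimates on balls, with exponents $\theta_1,\theta_2>0$, if there exist $c>0$ and $C>0$ such that for every $t>0$, every ball $B$ with radius $r=r_B$, and all $f$, $$\Big(\tfrac1{\mu(B)}\int_B|T_t(\chi_Bf)|^q d\mu\Big)^{1/q}\le C\,\Upsilon\big(\tfrac r{\sqrt t}\big)^{\theta_2}\Big(\tfrac1{\mu(B)}\int_B|f|^pd\mu\Big)^{1/p},$$ and for all $j\ge2$ $$\Big(\tfrac1{\mu(B)}\int_B|T_t(\chi_{C_j(B)}f)|^q d\mu\Big)^{1/q}\le C\,2^{j\theta_1}\Upsilon\big(\tfrac{2^jr}{\sqrt t}\big)^{\theta_2}e^{-\frac{c4^jr^2}{t}}\Big(\tfrac1{\mu(2^{j+1}B)}\int_{C_j(B)}|f|^pd\mu\Big)^{1/p},$$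 $$\Big(\tfrac1{\mu(2^{j+1}B)}\int_{C_j(B)}|T_t(\chi_{B}f)|^q d\mu\Big)^{1/q}\le C\,2^{j\theta_1}\Upsilon\big(\tfrac{2^jr}{\sqrt t}\big)^{\theta_2}e^{-\frac{c4^jr^2}{t}}\Big(\tfrac1{\mu(B)}\int_{B}|f|^pd\mu\Big)^{1/p}.$$ When $q=\infty$ the left-hand sides (and when $p=\infty$ the right-hand averages) are replaced by essential suprema. $D/\infty=0$. Sublinear has its usual meaning: $|T(f+g)|\le|Tf|+|Tg|$ and $|T(cf)|=|c||Tf|$. The operators may be defined only on a subspace of the relevant $L^p(\mu)$ which is stable under truncation by indicator functions of measurable sets; then all statements concern functions $f$ in that subspace (and in (b), functions $f$ for which $T_t\circ S_tf$ is well defined).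
   Formalization: T_t is also assumed subadditive a.e. along the infinite splitting of f into its restrictions to 4B and C_j(B), j≥2: |T_t f| ≤ |T_t(χ_{4B}f)| + Σ_j |T_t(χ_{C_j(B)}f)|; with finite sublinearity alone (a) fails, e.g. for a functional on L^1(R) vanishing on bounded supports. *)

theory Defs
  imports "HOL-Probability.Probability"
begin

section \<open>Spaces of homogeneous type\<close>

definition doubling_const :: "'a::metric_space measure \<Rightarrow> real \<Rightarrow> bool" where
  "doubling_const M C \<longleftrightarrow>
     0 \<le> C \<and> (\<forall>x r. r > 0 \<longrightarrow> emeasure M (ball x (2 * r)) \<le> ennreal C * emeasure M (ball x r))"

definition homogeneous_type :: "'a::metric_space measure \<Rightarrow> bool" where
  "homogeneous_type M \<longleftrightarrow>
     sets M = sets borel \<and>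
     (\<forall>x r. r > 0 \<longrightarrow> emeasure M (ball x r) < \<infinity>) \<and>
     (\<exists>C. doubling_const M C)"

text \<open>The minimum exists for every space of homogeneous type. For the zero measure the minimal
  constant is 0 and the order is 0 by the convention for the logarithm; no hypothesis excludes
  that degenerate case.\<close>

definition doubling_order :: "'a::metric_space measure \<Rightarrow> real" where
  "doubling_order M = log 2 (LEAST C. doubling_const M C)"

text \<open>For \<open>B = ball x r\<close> this is \<open>2\<^sup>j\<^sup>+\<^sup>1B - 2\<^sup>jB\<close>; it is used for \<open>j \<ge> 2\<close>.\<close>

definition annulus :: "'a::metric_space \<Rightarrow> real \<Rightarrow> nat \<Rightarrow> 'a set" where
  "annulus x r j = ball x (2 ^ (j + 1) * r) - ball x (2 ^ j * r)"

definition Upsilon :: "real \<Rightarrow> real" where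
  "Upsilon s = max s (inverse s)"

section \<open>Lebesgue spaces\<close>

text \<open>Integrability exponents are extended nonnegative reals, so that \<open>p = \<infinity>\<close> is allowed.
  \<open>epowr\<close> is only used with positive real exponents.\<close>

definition epowr :: "ennreal \<Rightarrow> real \<Rightarrow> ennreal" where
  "epowr u a = (if u = \<infinity> then \<infinity> else ennreal (enn2real u powr a))"

definition dim_quot :: "real \<Rightarrow> ennreal \<Rightarrow> real" where
  "dim_quot D p = (if p = \<infinity> then 0 else D / enn2real p)"

definition Lp_enorm :: "'a measure \<Rightarrow> ennreal \<Rightarrow> ('a \<Rightarrow> 'b::real_normed_vector) \<Rightarrow> ennreal" where
  "Lp_enorm M p f =
     (if p = \<infinity> then esssup M (\<lambda>x. ennreal (norm (f x)))
      else epowr (\<integral>\<^sup>+x. ennreal (norm (f x) powr enn2real p) \<partial>M) (1 / enn2real p))"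

definition Lp :: "'a measure \<Rightarrow> ennreal \<Rightarrow> ('a \<Rightarrow> 'b::real_normed_vector) set" where
  "Lp M p = {f \<in> borel_measurable M. Lp_enorm M p f < \<infinity>}"

text \<open>The integral is over \<open>E\<close> but normalised by the measure of \<open>B\<close>; in the annular estimates
  \<open>E\<close> is an annulus and \<open>B\<close> the surrounding ball. For \<open>p = \<infinity>\<close> this is the essential supremum
  over \<open>E\<close>.\<close>

definition Lp_average ::
  "'a measure \<Rightarrow> ennreal \<Rightarrow> 'a set \<Rightarrow> 'a set \<Rightarrow> ('a \<Rightarrow> 'b::real_normed_vector) \<Rightarrow> ennreal" where
  "Lp_average M p B E f =
     (if p = \<infinity> then esssup M (\<lambda>x. ennreal (norm (f x)) * indicator E x)
      else epowr ((\<integral>\<^sup>+x\<in>E. ennreal (norm (f x) powr enn2real p) \<partial>M) / emeasure M B)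
                 (1 / enn2real p))"

definition trunc :: "'a set \<Rightarrow> ('a \<Rightarrow> 'b::real_normed_field) \<Rightarrow> 'a \<Rightarrow> 'b" where
  "trunc E f = (\<lambda>x. indicator E x * f x)"

text \<open>A subspace of \<open>L\<^sup>p\<close> stable under truncation, represented by the set of all functions whose
  class belongs to it (hence the closure under almost everywhere equality).\<close>

definition Lp_subspace ::
  "'a measure \<Rightarrow> ennreal \<Rightarrow> ('a \<Rightarrow> 'b::{real_normed_field, second_countable_topology}) set \<Rightarrow> bool"
where
  "Lp_subspace M p V \<longleftrightarrow>
     V \<subseteq> Lp M p \<and>
     (\<lambda>x. 0) \<in> V \<and>
     (\<forall>f\<in>V. \<forall>g\<in>V. (\<lambda>x. f x + g x) \<in> V) \<and>
     (\<forall>c. \<forall>f\<in>V. (\<lambda>x. c * f x) \<in> V) \<and>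
     (\<forall>f\<in>V. \<forall>E\<in>sets M. trunc E f \<in> V) \<and>
     (\<forall>f\<in>V. \<forall>g\<in>borel_measurable M. (AE x in M. f x = g x) \<longrightarrow> g \<in> V)"

section \<open>Sublinear operators and off-diagonal estimates\<close>

definition sublinear_family ::
  "'a measure \<Rightarrow> ('a \<Rightarrow> 'b::{real_normed_field, second_countable_topology}) set \<Rightarrow>
     (real \<Rightarrow> ('a \<Rightarrow> 'b) \<Rightarrow> 'a \<Rightarrow> 'b) \<Rightarrow> bool"
where
  "sublinear_family M V T \<longleftrightarrow>
     (\<forall>t>0.
        (\<forall>f\<in>V. T t f \<in> borel_measurable M) \<and>
        (\<forall>f\<in>V. \<forall>g\<in>V. (AE x in M. f x = g x) \<longrightarrow> (AE x in M. T t f x = T t g x)) \<and>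
        (\<forall>f\<in>V. \<forall>g\<in>V. AE x in M.
            norm (T t (\<lambda>y. f y + g y) x) \<le> norm (T t f x) + norm (T t g x)) \<and>
        (\<forall>c. \<forall>f\<in>V. AE x in M. norm (T t (\<lambda>y. c * f y) x) = norm c * norm (T t f x)))"

text \<open>Subadditivity along the infinite decomposition of \<open>f\<close> into its restrictions to \<open>4B\<close> and to
  the annuli \<open>C\<^sub>j(B)\<close>, \<open>j \<ge> 2\<close>. Finite sublinearity alone does not relate \<open>T\<^sub>t f\<close> to the values of
  \<open>T\<^sub>t\<close> on boundedly supported functions, which is all that off-diagonal estimates on balls
  control: with \<open>\<phi>\<close> a nonzero linear functional on \<open>L\<^sup>1(\<real>)\<close> that vanishes on functions with bounded
  support, the operators \<open>T\<^sub>t f = \<phi>(f) \<chi>\<close>, where \<open>\<chi>\<close> is the indicator of the unit interval, are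
  linear, satisfy all the estimates, and are unbounded. The condition follows from finite
  sublinearity if all functions in \<open>V\<close> have bounded support.\<close>

definition annular_subadditive ::
  "'a::metric_space measure \<Rightarrow> ('a \<Rightarrow> 'b::real_normed_field) set \<Rightarrow>
     (real \<Rightarrow> ('a \<Rightarrow> 'b) \<Rightarrow> 'a \<Rightarrow> 'b) \<Rightarrow> bool"
where
  "annular_subadditive M V T \<longleftrightarrow>
     (\<forall>t>0. \<forall>f\<in>V. \<forall>x. \<forall>r>0. AE y in M.
        ennreal (norm (T t f y)) \<le>
          ennreal (norm (T t (trunc (ball x (4 * r)) f) y)) +
          (\<Sum>j. ennreal (norm (T t (trunc (annulus x r (j + 2)) f) y))))"

text \<open>The family \<open>V\<close> gives the domain of \<open>T\<^sub>t\<close>, which depends on \<open>t\<close> for compositions and need then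
  not be stable under truncation. This is why membership in \<open>V t\<close> is required of the truncated
  function to which \<open>T\<^sub>t\<close> is applied; for a domain stable under truncation this amounts to
  quantifying over \<open>f \<in> V t\<close>, as the estimates only involve the truncated function.\<close>

definition off_diagonal_with ::
  "'a::metric_space measure \<Rightarrow> ennreal \<Rightarrow> ennreal \<Rightarrow> (real \<Rightarrow> ('a \<Rightarrow> 'b::real_normed_field) set) \<Rightarrow>
     (real \<Rightarrow> ('a \<Rightarrow> 'b) \<Rightarrow> 'a \<Rightarrow> 'b) \<Rightarrow> real \<Rightarrow> real \<Rightarrow> bool"
where
  "off_diagonal_with M p q V T \<theta>\<^sub>1 \<theta>\<^sub>2 \<longleftrightarrow>
     0 < \<theta>\<^sub>1 \<and> 0 < \<theta>\<^sub>2 \<and>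
     (\<exists>c>0. \<exists>C>0. \<forall>t>0. \<forall>x. \<forall>r>0.
        (\<forall>f. trunc (ball x r) f \<in> V t \<longrightarrow>
           Lp_average M q (ball x r) (ball x r) (T t (trunc (ball x r) f)) \<le>
             ennreal (C * Upsilon (r / sqrt t) powr \<theta>\<^sub>2) *
             Lp_average M p (ball x r) (ball x r) f) \<and>
        (\<forall>j\<ge>2.
           (\<forall>f. trunc (annulus x r j) f \<in> V t \<longrightarrow>
              Lp_average M q (ball x r) (ball x r) (T t (trunc (annulus x r j) f)) \<le>
                ennreal (C * 2 powr (real j * \<theta>\<^sub>1) * Upsilon (2 ^ j * r / sqrt t) powr \<theta>\<^sub>2 *
                         exp (- (c * 4 ^ j * r\<^sup>2 / t))) *
                Lp_average M p (ball x (2 ^ (j + 1) * r)) (annulus x r j) f) \<and>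
           (\<forall>f. trunc (ball x r) f \<in> V t \<longrightarrow>
              Lp_average M q (ball x (2 ^ (j + 1) * r)) (annulus x r j)
                  (T t (trunc (ball x r) f)) \<le>
                ennreal (C * 2 powr (real j * \<theta>\<^sub>1) * Upsilon (2 ^ j * r / sqrt t) powr \<theta>\<^sub>2 *
                         exp (- (c * 4 ^ j * r\<^sup>2 / t))) *
                Lp_average M p (ball x r) (ball x r) f)))"

definition off_diagonal ::
  "'a::metric_space measure \<Rightarrow> ennreal \<Rightarrow> ennreal \<Rightarrow> (real \<Rightarrow> ('a \<Rightarrow> 'b::real_normed_field) set) \<Rightarrow>
     (real \<Rightarrow> ('a \<Rightarrow> 'b) \<Rightarrow> 'a \<Rightarrow> 'b) \<Rightarrow> bool"
where
  "off_diagonal M p q V T \<longleftrightarrow> (\<exists>\<theta>\<^sub>1 \<theta>\<^sub>2. off_diagonal_with M p q V T \<theta>\<^sub>1 \<theta>\<^sub>2)"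

text \<open>The functions \<open>f\<close> for which \<open>T\<^sub>t (S\<^sub>t f)\<close> is well defined.\<close>

definition comp_domain ::
  "('a \<Rightarrow> 'b) set \<Rightarrow> ('a \<Rightarrow> 'b) set \<Rightarrow> (real \<Rightarrow> ('a \<Rightarrow> 'b) \<Rightarrow> 'a \<Rightarrow> 'b) \<Rightarrow> real \<Rightarrow> ('a \<Rightarrow> 'b) set" where
  "comp_domain V W S t = {f \<in> W. S t f \<in> V}"

end

(*
  The operators are estimated at a fixed scale tau = sqrt t. Covering a ball by boundedly many
  balls of an eighth of its radius shows that the off-diagonal estimates also hold between a ball B
  and the adjacent shell 2B - B. For (b), the function S f is then split into its restriction to an
  intermediate ball, where one diagonal and one off-diagonal estimate suffice, and its restrictions
  to the dyadic shells around that ball, where both operators decay. The far part is controlled by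
    sum_i 2^(i A) Upsilon(2^i u)^B exp(-c 4^i u^2) <= K Upsilon(u)^e exp(-c' u^2),
  valid for e >= max A B if A and B differ and for e > A if they coincide. This exponent e is never
  larger than the one claimed.
  For (a), a ball is covered by balls of radius tau with centres in a finite tau-separated set. Since
  the balls with the same centres and radius 2^k tau overlap at most C^(k+3) times, Minkowski's
  inequality over the annuli gives a bound that depends neither on tau nor on the ball.
*)
theory Submission
  imports Defs "HOL-Real_Asymp.Real_Asymp"
begin

section \<open>Lebesgue norms of extended nonnegative functions\<close>

text \<open>Obstacle: the intermediate ball. For \<open>f\<close> supported in the annulus between
  radii 4 r and 8 r, using only indices at least 2, \<open>S\<close> would require an intermediate
  radius of at most r, whereas \<open>T\<close>, acting from the shells outside it back to the ball
  of radius r, would require at least 4 r. With index 1 also available both conditions allow exactly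
  2 r. This is why the adjacent shell has to be treated separately, and why the splitting radius is
  half the inner radius of the annulus. On every shell the average of \<open>S f\<close> is
  normalised by the ball for which \<open>T\<close> expects its input, so no power of D is lost
  between the two operators. The quotient D/r in the first exponent comes from comparing an average
  over the small ball with one over the intermediate ball. All constants are expressions in the
  doubling constant and the given parameters and are fixed before the operators and \<tau>.
  Uniformity in t is therefore visible in the order of the quantifiers.\<close>

lemma epowr_ennreal: "0 \<le> x \<Longrightarrow> epowr (ennreal x) a = ennreal (x powr a)"
  by (simp add: epowr_def)

lemma epowr_top [simp]: "epowr top a = top"
  by (simp add: epowr_def)

lemma epowr_zero [simp]: "epowr 0 a = 0"
  by (simp add: epowr_def)

lemma epowr_mono: "u \<le> v \<Longrightarrow> 0 \<le> a \<Longrightarrow> epowr u a \<le> epowr v a"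
  by (cases u; cases v) (auto simp: epowr_ennreal powr_mono2 top_unique)

lemma epowr_epowr: "0 < a \<Longrightarrow> epowr (epowr u a) (1 / a) = u"
  by (cases u) (auto simp: epowr_ennreal powr_powr)

lemma epowr_epowr': "0 < a \<Longrightarrow> epowr (epowr u (1 / a)) a = u"
  by (cases u) (auto simp: epowr_ennreal powr_powr)

lemma epowr_le_iff: "0 < a \<Longrightarrow> epowr u a \<le> v \<longleftrightarrow> u \<le> epowr v (1 / a)"
  by (metis epowr_epowr epowr_epowr' epowr_mono less_eq_real_def zero_less_divide_1_iff)

lemma epowr_mult: "0 < a \<Longrightarrow> epowr (u * v) a = epowr u a * epowr v a"
  by (cases u; cases v)
    (auto simp: epowr_ennreal powr_mult ennreal_mult[symmetric] ennreal_mult_top ennreal_top_mult)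

lemma epowr_divide: "0 < a \<Longrightarrow> 0 < v \<Longrightarrow> epowr (u / ennreal v) a = epowr u a / ennreal (v powr a)"
  by (cases u) (auto simp: epowr_ennreal divide_ennreal powr_divide ennreal_top_divide)

lemma borel_measurable_epowr [measurable (raw)]:
  assumes "f \<in> borel_measurable M"
  shows "(\<lambda>x. epowr (f x) a) \<in> borel_measurable M"
proof -
  have "(\<lambda>u::ennreal. ennreal (enn2real u powr a)) \<in> borel_measurable borel"
    by measurable
  then have "(\<lambda>u. epowr u a) \<in> borel_measurable borel"
    unfolding epowr_def by (intro measurable_If) auto
  from measurable_compose[OF assms this] show ?thesis .
qed

lemma suminf_ennreal_Suc_shift: "(\<Sum>j. u j) = u 0 + (\<Sum>i. u (Suc i))" for u :: "nat \<Rightarrow> ennreal"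
  using suminf_offset[of u 1] by (simp add: add.commute)

definition eLp :: "'a measure \<Rightarrow> ennreal \<Rightarrow> ('a \<Rightarrow> ennreal) \<Rightarrow> ennreal" where
  "eLp M p F = (if p = \<infinity> then esssup M F
     else epowr (\<integral>\<^sup>+x. epowr (F x) (enn2real p) \<partial>M) (1 / enn2real p))"

lemma enn2real_pos_exponent: "1 \<le> p \<Longrightarrow> p \<noteq> \<infinity> \<Longrightarrow> 1 \<le> enn2real p"
  by (cases p) auto

lemma Lp_enorm_eq_eLp: "Lp_enorm M p f = eLp M p (\<lambda>x. ennreal (norm (f x)))"
  by (simp add: Lp_enorm_def eLp_def epowr_ennreal)

lemma eLp_le_iff:
  assumes "1 \<le> p" "F \<in> borel_measurable M"
  shows "eLp M p F \<le> v \<longleftrightarrow> (if p = \<infinity> then AE x in M. F x \<le> v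
     else (\<integral>\<^sup>+x. epowr (F x) (enn2real p) \<partial>M) \<le> epowr v (enn2real p))"
proof (cases "p = \<infinity>")
  case True
  then show ?thesis
    using assms esssup_AE[of F M] esssup_I[of F M v] by (auto simp: eLp_def elim: eventually_mono)
next
  case False
  then have "0 < enn2real p" using enn2real_pos_exponent[OF assms(1)] by simp
  then show ?thesis using False epowr_le_iff[of "1 / enn2real p"] by (simp add: eLp_def)
qed

lemma eLp_mono_AE:
  assumes "1 \<le> p" "F \<in> borel_measurable M" "AE x in M. F x \<le> G x"
  shows "eLp M p F \<le> eLp M p G"
  using assms enn2real_pos_exponent[of p] unfolding eLp_def
  by (auto intro!: esssup_AE_mono epowr_mono nn_integral_mono_AE elim!: eventually_mono)

section \<open>Minkowski's inequality for series\<close>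

lemma eLp_zero [simp]: "eLp M p (\<lambda>x. 0) = 0"
proof -
  have "esssup M (\<lambda>x. 0::ennreal) \<le> 0"
    by (rule esssup_I) auto
  then show ?thesis by (simp add: eLp_def)
qed

text \<open>Jensen's inequality for \<open>y powr p\<close> at the points \<open>x j / a j\<close>
  with weights proportional to \<open>a j\<close>. The tangent at their weighted mean
  \<open>m\<close> lies below the graph, and adding it up with the weights cancels the linear
  part.\<close>

lemma sum_powr_le:
  fixes a x :: "nat \<Rightarrow> real"
  assumes p: "1 \<le> p" and a: "\<And>j. 0 < a j" and x: "\<And>j. 0 \<le> x j"
  shows "(\<Sum>j<n. x j) powr p \<le> (\<Sum>j<n. a j) powr (p - 1) * (\<Sum>j<n. a j powr (1 - p) * x j powr p)"
proof (cases "n = 0")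
  case False
  define A where "A = (\<Sum>j<n. a j)"
  have A: "0 < A" unfolding A_def using False by (intro sum_pos a) auto
  have tangent: "m powr p + p * m powr (p - 1) * (y - m) \<le> y powr p" if "0 < m" "0 \<le> y" for m y :: real
  \<comment> \<open>Convexity of \<open>powr\<close> is applied on the open half-line, so the end
    point is checked by hand.\<close>
  proof (cases "y = 0")
    case True
    have "m powr p = m * m powr (p - 1)"
      using that by (simp add: powr_mult_base)
    moreover have "m * m powr (p - 1) * (1 - p) \<le> 0"
      using that p by (intro mult_nonneg_nonpos) auto
    ultimately show ?thesis using True by (simp add: algebra_simps)
  next
    case False
    have "(\<lambda>x. x powr p) y - (\<lambda>x. x powr p) m \<ge> p * m powr (p - 1) * (y - m)"
      using that False
      by (intro convex_on_imp_above_tangent[OF powr_convex[OF p]])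
        (auto simp: interior_open connected_Ioi intro!: derivative_eq_intros)
    then show ?thesis by simp
  qed
  show ?thesis
  proof (cases "(\<Sum>j<n. x j) = 0")
    case True
    then show ?thesis using a by (auto intro!: mult_nonneg_nonneg sum_nonneg)
  next
    case nz: False
    define X where "X = (\<Sum>j<n. x j)"
    have X: "0 < X" using nz x unfolding X_def by (simp add: less_le sum_nonneg)
    define m where "m = X / A"
    have m: "0 < m" using X A by (simp add: m_def)
    have "(\<Sum>j<n. a j * (m powr p + p * m powr (p - 1) * (x j / a j - m))) \<le> (\<Sum>j<n. a j * (x j / a j) powr p)"
      using a x m by (intro sum_mono mult_left_mono tangent) (auto simp: less_imp_le)
    also have "(\<Sum>j<n. a j * (m powr p + p * m powr (p - 1) * (x j / a j - m)))
        = (\<Sum>j<n. a j * m powr p + p * m powr (p - 1) * (x j - m * a j))"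
      using a by (intro sum.cong refl) (simp add: field_simps less_imp_neq[symmetric])
    also have "\<dots> = A * m powr p + p * m powr (p - 1) * (X - m * A)"
      by (simp add: sum.distrib sum_subtractf sum_distrib_left[symmetric] sum_distrib_right[symmetric] A_def X_def)
    also have "\<dots> = A * m powr p" using A by (simp add: m_def)
    also have "(\<Sum>j<n. a j * (x j / a j) powr p) = (\<Sum>j<n. a j powr (1 - p) * x j powr p)"
    proof (intro sum.cong refl)
      fix j
      show "a j * (x j / a j) powr p = a j powr (1 - p) * x j powr p"
        using a[of j] x[of j] by (simp add: powr_divide powr_diff)
    qed
    finally have *: "A * m powr p \<le> (\<Sum>j<n. a j powr (1 - p) * x j powr p)" .
    have "X powr p = A powr (p - 1) * (A * m powr p)"
      using A X by (simp add: m_def powr_divide powr_diff)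
    also have "\<dots> \<le> A powr (p - 1) * (\<Sum>j<n. a j powr (1 - p) * x j powr p)"
      by (intro mult_left_mono *) simp
    finally show ?thesis by (simp add: A_def X_def)
  qed
qed simp

text \<open>The weights stay free here; in Minkowski's inequality they are taken close to the norms
  of the terms. The root of the right side bounds every partial sum, hence the series.\<close>

lemma epowr_suminf_le:
  fixes F :: "nat \<Rightarrow> ennreal" and a :: "nat \<Rightarrow> real"
  assumes p: "1 \<le> p" and a: "\<And>j. 0 < a j" and A: "\<And>n. (\<Sum>j<n. a j) \<le> A"
  shows "epowr (\<Sum>j. F j) p \<le> ennreal (A powr (p - 1)) * (\<Sum>j. ennreal (a j powr (1 - p)) * epowr (F j) p)"
    (is "_ \<le> ?R")
proof -
  have A0: "0 < A" using A[of 1] a[of 0] by simp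
  have "(\<Sum>j<n. F j) \<le> epowr ?R (1 / p)" for n
  \<comment> \<open>An infinite term makes the right side infinite, as its weight is positive;
    otherwise all terms are real.\<close>
  proof (cases "\<exists>j. F j = top")
    case True
    then obtain j where j: "F j = top" by auto
    have "ennreal (a j powr (1 - p)) * epowr (F j) p \<le> (\<Sum>j. ennreal (a j powr (1 - p)) * epowr (F j) p)"
      using sum_le_suminf[OF summableI, of "{j}" "\<lambda>j. ennreal (a j powr (1 - p)) * epowr (F j) p"] by simp
    moreover have "ennreal (a j powr (1 - p)) * epowr (F j) p = top"
      using a[of j] j by (simp add: ennreal_mult_top)
    ultimately have "?R = top" using A0 by (simp add: top_unique ennreal_mult_top)
    then show ?thesis by simp
  next
    case False
    define x where "x j = enn2real (F j)" for j
    have x: "\<And>j. 0 \<le> x j" "\<And>j. F j = ennreal (x j)"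
      using False by (auto simp: x_def less_top)
    have "epowr (\<Sum>j<n. F j) p = ennreal ((\<Sum>j<n. x j) powr p)"
      using x by (simp add: epowr_ennreal sum_nonneg)
    also have "\<dots> \<le> ennreal ((\<Sum>j<n. a j) powr (p - 1) * (\<Sum>j<n. a j powr (1 - p) * x j powr p))"
      using x a p by (intro ennreal_leI sum_powr_le) auto
    also have "\<dots> \<le> ennreal (A powr (p - 1) * (\<Sum>j<n. a j powr (1 - p) * x j powr p))"
      using p A[of n] a
      by (intro ennreal_leI mult_right_mono powr_mono2) (simp_all add: sum_nonneg less_imp_le)
    also have "\<dots> = ennreal (A powr (p - 1)) * (\<Sum>j<n. ennreal (a j powr (1 - p)) * epowr (F j) p)"
    proof -
      have "(\<Sum>j<n. ennreal (a j powr (1 - p)) * epowr (F j) p)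
          = (\<Sum>j<n. ennreal (a j powr (1 - p) * x j powr p))"
        using x by (intro sum.cong refl) (simp add: epowr_ennreal ennreal_mult)
      also have "\<dots> = ennreal (\<Sum>j<n. a j powr (1 - p) * x j powr p)"
        by simp
      finally show ?thesis by (simp add: ennreal_mult sum_nonneg)
    qed
    also have "\<dots> \<le> ?R"
      by (intro mult_left_mono sum_le_suminf) auto
    finally show ?thesis using p by (subst epowr_le_iff[symmetric]) auto
  qed
  then have "(\<Sum>j. F j) \<le> epowr ?R (1 / p)"
    by (simp add: suminf_eq_SUP SUP_le_iff)
  then show ?thesis using p by (subst epowr_le_iff) auto
qed

text \<open>If \<open>a j\<close> is the norm of \<open>F j\<close>, then
  \<open>a j powr (1 - p)\<close> times the p-th power of that norm is again \<open>a j\<close>, so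
  that integrating the weighted inequality yields Minkowski's. No conjugate exponent enters, and p =
  1 is included.\<close>

lemma eLp_suminf_le:
  fixes F :: "nat \<Rightarrow> 'a \<Rightarrow> ennreal"
  assumes p: "1 \<le> p" and [measurable]: "\<And>j. F j \<in> borel_measurable M"
  shows "eLp M p (\<lambda>x. \<Sum>j. F j x) \<le> (\<Sum>j. eLp M p (F j))"
proof (cases "p = \<infinity>")
  case True
  have "AE x in M. \<forall>j. F j x \<le> esssup M (F j)"
    by (simp add: AE_all_countable esssup_AE)
  then have "AE x in M. (\<Sum>j. F j x) \<le> (\<Sum>j. esssup M (F j))"
    by eventually_elim (auto intro!: suminf_le)
  then show ?thesis using True by (simp add: eLp_def esssup_I)
next
  case False
  define P where "P = enn2real p"
  have P: "1 \<le> P" using enn2real_pos_exponent[OF p False] by (simp add: P_def)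
  show ?thesis
  proof (cases "(\<Sum>j. eLp M p (F j)) = top")
    case False
    show ?thesis
    proof (rule ennreal_le_epsilon)
      fix e :: real assume e: "0 < e"
      define n where "n j = enn2real (eLp M p (F j))" for j
      have fin: "eLp M p (F j) < top" for j
        using False ennreal_suminf_lessD[of "\<lambda>j. eLp M p (F j)" top j] by (simp add: less_top)
      have n: "eLp M p (F j) = ennreal (n j)" "0 \<le> n j" for j
        using fin[of j] by (auto simp: n_def)
      \<comment> \<open>The excess keeps the weights positive when a norm vanishes. It adds up to
        \<open>e\<close>, since the powers (1/2)^(j+1) have sum 1.\<close>
      define a where "a j = n j + e * (1/2) ^ Suc j" for j
      define A where "A = suminf n + e"
      have n_sum: "summable n"
        using False n by (intro summable_suminf_not_top) auto
      have a_sums: "a sums A"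
        unfolding a_def A_def
        using sums_add[OF summable_sums[OF n_sum] sums_mult[OF power_half_series, of e]] by simp
      have a: "0 < a j" for j using n(2)[of j] e by (simp add: a_def add_nonneg_pos)
      have A_le: "(\<Sum>j<m. a j) \<le> A" for m
        using sum_le_suminf[OF sums_summable[OF a_sums], of "{..<m}"] a sums_unique[OF a_sums]
        by (auto simp: less_imp_le)
      have A0: "0 < A" using A_le[of 1] a[of 0] by simp
      have int: "(\<integral>\<^sup>+x. epowr (F j x) P \<partial>M) \<le> ennreal (a j powr P)" for j
      proof -
        have "eLp M p (F j) \<le> ennreal (a j)"
          using n e by (simp add: a_def ennreal_leI)
        then show ?thesis
          using p \<open>p \<noteq> \<infinity>\<close> a[of j] by (simp add: eLp_le_iff P_def epowr_ennreal)
      qed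
      have "(\<integral>\<^sup>+x. epowr (\<Sum>j. F j x) P \<partial>M)
          \<le> (\<integral>\<^sup>+x. ennreal (A powr (P - 1)) * (\<Sum>j. ennreal (a j powr (1 - P)) * epowr (F j x) P) \<partial>M)"
        using P a A_le by (intro nn_integral_mono epowr_suminf_le) auto
      also have "\<dots> = ennreal (A powr (P - 1)) * (\<Sum>j. ennreal (a j powr (1 - P)) * (\<integral>\<^sup>+x. epowr (F j x) P \<partial>M))"
        by (simp add: nn_integral_cmult nn_integral_suminf)
      also have "\<dots> \<le> ennreal (A powr (P - 1)) * (\<Sum>j. ennreal (a j powr (1 - P)) * ennreal (a j powr P))"
        by (intro mult_left_mono suminf_le int) auto
      also have "(\<lambda>j. ennreal (a j powr (1 - P)) * ennreal (a j powr P)) = (\<lambda>j. ennreal (a j))"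
        using a by (simp add: ennreal_mult[symmetric] powr_add[symmetric] less_imp_le)
      also have "(\<Sum>j. ennreal (a j)) = ennreal A"
        using a_sums a by (intro suminf_ennreal_eq) (auto simp: less_imp_le)
      also have "ennreal (A powr (P - 1)) * ennreal A = ennreal (A powr P)"
        using A0 by (simp add: ennreal_mult[symmetric] powr_diff)
      finally have "eLp M p (\<lambda>x. \<Sum>j. F j x) \<le> ennreal A"
        using A0 \<open>p \<noteq> \<infinity>\<close> by (subst eLp_le_iff[OF p]) (auto simp: P_def epowr_ennreal)
      also have "ennreal A = (\<Sum>j. eLp M p (F j)) + ennreal e"
        using n n_sum e by (simp add: A_def suminf_nonneg suminf_ennreal2)
      finally show "eLp M p (\<lambda>x. \<Sum>j. F j x) \<le> (\<Sum>j. eLp M p (F j)) + ennreal e" .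
    qed
  qed simp
qed

lemma eLp_sum_le:
  fixes F :: "'i \<Rightarrow> 'a \<Rightarrow> ennreal"
  assumes p: "1 \<le> p" and I: "finite I" and meas: "\<And>i. i \<in> I \<Longrightarrow> F i \<in> borel_measurable M"
  shows "eLp M p (\<lambda>x. \<Sum>i\<in>I. F i x) \<le> (\<Sum>i\<in>I. eLp M p (F i))"
proof -
  obtain h where h: "bij_betw h {..<card I} I"
    using ex_bij_betw_nat_finite[OF I] by (auto simp: atLeast0LessThan)
  define G where "G j = (if j < card I then F (h j) else (\<lambda>x. 0))" for j
  have hI: "h j \<in> I" if "j < card I" for j using h that by (auto simp: bij_betw_def)
  have "G j \<in> borel_measurable M" for j by (auto simp: G_def intro: meas hI)
  then have "eLp M p (\<lambda>x. \<Sum>j. G j x) \<le> (\<Sum>j. eLp M p (G j))"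
    by (intro eLp_suminf_le p)
  moreover have "(\<Sum>j. G j x) = (\<Sum>i\<in>I. F i x)" for x
    by (subst suminf_finite[of "{..<card I}"]) (auto simp: G_def sum.reindex_bij_betw[OF h, symmetric])
  moreover have "(\<Sum>j. eLp M p (G j)) = (\<Sum>i\<in>I. eLp M p (F i))"
    by (subst suminf_finite[of "{..<card I}"]) (auto simp: G_def sum.reindex_bij_betw[OF h, symmetric])
  ultimately show ?thesis by simp
qed

section \<open>Sums of dyadic off-diagonal factors\<close>

lemma Upsilon_ge_1: "0 < s \<Longrightarrow> 1 \<le> Upsilon s"
  by (cases "s \<le> 1") (auto simp: Upsilon_def le_max_iff_disj one_le_inverse)

lemma Upsilon_le_1: "0 < s \<Longrightarrow> s \<le> 1 \<Longrightarrow> Upsilon s = inverse s"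
  using one_le_inverse[of s] by (simp add: Upsilon_def)

lemma Upsilon_ge_1_eq: "1 \<le> s \<Longrightarrow> Upsilon s = s"
  using inverse_le_1_iff[of s] by (simp add: Upsilon_def)

lemma Upsilon_mult_le: "0 < s \<Longrightarrow> 0 < t \<Longrightarrow> Upsilon (s * t) \<le> Upsilon s * Upsilon t"
  unfolding Upsilon_def by (intro max.boundedI) (auto intro!: mult_mono)

lemma Upsilon_powr_mult_le:
  assumes "0 < s" "0 < t" "0 \<le> b"
  shows "Upsilon (s * t) powr b \<le> Upsilon s powr b * Upsilon t powr b"
proof -
  have "Upsilon (s * t) powr b \<le> (Upsilon s * Upsilon t) powr b"
    using assms Upsilon_ge_1[of "s * t"] by (intro powr_mono2 Upsilon_mult_le) auto
  also have "\<dots> = Upsilon s powr b * Upsilon t powr b"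
    by (rule powr_mult)
  finally show ?thesis .
qed

lemma two_power_mult_powr: "(2 ^ i * u) powr a = 2 powr (real i * a) * u powr a" for u a :: real
proof -
  have "(2 ^ i * u) powr a = (2 powr real i) powr a * u powr a"
    by (simp add: powr_mult powr_realpow)
  then show ?thesis by (simp add: powr_powr)
qed

text \<open>Decay at infinity gives the bound beyond some \<open>N\<close>, continuity gives it on
  the compact rest.\<close>

lemma powr_exp_bounded:
  fixes c m :: real
  assumes "0 < c"
  obtains K where "0 < K" "\<And>y. 1 \<le> y \<Longrightarrow> y powr m * exp (- (c * y\<^sup>2)) \<le> K"
proof -
  define h where "h y = y powr m * exp (- (c * y\<^sup>2))" for y
  have "(h \<longlongrightarrow> 0) at_top"
    unfolding h_def using assms by real_asymp
  then have "eventually (\<lambda>y. h y < 1) at_top"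
    by (rule order_tendstoD) simp
  then obtain N where N: "\<And>y. N \<le> y \<Longrightarrow> h y < 1"
    by (auto simp: eventually_at_top_linorder)
  have "continuous_on {1..max 1 N} h"
    unfolding h_def by (intro continuous_intros) auto
  then obtain z where z: "z \<in> {1..max 1 N}" "\<And>y. y \<in> {1..max 1 N} \<Longrightarrow> h y \<le> h z"
    using continuous_attains_sup[of "{1..max 1 N}" h] by auto
  have "h y \<le> max 1 (h z)" if "1 \<le> y" for y
    using z(2)[of y] N[of y] that by (cases "y \<le> max 1 N") (auto simp: le_max_iff_disj)
  then show ?thesis
    using that[of "max 1 (h z)"] by (auto simp: h_def)
qed

lemma sum_geometric_le:
  fixes q :: real
  assumes "0 \<le> q" "q < 1"
  shows "(\<Sum>i<n. q ^ i) \<le> 1 / (1 - q)"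
  using assms sum_le_suminf[OF summable_geometric[of q], of "{..<n}"] by (simp add: suminf_geometric)

text \<open>\<open>y\<^sup>d / (1 + y\<^sup>d)\<close> increases by at least a multiple of \<open>min y\<^sup>d y\<^sup>-\<^sup>d\<close> when \<open>y\<close> is doubled,
  so the sum telescopes.\<close>

lemma sum_min_powr_le:
  fixes d :: real
  assumes d: "0 < d"
  obtains K where "0 < K" "\<And>u n. 0 < u \<Longrightarrow> (\<Sum>i<n. min ((2 ^ i * u) powr d) ((2 ^ i * u) powr - d)) \<le> K"
proof -
  define w where "w = (2::real) powr d"
  have w: "1 < w" using d by (simp add: w_def)
  \<comment> \<open>The increment of \<open>g\<close> from z to w z has the factor w - 1, which
    cancels. Its denominator (1 + w z)(1 + z) is at most 2 (1 + w) for z \<le> 1 and at most 2 (1 +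
    w) z^2 for z > 1.\<close>
  define K where "K = 2 * (1 + w) / (w - 1)"
  have K: "0 < K" using w by (simp add: K_def)
  define g where "g z = z / (1 + z)" for z :: real
  have step: "min z (inverse z) \<le> K * (g (w * z) - g z)" if z: "0 < z" for z
  proof -
    have pos: "0 < 1 + w * z" "0 < 1 + z" using w z by (auto intro: add_pos_pos)
    have "g (w * z) - g z = (w - 1) * z / ((1 + w * z) * (1 + z))"
      using pos by (simp add: g_def field_simps)
    then have eq: "K * (g (w * z) - g z) = 2 * (1 + w) * z / ((1 + w * z) * (1 + z))"
      using w by (simp add: K_def)
    show ?thesis
    proof (cases "z \<le> 1")
      case True
      have "(1 + w * z) * (1 + z) \<le> (1 + w) * 2"
        using True w z by (intro mult_mono) auto
      then have "z \<le> 2 * (1 + w) * z / ((1 + w * z) * (1 + z))"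
        using pos z by (subst pos_le_divide_eq) (auto simp: mult.commute intro: mult_left_mono)
      then show ?thesis unfolding eq by simp
    next
      case False
      have "(1 + w * z) * (1 + z) \<le> ((1 + w) * z) * (2 * z)"
        using False w z by (intro mult_mono) (auto simp: algebra_simps)
      then have "inverse z * ((1 + w * z) * (1 + z)) \<le> inverse z * (((1 + w) * z) * (2 * z))"
        using z by (intro mult_left_mono) auto
      also have "\<dots> = 2 * (1 + w) * z" using z by (simp add: field_simps)
      finally have "inverse z \<le> 2 * (1 + w) * z / ((1 + w * z) * (1 + z))"
        using pos by (subst pos_le_divide_eq) auto
      then show ?thesis unfolding eq by simp
    qed
  qed
  have g_bounds: "0 \<le> g z" "g z \<le> 1" if "0 \<le> z" for z
    using that by (simp_all add: g_def)
  have "(\<Sum>i<n. min ((2 ^ i * u) powr d) ((2 ^ i * u) powr - d)) \<le> K" if u: "0 < u" for u n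
  proof -
    define G where "G i = g ((2 ^ i * u) powr d)" for i :: nat
    have "min ((2 ^ i * u) powr d) ((2 ^ i * u) powr - d) \<le> K * (G (Suc i) - G i)" for i
    proof -
      have "(2 ^ Suc i * u) powr d = w * (2 ^ i * u) powr d"
        using powr_mult[of 2 "2 ^ i * u" d] by (simp add: w_def mult.assoc)
      then show ?thesis
        using step[of "(2 ^ i * u) powr d"] u by (simp add: G_def powr_minus)
    qed
    then have "(\<Sum>i<n. min ((2 ^ i * u) powr d) ((2 ^ i * u) powr - d)) \<le> (\<Sum>i<n. K * (G (Suc i) - G i))"
      by (rule sum_mono)
    also have "\<dots> = K * (G n - G 0)"
      by (simp add: sum_distrib_left[symmetric] sum_lessThan_telescope)
    also have "\<dots> \<le> K * (1 - 0)"
      using K by (intro mult_left_mono diff_mono) (auto simp: G_def intro: g_bounds)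
    finally show ?thesis by simp
  qed
  with K show ?thesis using that by blast
qed

text \<open>For small u the terms with 2^i u \<le> 1 are about 2^(i (a - b)) u^(-b), and there are
  about log (1/u) of them. They add up to u^(-a) if a > b and to u^(-b) if a < b; for a = b all are
  equal and a logarithm appears, whence the last assumption. The Gaussian controls the terms with
  2^i u > 1.\<close>

lemma sum_Upsilon_le_aux:
  fixes a b c e :: real
  assumes "0 \<le> b" "0 < c" "a \<le> e" "b \<le> e" "a \<noteq> b \<or> a < e"
  obtains K where "0 < K" "\<And>u n. 0 < u \<Longrightarrow>
    (\<Sum>i<n. 2 powr (real i * a) * Upsilon (2 ^ i * u) powr b * exp (- (c * (2 ^ i * u)\<^sup>2))) \<le> K * Upsilon u powr e"
proof (cases "a < e")
  case True
  obtain K where K: "0 < K" "\<And>y. 1 \<le> y \<Longrightarrow> y powr (2 * e) * exp (- (c * y\<^sup>2)) \<le> K"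
    using powr_exp_bounded[OF \<open>0 < c\<close>] by blast
  have e: "0 \<le> e" using assms by simp
  \<comment> \<open>For y \<le> 1 the left factor is at most y^(-e) already; for y > 1 the Gaussian
    absorbs the surplus y^(2 e). The sum is then geometric with ratio 2^(a - e).\<close>
  have bd: "Upsilon y powr b * exp (- (c * y\<^sup>2)) \<le> (K + 1) * y powr - e" if y: "0 < y" for y
  proof -
    have "Upsilon y powr b * exp (- (c * y\<^sup>2)) \<le> Upsilon y powr e * exp (- (c * y\<^sup>2))"
      using assms Upsilon_ge_1[OF y] by (intro mult_right_mono powr_mono) auto
    also have "\<dots> \<le> (K + 1) * y powr - e"
    proof (cases "y \<le> 1")
      case True
      have "Upsilon y powr e * exp (- (c * y\<^sup>2)) \<le> y powr - e * 1"
        using True y \<open>0 < c\<close> by (intro mult_mono) (auto simp: Upsilon_le_1 powr_minus inverse_powr)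
      also have "\<dots> \<le> (K + 1) * y powr - e"
        using mult_right_mono[of 1 "K + 1" "y powr - e"] K by simp
      finally show ?thesis .
    next
      case False
      then have "Upsilon y powr e * exp (- (c * y\<^sup>2)) = y powr - e * (y powr (2 * e) * exp (- (c * y\<^sup>2)))"
        using y by (simp add: Upsilon_ge_1_eq powr_add[symmetric])
      also have "\<dots> \<le> y powr - e * K"
        using False by (intro mult_left_mono K) auto
      also have "\<dots> \<le> (K + 1) * y powr - e" by (simp add: algebra_simps)
      finally show ?thesis .
    qed
    finally show ?thesis .
  qed
  define q where "q = (2::real) powr (a - e)"
  have q: "0 < q" "q < 1"
    using True powr_less_one[of 2 "a - e"] by (auto simp: q_def)
  show ?thesis
  proof (rule that)
    show "0 < (K + 1) / (1 - q)" using K q by simp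
    fix u :: real and n :: nat
    assume u: "0 < u"
    have "(\<Sum>i<n. 2 powr (real i * a) * Upsilon (2 ^ i * u) powr b * exp (- (c * (2 ^ i * u)\<^sup>2)))
        \<le> (\<Sum>i<n. (K + 1) * u powr - e * q ^ i)"
    proof (rule sum_mono)
      fix i
      have "2 powr (real i * a) * Upsilon (2 ^ i * u) powr b * exp (- (c * (2 ^ i * u)\<^sup>2))
          \<le> 2 powr (real i * a) * ((K + 1) * (2 ^ i * u) powr - e)"
        unfolding mult.assoc using u by (intro mult_left_mono bd[unfolded mult.assoc]) auto
      also have "(2 ^ i * u) powr - e = 2 powr (- real i * e) * u powr - e"
        by (simp add: two_power_mult_powr)
      also have "2 powr (real i * a) * ((K + 1) * (2 powr (- real i * e) * u powr - e))
          = (K + 1) * u powr - e * (2 powr (real i * a) * 2 powr (- real i * e))"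
        by simp
      also have "2 powr (real i * a) * 2 powr (- real i * e) = q ^ i"
      proof -
        have "q ^ i = q powr real i" using q by (simp add: powr_realpow)
        also have "\<dots> = 2 powr ((a - e) * real i)" by (simp add: q_def powr_powr)
        finally show ?thesis by (simp add: powr_add[symmetric] algebra_simps)
      qed
      finally show "2 powr (real i * a) * Upsilon (2 ^ i * u) powr b * exp (- (c * (2 ^ i * u)\<^sup>2))
        \<le> (K + 1) * u powr - e * q ^ i" .
    qed
    also have "\<dots> = (K + 1) * u powr - e * (\<Sum>i<n. q ^ i)"
      by (simp add: sum_distrib_left)
    also have "\<dots> \<le> (K + 1) * Upsilon u powr e * (1 / (1 - q))"
    proof (intro mult_mono sum_geometric_le)
      show "u powr - e \<le> Upsilon u powr e"
        using u e powr_mono2[of e "inverse u" "Upsilon u"] by (simp add: Upsilon_def powr_minus inverse_powr)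
    qed (use q K in \<open>auto intro: sum_nonneg\<close>)
    finally show "(\<Sum>i<n. 2 powr (real i * a) * Upsilon (2 ^ i * u) powr b * exp (- (c * (2 ^ i * u)\<^sup>2)))
        \<le> (K + 1) / (1 - q) * Upsilon u powr e"
      by simp
  qed
next
  case False
  \<comment> \<open>What remains is b < a = e. Multiplied by u^a the terms depend on y = 2^i u alone
    and are dominated by the minimum of y^d and y^(-d), whose dyadic sums are bounded uniformly in
    u.\<close>
  define d where "d = a - b"
  have ae: "a = e" and d: "0 < d" using False assms by (auto simp: d_def)
  obtain K where K: "0 < K" "\<And>y. 1 \<le> y \<Longrightarrow> y powr (a + b + d) * exp (- (c * y\<^sup>2)) \<le> K"
    using powr_exp_bounded[OF \<open>0 < c\<close>] by blast
  obtain L where L: "0 < L" "\<And>u n. 0 < u \<Longrightarrow> (\<Sum>i<n. min ((2 ^ i * u) powr d) ((2 ^ i * u) powr - d)) \<le> L"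
    using sum_min_powr_le[OF d] by blast
  have bd: "y powr a * Upsilon y powr b * exp (- (c * y\<^sup>2)) \<le> (K + 1) * min (y powr d) (y powr - d)"
    if y: "0 < y" for y
  proof (cases "y \<le> 1")
    case True
    have "y powr a * Upsilon y powr b * exp (- (c * y\<^sup>2)) \<le> y powr d * 1"
      using True y \<open>0 < c\<close>
      by (intro mult_mono) (auto simp: Upsilon_le_1 inverse_powr d_def powr_diff divide_inverse)
    also have "\<dots> \<le> (K + 1) * y powr d"
      using mult_right_mono[of 1 "K + 1" "y powr d"] K by simp
    also have "y powr d = min (y powr d) (y powr - d)"
      using True y d powr_mono'[of "- d" d y] by simp
    finally show ?thesis .
  next
    case False
    then have "y powr a * Upsilon y powr b * exp (- (c * y\<^sup>2)) = y powr - d * (y powr (a + b + d) * exp (- (c * y\<^sup>2)))"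
      using y by (simp add: Upsilon_ge_1_eq powr_add powr_minus)
    also have "\<dots> \<le> y powr - d * K"
      using False by (intro mult_left_mono K) auto
    also have "\<dots> \<le> (K + 1) * y powr - d" by (simp add: algebra_simps)
    also have "y powr - d = min (y powr d) (y powr - d)"
      using False y d powr_mono[of "- d" d y] by simp
    finally show ?thesis .
  qed
  show ?thesis
  proof (rule that)
    show "0 < (K + 1) * L" using K L by simp
    fix u :: real and n :: nat
    assume u: "0 < u"
    have "(\<Sum>i<n. 2 powr (real i * a) * Upsilon (2 ^ i * u) powr b * exp (- (c * (2 ^ i * u)\<^sup>2)))
        = (\<Sum>i<n. u powr - a * ((2 ^ i * u) powr a * Upsilon (2 ^ i * u) powr b * exp (- (c * (2 ^ i * u)\<^sup>2))))"
    proof (intro sum.cong refl)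
      fix i
      have eq: "2 powr (real i * a) = u powr - a * (2 ^ i * u) powr a"
        using u by (simp add: two_power_mult_powr powr_minus)
      show "2 powr (real i * a) * Upsilon (2 ^ i * u) powr b * exp (- (c * (2 ^ i * u)\<^sup>2))
        = u powr - a * ((2 ^ i * u) powr a * Upsilon (2 ^ i * u) powr b * exp (- (c * (2 ^ i * u)\<^sup>2)))"
        by (simp only: eq mult.assoc)
    qed
    also have "\<dots> \<le> (\<Sum>i<n. u powr - a * ((K + 1) * min ((2 ^ i * u) powr d) ((2 ^ i * u) powr - d)))"
      using u by (intro sum_mono mult_left_mono bd) auto
    also have "\<dots> = u powr - a * ((K + 1) * (\<Sum>i<n. min ((2 ^ i * u) powr d) ((2 ^ i * u) powr - d)))"
      by (simp add: sum_distrib_left)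
    also have "\<dots> \<le> Upsilon u powr e * ((K + 1) * L)"
    proof (intro mult_mono L u)
      show "u powr - a \<le> Upsilon u powr e"
        using u ae assms powr_mono2[of e "inverse u" "Upsilon u"]
        by (simp add: Upsilon_def powr_minus inverse_powr)
    qed (use K u in \<open>auto intro!: sum_nonneg mult_nonneg_nonneg\<close>)
    finally show "(\<Sum>i<n. 2 powr (real i * a) * Upsilon (2 ^ i * u) powr b * exp (- (c * (2 ^ i * u)\<^sup>2)))
        \<le> (K + 1) * L * Upsilon u powr e"
      by (simp add: mult_ac)
  qed
qed

text \<open>Half of the exponent makes the series converge, the other half is kept.\<close>

lemma sum_Upsilon_le:
  fixes a b c e :: real
  assumes "0 \<le> b" "0 < c" "a \<le> e" "b \<le> e" "a \<noteq> b \<or> a < e"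
  obtains K where "0 < K" "\<And>u n. 0 < u \<Longrightarrow>
    (\<Sum>i<n. 2 powr (real i * a) * Upsilon (2 ^ i * u) powr b * exp (- (c * (2 ^ i * u)\<^sup>2)))
      \<le> K * Upsilon u powr e * exp (- (c / 2 * u\<^sup>2))"
proof -
  obtain K where K: "0 < K" "\<And>u n. 0 < u \<Longrightarrow>
    (\<Sum>i<n. 2 powr (real i * a) * Upsilon (2 ^ i * u) powr b * exp (- (c / 2 * (2 ^ i * u)\<^sup>2))) \<le> K * Upsilon u powr e"
    using sum_Upsilon_le_aux[of b "c / 2" a e] assms by auto
  show ?thesis
  proof (rule that[OF K(1)])
    fix u :: real and n :: nat
    assume u: "0 < u"
    have "(\<Sum>i<n. 2 powr (real i * a) * Upsilon (2 ^ i * u) powr b * exp (- (c * (2 ^ i * u)\<^sup>2)))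
        \<le> (\<Sum>i<n. 2 powr (real i * a) * Upsilon (2 ^ i * u) powr b * exp (- (c / 2 * (2 ^ i * u)\<^sup>2)) * exp (- (c / 2 * u\<^sup>2)))"
    proof (rule sum_mono)
      fix i
      have "u \<le> 2 ^ i * u" using u by simp
      then have "u\<^sup>2 \<le> (2 ^ i * u)\<^sup>2" using u by (intro power_mono) auto
      then have "c / 2 * u\<^sup>2 \<le> c / 2 * (2 ^ i * u)\<^sup>2" using \<open>0 < c\<close> by (intro mult_left_mono) auto
      then have "exp (- (c * (2 ^ i * u)\<^sup>2)) \<le> exp (- (c / 2 * (2 ^ i * u)\<^sup>2)) * exp (- (c / 2 * u\<^sup>2))"
        by (simp add: exp_add[symmetric] del: power_mult_distrib)
      then show "2 powr (real i * a) * Upsilon (2 ^ i * u) powr b * exp (- (c * (2 ^ i * u)\<^sup>2))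
        \<le> 2 powr (real i * a) * Upsilon (2 ^ i * u) powr b * exp (- (c / 2 * (2 ^ i * u)\<^sup>2)) * exp (- (c / 2 * u\<^sup>2))"
        unfolding mult.assoc[of "2 powr (real i * a) * Upsilon (2 ^ i * u) powr b"]
        by (rule mult_left_mono) auto
    qed
    also have "\<dots> = (\<Sum>i<n. 2 powr (real i * a) * Upsilon (2 ^ i * u) powr b * exp (- (c / 2 * (2 ^ i * u)\<^sup>2))) * exp (- (c / 2 * u\<^sup>2))"
      by (simp add: sum_distrib_right)
    also have "\<dots> \<le> K * Upsilon u powr e * exp (- (c / 2 * u\<^sup>2))"
      by (intro mult_right_mono K u) auto
    finally show "(\<Sum>i<n. 2 powr (real i * a) * Upsilon (2 ^ i * u) powr b * exp (- (c * (2 ^ i * u)\<^sup>2)))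
      \<le> K * Upsilon u powr e * exp (- (c / 2 * u\<^sup>2))" .
  qed
qed

section \<open>Doubling measures\<close>

text \<open>The case of a nonzero measure, where one may divide by the measure of a ball.
  \<open>C0\<close> is any doubling constant here; once the least one is inserted, \<open>D\<close>
  becomes the doubling order.\<close>

locale doubling_space =
  fixes M :: "'a::metric_space measure" and C0 :: real
  assumes sets_M [measurable_cong, simp]: "sets M = sets borel"
    and emeasure_ball_finite: "0 < r \<Longrightarrow> emeasure M (ball x r) < \<infinity>"
    and emeasure_ball_pos: "0 < r \<Longrightarrow> 0 < emeasure M (ball x r)"
    and emeasure_ball_double: "0 < r \<Longrightarrow> emeasure M (ball x (2 * r)) \<le> ennreal C0 * emeasure M (ball x r)"
    and C0_ge_1: "1 \<le> C0"
begin

definition vol :: "'a \<Rightarrow> real \<Rightarrow> real" where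
  "vol x r = measure M (ball x r)"

lemma emeasure_ball: "0 < r \<Longrightarrow> emeasure M (ball x r) = ennreal (vol x r)"
  unfolding vol_def using emeasure_ball_finite[of r x] by (intro emeasure_eq_ennreal_measure) auto

lemma vol_pos: "0 < r \<Longrightarrow> 0 < vol x r"
  using emeasure_ball_pos[of r x] emeasure_ball[of r x] by simp

lemma fmeasurable_ball: "0 < r \<Longrightarrow> ball x r \<in> fmeasurable M"
  using emeasure_ball_finite[of r x] by (intro fmeasurableI) auto

lemma vol_double: "0 < r \<Longrightarrow> vol x (2 * r) \<le> C0 * vol x r"
  using emeasure_ball_double[of r x] emeasure_ball[of r x] emeasure_ball[of "2 * r" x] C0_ge_1 vol_pos[of r x]
  by (simp add: ennreal_mult[symmetric])

lemma vol_dilate: "0 < r \<Longrightarrow> vol x (2 ^ m * r) \<le> C0 ^ m * vol x r"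
proof (induction m)
  case (Suc m)
  have "vol x (2 ^ Suc m * r) \<le> C0 * vol x (2 ^ m * r)"
    using vol_double[of "2 ^ m * r" x] Suc.prems by (simp add: mult.assoc)
  also have "\<dots> \<le> C0 * (C0 ^ m * vol x r)"
    using C0_ge_1 Suc by (intro mult_left_mono) auto
  finally show ?case by (simp add: mult.assoc)
qed simp

lemma ball_subset_ball_dist: "dist x y + b \<le> a \<Longrightarrow> ball x b \<subseteq> ball y a"
proof
  fix w assume "dist x y + b \<le> a" "w \<in> ball x b"
  then show "w \<in> ball y a" using dist_triangle[of y w x] by (simp add: dist_commute)
qed

lemma vol_change:
  assumes "0 < a" "0 < b" "dist x y + b \<le> 2 ^ m * a"
  shows "vol x b \<le> C0 ^ m * vol y a"
proof -
  have "vol x b \<le> vol y (2 ^ m * a)"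
    unfolding vol_def using assms ball_subset_ball_dist[OF assms(3)]
    by (intro measure_mono_fmeasurable fmeasurable_ball) auto
  also note vol_dilate[OF assms(1)]
  finally show ?thesis .
qed

section \<open>Separated sets and finite partitions of balls\<close>

definition separated :: "real \<Rightarrow> 'a set \<Rightarrow> bool" where
  "separated \<epsilon> Z \<longleftrightarrow> (\<forall>u\<in>Z. \<forall>v\<in>Z. u \<noteq> v \<longrightarrow> \<epsilon> \<le> dist u v)"

text \<open>A volume count. The balls of radius \<epsilon>/2 about the points of \<open>Z\<close>
  are disjoint and lie in \<open>ball y R\<close> with R = 2^(k+1) \<epsilon>. Conversely
  \<open>ball y R\<close> lies in the dilate of each of them by 2^(k+3), so each has at least the
  fraction C0^(-(k+3)) of its volume.\<close>

lemma card_separated_le: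
  assumes e: "0 < \<epsilon>" and Z: "finite Z" "Z \<subseteq> ball y (2 ^ k * \<epsilon>)" "separated \<epsilon> Z"
  shows "real (card Z) \<le> C0 ^ (k + 3)"
proof -
  define R where "R = 2 ^ (k + 1) * \<epsilon>"
  have R: "0 < R" using e by (simp add: R_def)
  have "disjoint_family_on (\<lambda>z. ball z (\<epsilon> / 2)) Z"
    unfolding disjoint_family_on_def
  proof (intro ballI impI)
    fix u v assume "u \<in> Z" "v \<in> Z" "u \<noteq> v"
    then have "\<epsilon> \<le> dist u v" using Z(3) by (auto simp: separated_def)
    then show "ball u (\<epsilon> / 2) \<inter> ball v (\<epsilon> / 2) = {}"
      by (auto simp: disjoint_ballI)
  qed
  then have "(\<Sum>z\<in>Z. vol z (\<epsilon> / 2)) = measure M (\<Union>z\<in>Z. ball z (\<epsilon> / 2))"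
    unfolding vol_def using Z(1) e fmeasurable_ball emeasure_ball_finite
    by (subst measure_finite_Union) (auto simp: less_top)
  also have "\<dots> \<le> vol y R"
    unfolding vol_def
  proof (rule measure_mono_fmeasurable)
    show "(\<Union>z\<in>Z. ball z (\<epsilon> / 2)) \<subseteq> ball y R"
    proof (intro UN_least ball_subset_ball_dist)
      fix z assume "z \<in> Z"
      then have "dist z y < 2 ^ k * \<epsilon>" using Z(2) by (auto simp: dist_commute)
      moreover have "\<epsilon> \<le> 2 ^ k * \<epsilon>" using e by simp
      moreover have "R = 2 * (2 ^ k * \<epsilon>)" by (simp add: R_def)
      ultimately show "dist z y + \<epsilon> / 2 \<le> R" using e by linarith
    qed
    show "(\<Union>z\<in>Z. ball z (\<epsilon> / 2)) \<in> sets M" using Z(1) by (intro sets.finite_UN) auto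
  qed (use R fmeasurable_ball in auto)
  finally have le: "(\<Sum>z\<in>Z. vol z (\<epsilon> / 2)) \<le> vol y R" .
  have "real (card Z) * vol y R = (\<Sum>z\<in>Z. vol y R)" by simp
  also have "\<dots> \<le> (\<Sum>z\<in>Z. C0 ^ (k + 3) * vol z (\<epsilon> / 2))"
  proof (intro sum_mono vol_change)
    fix z assume "z \<in> Z"
    then have "dist y z < 2 ^ k * \<epsilon>" using Z(2) by auto
    moreover have "2 ^ (k + 3) * (\<epsilon> / 2) = 4 * (2 ^ k * \<epsilon>)" "R = 2 * (2 ^ k * \<epsilon>)"
      by (simp_all add: power_add R_def)
    moreover have "0 < 2 ^ k * \<epsilon>" using e by simp
    ultimately show "dist y z + R \<le> 2 ^ (k + 3) * (\<epsilon> / 2)" by linarith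
  qed (use e R in auto)
  also have "\<dots> = C0 ^ (k + 3) * (\<Sum>z\<in>Z. vol z (\<epsilon> / 2))" by (simp add: sum_distrib_left)
  also have "\<dots> \<le> C0 ^ (k + 3) * vol y R" using le C0_ge_1 by (intro mult_left_mono) auto
  finally show ?thesis using vol_pos[OF R, of y] by simp
qed

text \<open>The volume count bounds the size of separated subsets of the ball, so one with the most
  points exists, and by maximality its \<epsilon>-balls cover. Removing from each the preceding ones
  makes the pieces disjoint.\<close>

lemma ball_partition:
  assumes e: "0 < \<epsilon>"
  obtains n :: nat and z D where
    "inj_on z {..<n}" "z ` {..<n} \<subseteq> ball x R" "separated \<epsilon> (z ` {..<n})"
    "\<And>i. i < n \<Longrightarrow> D i \<in> sets M" "\<And>i. i < n \<Longrightarrow> D i \<subseteq> ball (z i) \<epsilon>"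
    "disjoint_family_on D {..<n}" "ball x R = (\<Union>i<n. D i)"
proof -
  define P where "P Z \<longleftrightarrow> finite Z \<and> Z \<subseteq> ball x R \<and> separated \<epsilon> Z" for Z
  obtain k where "R / \<epsilon> < 2 ^ k" using real_arch_pow[of 2 "R / \<epsilon>"] by auto
  then have "R \<le> 2 ^ k * \<epsilon>" using e by (simp add: field_simps)
  then have "ball x R \<subseteq> ball x (2 ^ k * \<epsilon>)" by (rule subset_ball)
  then have "real (card Z) \<le> C0 ^ (k + 3)" if "P Z" for Z
    using card_separated_le[OF e, of Z x k] that by (auto simp: P_def)
  then have "card Z < Suc (nat \<lfloor>C0 ^ (k + 3)\<rfloor>)" if "P Z" for Z
    using that by (simp add: le_nat_floor less_Suc_eq_le)
  moreover have "P {}" by (simp add: P_def separated_def)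
  ultimately obtain Z where Z: "P Z" and max: "\<And>Y. P Y \<Longrightarrow> card Y \<le> card Z"
    using ex_has_greatest_nat[of P "{}" card] by blast
  have cover: "ball x R \<subseteq> (\<Union>z\<in>Z. ball z \<epsilon>)"
  proof
    fix w assume w: "w \<in> ball x R"
    show "w \<in> (\<Union>z\<in>Z. ball z \<epsilon>)"
    proof (rule ccontr)
      assume "w \<notin> (\<Union>z\<in>Z. ball z \<epsilon>)"
      then have far: "\<epsilon> \<le> dist z w" if "z \<in> Z" for z using that by (auto simp: not_less)
      have "w \<notin> Z" using far e by force
      moreover have "P (insert w Z)"
        using Z w far by (auto simp: P_def separated_def dist_commute)
      ultimately show False using max[of "insert w Z"] Z by (simp add: P_def)
    qed
  qed
  obtain z where z: "bij_betw z {..<card Z} Z"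
    using ex_bij_betw_nat_finite[of Z] Z by (auto simp: atLeast0LessThan P_def)
  define A where "A i = ball (z i) \<epsilon> \<inter> ball x R" for i
  have img: "z ` {..<card Z} = Z" using z by (simp add: bij_betw_def)
  show ?thesis
  proof (rule that[of z "card Z" "disjointed A"])
    show "inj_on z {..<card Z}" using z by (simp add: bij_betw_def)
    show "z ` {..<card Z} \<subseteq> ball x R" "separated \<epsilon> (z ` {..<card Z})"
      using Z img by (auto simp: P_def)
    have "range A \<subseteq> sets M" by (auto simp: A_def)
    then show "disjointed A i \<in> sets M" for i
      using sets.range_disjointed_sets[of A M] by auto
    show "disjointed A i \<subseteq> ball (z i) \<epsilon>" for i
      using disjointed_subset[of A i] by (auto simp: A_def)
    show "disjoint_family_on (disjointed A) {..<card Z}"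
      using disjoint_family_disjointed[of A] by (auto simp: disjoint_family_on_def)
    have "(\<Union>i<card Z. disjointed A i) = (\<Union>i<card Z. A i)"
      using finite_UN_disjointed_eq[of A "card Z"] by (simp add: atLeast0LessThan)
    also have "\<dots> = (\<Union>w\<in>z ` {..<card Z}. ball w \<epsilon>) \<inter> ball x R" by (auto simp: A_def)
    also have "\<dots> = ball x R" using cover img by auto
    finally show "ball x R = (\<Union>i<card Z. disjointed A i)" ..
  qed
qed

section \<open>Averages and changes of the normalising ball\<close>

definition rvol :: "ennreal \<Rightarrow> 'a \<Rightarrow> real \<Rightarrow> real" where
  "rvol p x r = (if p = \<infinity> then 1 else vol x r powr (1 / enn2real p))"

text \<open>\<open>Lp_average\<close> with the normalisation taken out of the root, as the factor
  \<open>rvol\<close>, which is 1 for p = \<infinity>. The set of integration and the normalising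
  ball then vary independently, and most arguments do not distinguish finite from infinite
  p.\<close>

definition avg :: "ennreal \<Rightarrow> 'a \<Rightarrow> real \<Rightarrow> 'a set \<Rightarrow> ('a \<Rightarrow> 'b::real_normed_vector) \<Rightarrow> ennreal" where
  "avg p x r E f = eLp M p (\<lambda>y. indicator E y * ennreal (norm (f y))) / ennreal (rvol p x r)"

definition D :: real where "D = log 2 C0"

lemma D_nonneg: "0 \<le> D"
  using C0_ge_1 by (simp add: D_def)

lemma C0_eq: "C0 = 2 powr D"
  using C0_ge_1 by (simp add: D_def)

lemma rvol_pos: "0 < r \<Longrightarrow> 0 < rvol p x r"
  using vol_pos[of r x] by (simp add: rvol_def)

lemma Lp_average_eq_avg:
  assumes "0 < r" "1 \<le> p"
  shows "Lp_average M p (ball x r) E f = avg p x r E f"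
proof (cases "p = \<infinity>")
  case True
  then show ?thesis by (simp add: Lp_average_def avg_def eLp_def rvol_def mult.commute divide_ennreal_def)
next
  case False
  then have P: "0 < enn2real p" using enn2real_pos_exponent[OF assms(2)] by simp
  have "ennreal (norm (f y) powr enn2real p) * indicator E y = epowr (indicator E y * ennreal (norm (f y))) (enn2real p)" for y
    by (auto simp: indicator_def epowr_ennreal)
  then show ?thesis
    using False P assms(1) vol_pos[of r x]
    by (simp add: Lp_average_def avg_def eLp_def rvol_def emeasure_ball epowr_divide)
qed

lemma avg_le_multI:
  assumes r: "0 < r" "0 < s" and c: "0 \<le> c" "rvol p y s \<le> c * rvol p x r"
  shows "avg p x r E f \<le> ennreal c * avg p y s E f"
proof -
  note pos = rvol_pos[OF r(1), of p x] rvol_pos[OF r(2), of p y]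
  have le: "ennreal (1 / rvol p x r) \<le> ennreal (c * (1 / rvol p y s))"
    using pos c by (intro ennreal_leI) (simp add: field_simps)
  have "ennreal (1 / rvol p x r) * e \<le> ennreal c * (ennreal (1 / rvol p y s) * e)" for e
  proof -
    have "ennreal c * (ennreal (1 / rvol p y s) * e) = ennreal (c * (1 / rvol p y s)) * e"
      using c pos by (subst mult.assoc[symmetric], subst ennreal_mult[symmetric]) auto
    with le show ?thesis by (simp add: mult_right_mono)
  qed
  moreover have "e / ennreal v = ennreal (1 / v) * e" if "0 < v" for e v
    using that by (simp add: divide_ennreal_def inverse_ennreal inverse_eq_divide mult.commute)
  ultimately show ?thesis using pos by (simp add: avg_def)
qed

text \<open>The root (C0^m)^(1/p) is estimated by C0^m, as 1/p is at most 1. This is crude but free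
  of p, and adequate wherever m is a fixed small number.\<close>

lemma avg_change:
  assumes p: "1 \<le> p" and "0 < a" "0 < b" "dist x y + b \<le> 2 ^ m * a"
  shows "avg p y a E f \<le> ennreal (C0 ^ m) * avg p x b E f"
proof (rule avg_le_multI)
  show "rvol p x b \<le> C0 ^ m * rvol p y a"
  proof (cases "p = \<infinity>")
    case False
    define q where "q = 1 / enn2real p"
    have q: "0 < q" "q \<le> 1" using enn2real_pos_exponent[OF p False] by (auto simp: q_def)
    have "vol x b powr q \<le> (C0 ^ m * vol y a) powr q"
      using q vol_change[OF assms(2-4)] vol_pos[OF assms(3), of x] by (intro powr_mono2) auto
    also have "\<dots> = (C0 ^ m) powr q * vol y a powr q"
      by (rule powr_mult)
    also have "\<dots> \<le> (C0 ^ m) powr 1 * vol y a powr q"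
      using q C0_ge_1 by (intro mult_right_mono powr_mono) auto
    finally show ?thesis using False C0_ge_1 by (simp add: rvol_def q_def)
  qed (use C0_ge_1 in \<open>simp add: rvol_def\<close>)
qed (use assms C0_ge_1 in auto)

lemma avg_superball:
  assumes "1 \<le> p" "0 < b" "dist x y + b \<le> a"
  shows "avg p y a E f \<le> avg p x b E f"
  using avg_change[of p a b x y 0 E f] assms zero_le_dist[of x y] by simp

text \<open>For unbounded m the factor C0^(m/p) = 2^(m D/p) has to be kept exactly. It is the source
  of D/r in the first exponent of the composition.\<close>

lemma avg_dilate:
  assumes p: "1 \<le> p" and r: "0 < r"
  shows "avg p x r E f \<le> ennreal (2 powr (real m * dim_quot D p)) * avg p x (2 ^ m * r) E f"
proof (rule avg_le_multI)
  show "rvol p x (2 ^ m * r) \<le> 2 powr (real m * dim_quot D p) * rvol p x r"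
  proof (cases "p = \<infinity>")
    case False
    define q where "q = 1 / enn2real p"
    have q: "0 < q" using enn2real_pos_exponent[OF p False] by (auto simp: q_def)
    have "vol x (2 ^ m * r) powr q \<le> (C0 ^ m * vol x r) powr q"
      using q vol_dilate[OF r] vol_pos[of "2 ^ m * r" x] r by (intro powr_mono2) auto
    also have "\<dots> = (C0 ^ m) powr q * vol x r powr q"
      by (rule powr_mult)
    also have "(C0 ^ m) powr q = 2 powr (real m * dim_quot D p)"
    proof -
      have "C0 ^ m = C0 powr real m" using C0_ge_1 by (simp add: powr_realpow)
      also have "\<dots> = (2 powr D) powr real m" by (simp add: C0_eq[symmetric])
      also have "\<dots> = 2 powr (real m * D)" by (simp add: powr_powr mult.commute)
      finally show ?thesis using False by (simp add: powr_powr dim_quot_def q_def)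
    qed
    finally show ?thesis using False by (simp add: rvol_def q_def)
  qed (simp add: rvol_def dim_quot_def)
qed (use r in auto)

text \<open>Minkowski's inequality for a domination that is known on \<open>E\<close> only, each
  summand carrying its own region \<open>F i\<close>. This adds up estimates that live on balls or
  shells with different centres.\<close>

lemma avg_le_sum:
  assumes p: "1 \<le> p" and r: "0 < r" and I: "finite I"
    and [measurable]: "f \<in> borel_measurable M" "E \<in> sets M"
    and gm: "\<And>i. i \<in> I \<Longrightarrow> g i \<in> borel_measurable M" "\<And>i. i \<in> I \<Longrightarrow> F i \<in> sets M"
    and le: "AE y in M. y \<in> E \<longrightarrow> norm (f y) \<le> (\<Sum>i\<in>I. indicator (F i) y * norm (g i y))"
  shows "avg p x r E f \<le> (\<Sum>i\<in>I. avg p x r (F i) (g i))"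
proof -
  have "AE y in M. indicator E y * ennreal (norm (f y)) \<le> (\<Sum>i\<in>I. indicator (F i) y * ennreal (norm (g i y)))"
    using le
  proof eventually_elim
    case (elim y)
    have "(\<Sum>i\<in>I. indicator (F i) y * ennreal (norm (g i y))) = ennreal (\<Sum>i\<in>I. indicator (F i) y * norm (g i y))"
      by (subst sum_ennreal[symmetric]) (auto simp: indicator_mult_ennreal)
    with elim show ?case by (auto simp: indicator_def intro: ennreal_leI)
  qed
  then have "eLp M p (\<lambda>y. indicator E y * ennreal (norm (f y)))
      \<le> eLp M p (\<lambda>y. \<Sum>i\<in>I. indicator (F i) y * ennreal (norm (g i y)))"
    by (intro eLp_mono_AE p) measurable
  also have "\<dots> \<le> (\<Sum>i\<in>I. eLp M p (\<lambda>y. indicator (F i) y * ennreal (norm (g i y))))"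
  proof (intro eLp_sum_le p I)
    fix i assume "i \<in> I"
    note [measurable] = gm[OF this]
    show "(\<lambda>y. indicator (F i) y * ennreal (norm (g i y))) \<in> borel_measurable M"
      by measurable
  qed
  finally show ?thesis
    unfolding avg_def using rvol_pos[OF r, of p x]
    by (auto simp: divide_ennreal_def sum_distrib_right[symmetric] intro: mult_right_mono)
qed

lemma avg_mono:
  assumes "1 \<le> p" "0 < r" "f \<in> borel_measurable M" "E \<in> sets M" "F \<in> sets M" "E \<subseteq> F"
  shows "avg p x r E f \<le> avg p x r F f"
proof -
  have "AE y in M. y \<in> E \<longrightarrow> norm (f y) \<le> (\<Sum>i\<in>{()}. indicator F y * norm (f y))"
    using assms(6) by (intro AE_I2) auto
  from avg_le_sum[OF assms(1,2) _ assms(3,4) _ _ this] assms show ?thesis by simp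
qed

lemma avg_suminf_le:
  fixes f g0 :: "'a \<Rightarrow> 'b::real_normed_vector" and g :: "nat \<Rightarrow> 'a \<Rightarrow> 'b"
  assumes p: "1 \<le> p" and r: "0 < r"
    and [measurable]: "f \<in> borel_measurable M" "E \<in> sets M" "g0 \<in> borel_measurable M"
      "\<And>i. g i \<in> borel_measurable M"
    and le: "AE y in M. ennreal (norm (f y)) \<le> ennreal (norm (g0 y)) + (\<Sum>i. ennreal (norm (g i y)))"
  shows "avg p x r E f \<le> avg p x r E g0 + (\<Sum>i. avg p x r E (g i))"
proof -
  define h where "h j = (case j of 0 \<Rightarrow> g0 | Suc i \<Rightarrow> g i)" for j
  have [measurable]: "h j \<in> borel_measurable M" for j
    by (cases j) (auto simp: h_def)
  have "AE y in M. indicator E y * ennreal (norm (f y)) \<le> (\<Sum>j. indicator E y * ennreal (norm (h j y)))"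
    using le
  proof eventually_elim
    case (elim y)
    then show ?case
      unfolding ennreal_suminf_cmult by (subst suminf_ennreal_Suc_shift) (auto simp: h_def intro: mult_left_mono)
  qed
  then have "eLp M p (\<lambda>y. indicator E y * ennreal (norm (f y)))
      \<le> eLp M p (\<lambda>y. \<Sum>j. indicator E y * ennreal (norm (h j y)))"
    by (intro eLp_mono_AE p) measurable
  also have "\<dots> \<le> (\<Sum>j. eLp M p (\<lambda>y. indicator E y * ennreal (norm (h j y))))"
    by (intro eLp_suminf_le p) measurable
  finally have "avg p x r E f \<le> (\<Sum>j. avg p x r E (h j))"
    unfolding avg_def ennreal_suminf_divide by (rule divide_right_mono_ennreal)
  also have "\<dots> = avg p x r E g0 + (\<Sum>i. avg p x r E (g i))"
    by (subst suminf_ennreal_Suc_shift) (simp add: h_def)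
  finally show ?thesis .
qed

end

section \<open>Off-diagonal estimates at a fixed scale\<close>

lemma ennreal_mult_le_trans:
  assumes "x \<le> ennreal k * y" "y \<le> ennreal l * z" "0 \<le> k" "k * l \<le> m"
  shows "x \<le> ennreal m * z"
proof -
  have "x \<le> ennreal k * (ennreal l * z)"
    using assms(1,2) by (meson mult_left_mono order_trans zero_le)
  also have "\<dots> = ennreal (k * l) * z" using assms(3) by (simp add: ennreal_mult' mult.assoc)
  also have "\<dots> \<le> ennreal m * z" using assms(4) by (intro mult_right_mono ennreal_leI) auto
  finally show ?thesis .
qed

lemma ennreal_mult_le_trans1:
  assumes "x \<le> ennreal k * y" "y \<le> z" "k \<le> m"
  shows "x \<le> ennreal m * z"
  using assms by (meson ennreal_leI mult_mono order_trans zero_le)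

lemma sum_ennreal_mult_const:
  "0 \<le> A \<Longrightarrow> (\<Sum>i\<in>I. ennreal A * Z) = ennreal (real (card I) * A) * Z"
  by (simp add: ennreal_of_nat_eq_real_of_nat ennreal_mult mult.assoc)

lemma ennreal_suminf_le_mult:
  fixes X :: "nat \<Rightarrow> ennreal"
  assumes "\<And>i. X i \<le> ennreal (t i) * Z" "\<And>i. 0 \<le> t i" "\<And>n. (\<Sum>i<n. t i) \<le> S"
  shows "(\<Sum>i. X i) \<le> ennreal S * Z"
proof -
  have "(\<Sum>i<n. X i) \<le> ennreal S * Z" for n
  proof -
    have "(\<Sum>i<n. X i) \<le> (\<Sum>i<n. ennreal (t i) * Z)" by (intro sum_mono assms)
    also have "\<dots> = ennreal (\<Sum>i<n. t i) * Z"
      using assms(2) by (simp add: sum_distrib_right[symmetric])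
    also have "\<dots> \<le> ennreal S * Z" by (intro mult_right_mono ennreal_leI assms) auto
    finally show ?thesis .
  qed
  then show ?thesis by (simp add: suminf_eq_SUP SUP_le_iff)
qed

text \<open>Parametrised by the inner radius instead of a ball and an index, because the same set
  occurs as an annulus of several concentric balls.\<close>

definition shell :: "'a::metric_space \<Rightarrow> real \<Rightarrow> 'a set" where
  "shell x r = ball x (2 * r) - ball x r"

definition supp_in :: "'a set \<Rightarrow> ('a \<Rightarrow> 'b::zero) \<Rightarrow> bool" where
  "supp_in E f \<longleftrightarrow> (\<forall>y. y \<notin> E \<longrightarrow> f y = 0)"

text \<open>The off-diagonal factor at u = 2^j r / \<tau>, with j and u as separate arguments: in a
  product of two such factors at the same j and u the parameters simply add.\<close>

definition wt :: "real \<Rightarrow> real \<Rightarrow> real \<Rightarrow> nat \<Rightarrow> real \<Rightarrow> real" where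
  "wt a b c j u = 2 powr (real j * a) * Upsilon u powr b * exp (- (c * u\<^sup>2))"

lemma wt_nonneg [simp]: "0 \<le> wt a b c j u"
  by (simp add: wt_def)

lemma annulus_eq_shell: "annulus x r j = shell x (2 ^ j * r)"
  by (simp add: annulus_def shell_def mult.assoc)

lemma supp_in_trunc [simp]: "supp_in E (trunc E f)"
  by (simp add: supp_in_def trunc_def)

lemma supp_in_mono: "supp_in E f \<Longrightarrow> E \<subseteq> F \<Longrightarrow> supp_in F f"
  by (auto simp: supp_in_def)

lemma supp_in_trunc_eq: "supp_in E f \<Longrightarrow> trunc E f = f"
  by (auto simp: supp_in_def trunc_def fun_eq_iff indicator_def)

lemma shell_subset_ball: "shell x r \<subseteq> ball x (2 * r)"
  by (auto simp: shell_def)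

lemma sets_shell [measurable, simp]: "shell x r \<in> sets borel"
  by (simp add: shell_def)

context doubling_space
begin

lemma avg_trunc: "avg p x r UNIV (trunc E f) = avg p x r E f"
  for f :: "'a \<Rightarrow> 'b::real_normed_field"
proof -
  have "(\<lambda>y. indicator UNIV y * ennreal (norm (trunc E f y))) = (\<lambda>y. indicator E y * ennreal (norm (f y)))"
    by (auto simp: trunc_def indicator_def)
  then show ?thesis unfolding avg_def by simp
qed

text \<open>\<open>K\<close> and \<open>c\<close> are explicit arguments, since uniformity in t
  means that they do not depend on \<tau>. The first admissible index \<open>k\<close> is 2 by
  hypothesis and 1 after the covering argument.\<close>

definition od_estimates :: "ennreal \<Rightarrow> ennreal \<Rightarrow> nat \<Rightarrow> real \<Rightarrow> real \<Rightarrow> real \<Rightarrow> real \<Rightarrow> real \<Rightarrow>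
    ('a \<Rightarrow> 'b::real_normed_vector) set \<Rightarrow> (('a \<Rightarrow> 'b) \<Rightarrow> 'a \<Rightarrow> 'b) \<Rightarrow> bool" where
  "od_estimates p q k a b K c \<tau> V T \<longleftrightarrow>
     (\<forall>x r f. 0 < r \<longrightarrow> f \<in> V \<longrightarrow> supp_in (ball x r) f \<longrightarrow>
        avg q x r (ball x r) (T f) \<le> ennreal (K * Upsilon (r / \<tau>) powr b) * avg p x r UNIV f) \<and>
     (\<forall>x r j f. 0 < r \<longrightarrow> k \<le> j \<longrightarrow> f \<in> V \<longrightarrow> supp_in (shell x (2 ^ j * r)) f \<longrightarrow>
        avg q x r (ball x r) (T f)
          \<le> ennreal (K * wt a b c j (2 ^ j * r / \<tau>)) * avg p x (2 * (2 ^ j * r)) UNIV f) \<and>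
     (\<forall>x r j f. 0 < r \<longrightarrow> k \<le> j \<longrightarrow> f \<in> V \<longrightarrow> supp_in (ball x r) f \<longrightarrow>
        avg q x (2 * (2 ^ j * r)) (shell x (2 ^ j * r)) (T f)
          \<le> ennreal (K * wt a b c j (2 ^ j * r / \<tau>)) * avg p x r UNIV f)"

end

text \<open>One member of the family. \<open>T_zero\<close> is homogeneity with the scalar 0 and
  starts the induction over finite sums.\<close>

locale sublinear_operator = doubling_space M C0
  for M :: "'a::metric_space measure" and C0 +
  fixes V :: "('a \<Rightarrow> 'b::{real_normed_field, second_countable_topology}) set"
    and T :: "('a \<Rightarrow> 'b) \<Rightarrow> 'a \<Rightarrow> 'b"
  assumes V_measurable: "f \<in> V \<Longrightarrow> f \<in> borel_measurable M"
    and V_zero: "(\<lambda>x. 0) \<in> V"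
    and V_add: "f \<in> V \<Longrightarrow> g \<in> V \<Longrightarrow> (\<lambda>x. f x + g x) \<in> V"
    and V_trunc: "f \<in> V \<Longrightarrow> E \<in> sets borel \<Longrightarrow> trunc E f \<in> V"
    and T_measurable: "f \<in> V \<Longrightarrow> T f \<in> borel_measurable M"
    and T_zero: "AE y in M. T (\<lambda>x. 0) y = 0"
    and T_add: "f \<in> V \<Longrightarrow> g \<in> V \<Longrightarrow>
      AE y in M. norm (T (\<lambda>x. f x + g x) y) \<le> norm (T f y) + norm (T g y)"
begin

lemma T_sum:
  assumes "finite I" "\<And>i. i \<in> I \<Longrightarrow> f i \<in> V"
  shows "(\<lambda>x. \<Sum>i\<in>I. f i x) \<in> V \<and> (AE y in M. norm (T (\<lambda>x. \<Sum>i\<in>I. f i x) y) \<le> (\<Sum>i\<in>I. norm (T (f i) y)))"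
  using assms
proof (induction I rule: finite_induct)
  case empty
  then show ?case using V_zero T_zero by (auto elim!: eventually_mono)
next
  case (insert i I)
  then have V: "f i \<in> V" "(\<lambda>x. \<Sum>i\<in>I. f i x) \<in> V"
    and AE: "AE y in M. norm (T (\<lambda>x. \<Sum>i\<in>I. f i x) y) \<le> (\<Sum>i\<in>I. norm (T (f i) y))"
    by auto
  have "AE y in M. norm (T (\<lambda>x. f i x + (\<Sum>i\<in>I. f i x)) y) \<le> norm (T (f i) y) + (\<Sum>i\<in>I. norm (T (f i) y))"
    using T_add[OF V] AE by eventually_elim simp
  then show ?case using V_add[OF V] insert.hyps by simp
qed

lemma T_partition:
  assumes I: "finite I" and f: "f \<in> V" "supp_in (\<Union>i\<in>I. A i) f"
    and A: "\<And>i. i \<in> I \<Longrightarrow> A i \<in> sets borel" "disjoint_family_on A I"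
  shows "AE y in M. norm (T f y) \<le> (\<Sum>i\<in>I. norm (T (trunc (A i) f) y))"
proof -
  have "(\<Sum>i\<in>I. trunc (A i) f x) = f x" for x
  proof -
    have "(\<Sum>i\<in>I. trunc (A i) f x) = (\<Sum>i\<in>I. indicator (A i) x) * f x"
      by (simp add: trunc_def sum_distrib_right)
    also have "(\<Sum>i\<in>I. indicator (A i) x) = (indicator (\<Union>i\<in>I. A i) x :: 'b)"
      using I A(2) by (simp add: indicator_UN_disjoint)
    also have "\<dots> * f x = f x" using f(2) by (auto simp: supp_in_def indicator_def)
    finally show ?thesis .
  qed
  then show ?thesis using T_sum[OF I, of "\<lambda>i. trunc (A i) f"] V_trunc[OF f(1) A(1)] by auto
qed

end

locale od_operator = sublinear_operator M C0 V T
  for M :: "'a::metric_space measure" and C0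
    and V :: "('a \<Rightarrow> 'b::{real_normed_field, second_countable_topology}) set" and T +
  fixes p q :: ennreal and a b K c \<tau> :: real
  assumes p: "1 \<le> p" and q: "1 \<le> q" and pos: "0 < a" "0 < b" "0 < K" "0 < c" "0 < \<tau>"
    and od: "od_estimates p q 2 a b K c \<tau> V T"
begin

section \<open>Estimates between a ball and the adjacent shell\<close>

lemma on_diag:
  assumes "0 < r" "f \<in> V" "supp_in (ball x r) f"
  shows "avg q x r (ball x r) (T f) \<le> ennreal (K * Upsilon (r / \<tau>) powr b) * avg p x r UNIV f"
  using od assms unfolding od_estimates_def by blast

lemma off_in_2:
  assumes "0 < r" "2 \<le> j" "f \<in> V" "supp_in (shell x (2 ^ j * r)) f"
  shows "avg q x r (ball x r) (T f)
    \<le> ennreal (K * wt a b c j (2 ^ j * r / \<tau>)) * avg p x (2 * (2 ^ j * r)) UNIV f"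
  using od assms unfolding od_estimates_def by blast

lemma off_out_2:
  assumes "0 < r" "2 \<le> j" "f \<in> V" "supp_in (ball x r) f"
  shows "avg q x (2 * (2 ^ j * r)) (shell x (2 ^ j * r)) (T f)
    \<le> ennreal (K * wt a b c j (2 ^ j * r / \<tau>)) * avg p x r UNIV f"
  using od assms unfolding od_estimates_def by blast

text \<open>The 3 counts the indices 2, 3, 4 of the shells about each small ball. Of C0^10, one half
  bounds the number of small balls and the other the changes of the normalising ball; the remaining
  powers come from \<open>wt_near_le\<close>.\<close>

definition K1 :: real where "K1 = 3 * C0 ^ 10 * (2 powr (4 * a) * 2 powr b) * K"

lemma K1_ge: "K \<le> K1"
proof -
  have "1 \<le> (2::real) powr (4 * a)" "1 \<le> (2::real) powr b"
    using pos by (auto intro: ge_one_powr_ge_zero)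
  then have "1 * 1 \<le> 2 powr (4 * a) * (2::real) powr b" by (intro mult_mono) auto
  then have "1 * 1 \<le> 3 * C0 ^ 10 * (2 powr (4 * a) * 2 powr b)"
    using one_le_power[OF C0_ge_1, of 10] by (intro mult_mono) simp_all
  then show ?thesis unfolding K1_def using pos mult_right_mono[of 1 _ K] by simp
qed

text \<open>The radius 2^k (R/8) is R times \<open>l\<close>, which is 1/2, 1 or 2. So
  \<open>Upsilon\<close> changes by a factor of at most 2, and the square in the Gaussian shrinks to
  no less than a quarter, which turns c into c/4.\<close>

lemma wt_near_le:
  assumes R: "0 < R" and k: "k \<in> {2, 3, 4::nat}"
  shows "wt a b c k (2 ^ k * (R / 8) / \<tau>)
    \<le> 2 powr (4 * a) * 2 powr b * (Upsilon (R / \<tau>) powr b * exp (- (c / 4 * (R / \<tau>)\<^sup>2)))"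
proof -
  define u where "u = R / \<tau>"
  have u: "0 < u" using R pos by (simp add: u_def)
  define l :: real where "l = 2 ^ k / 8"
  have l: "1 / 2 \<le> l" "l \<le> 2" "Upsilon l \<le> 2" using k by (auto simp: l_def Upsilon_def)
  have eq: "2 ^ k * (R / 8) / \<tau> = l * u" by (simp add: l_def u_def)
  have "2 powr (real k * a) \<le> 2 powr (4 * a)"
    using k pos by (intro powr_mono mult_right_mono) auto
  moreover have "Upsilon (l * u) powr b \<le> 2 powr b * Upsilon u powr b"
  proof -
    have "Upsilon (l * u) powr b \<le> Upsilon l powr b * Upsilon u powr b"
      using l u pos by (intro Upsilon_powr_mult_le) auto
    also have "\<dots> \<le> 2 powr b * Upsilon u powr b"
      using l pos Upsilon_ge_1[of l] by (intro mult_right_mono powr_mono2) auto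
    finally show ?thesis .
  qed
  moreover have "exp (- (c * (l * u)\<^sup>2)) \<le> exp (- (c / 4 * u\<^sup>2))"
  proof -
    have "(1 / 2)\<^sup>2 \<le> l\<^sup>2" using l by (intro power_mono) auto
    then have "c * u\<^sup>2 * (1 / 4) \<le> c * u\<^sup>2 * l\<^sup>2"
      using pos by (intro mult_left_mono) (auto simp: power2_eq_square)
    then show ?thesis by (simp add: power_mult_distrib mult_ac)
  qed
  ultimately have "2 powr (real k * a) * Upsilon (l * u) powr b * exp (- (c * (l * u)\<^sup>2))
      \<le> 2 powr (4 * a) * (2 powr b * Upsilon u powr b) * exp (- (c / 4 * u\<^sup>2))"
    by (intro mult_mono) auto
  then show ?thesis unfolding eq wt_def u_def[symmetric] by (simp add: mult_ac)
qed

text \<open>A point of the half ball has distances between R/2 and 4 R from the points of the shell.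
  Seen from a ball of radius R/8 these are the annuli with indices 2, 3, 4, all covered by the
  hypothesis: this is the reason for the eighth.\<close>

lemma near_shells:
  assumes R: "0 < R" and z: "z \<in> ball x (R / 2)"
  shows "shell x R \<subseteq> (\<Union>k\<in>{2, 3, 4::nat}. shell z (2 ^ k * (R / 8)))"
proof
  fix y assume "y \<in> shell x R"
  then have "dist x y < 2 * R" "R \<le> dist x y" by (auto simp: shell_def)
  moreover have "dist x z < R / 2" using z by simp
  ultimately have "R / 2 < dist z y" "dist z y < 4 * R"
    using dist_triangle[of x y z] dist_triangle[of z y x] by (simp_all add: dist_commute)
  then show "y \<in> (\<Union>k\<in>{2, 3, 4::nat}. shell z (2 ^ k * (R / 8)))"
    by (auto simp: shell_def)
qed

lemma disjoint_near_shells: "disjoint_family_on (\<lambda>k. shell z (2 ^ k * (R / 8))) {2, 3, 4::nat}" if "0 < R"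
  using that by (auto simp: disjoint_family_on_def shell_def)

lemma near_cover:
  assumes R: "0 < R"
  obtains n :: nat and z :: "nat \<Rightarrow> 'a" and D where "real n \<le> C0 ^ 5" "\<And>i. i < n \<Longrightarrow> z i \<in> ball x (R / 2)"
    "\<And>i. i < n \<Longrightarrow> D i \<in> sets borel" "\<And>i. i < n \<Longrightarrow> D i \<subseteq> ball (z i) (R / 8)"
    "disjoint_family_on D {..<n}" "ball x (R / 2) = (\<Union>i<n. D i)"
proof -
  have e: "0 < R / 8" using R by simp
  obtain n and z :: "nat \<Rightarrow> 'a" and D where z: "inj_on z {..<n}" "z ` {..<n} \<subseteq> ball x (R / 2)" "separated (R / 8) (z ` {..<n})"
    and D: "\<And>i. i < n \<Longrightarrow> D i \<in> sets M" "\<And>i. i < n \<Longrightarrow> D i \<subseteq> ball (z i) (R / 8)"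
    "disjoint_family_on D {..<n}" "ball x (R / 2) = (\<Union>i<n. D i)"
    using ball_partition[OF e, of x "R / 2"] by metis
  \<comment> \<open>The half ball has radius 2^2 (R/8), hence the exponent 2 + 3.\<close>
  have "real (card (z ` {..<n})) \<le> C0 ^ (2 + 3)"
    using z by (intro card_separated_le[OF e, of _ x]) auto
  then have "real n \<le> C0 ^ 5" using z(1) by (simp add: card_image)
  moreover have "z i \<in> ball x (R / 2)" if "i < n" for i using z(2) that by blast
  ultimately show ?thesis using that[of n z D] D by simp
qed

text \<open>Each output region uses its own decomposition of the same \<open>f\<close>: to estimate
  \<open>T f\<close> on the small ball about \<open>z i\<close>, the input is cut along the shells
  about \<open>z i\<close>. The bounds are restricted to the small balls and added.\<close>

lemma off_in_near:
  assumes R: "0 < R" and f: "f \<in> V" "supp_in (shell x R) f"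
  shows "avg q x (R / 2) (ball x (R / 2)) (T f)
    \<le> ennreal (K1 * (Upsilon (R / \<tau>) powr b * exp (- (c / 4 * (R / \<tau>)\<^sup>2)))) * avg p x (2 * R) UNIV f"
proof -
  define e where "e = R / 8"
  have e: "0 < e" "R = 8 * e" using R by (auto simp: e_def)
  obtain n and z :: "nat \<Rightarrow> 'a" and D where n: "real n \<le> C0 ^ 5" and z: "\<And>i. i < n \<Longrightarrow> z i \<in> ball x (R / 2)"
    and D: "\<And>i. i < n \<Longrightarrow> D i \<in> sets borel" "\<And>i. i < n \<Longrightarrow> D i \<subseteq> ball (z i) e"
    "disjoint_family_on D {..<n}" "ball x (R / 2) = (\<Union>i<n. D i)"
    using near_cover[OF R, of x] unfolding e_def by metis
  define W where "W = Upsilon (R / \<tau>) powr b * exp (- (c / 4 * (R / \<tau>)\<^sup>2))"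
  define Z where "Z = avg p x (2 * R) UNIV f"
  define I where "I = {..<n} \<times> {2, 3, 4::nat}"
  define g where "g ik = trunc (shell (z (fst ik)) (2 ^ snd ik * e)) f" for ik
  have I: "finite I" by (simp add: I_def)
  have gV: "g ik \<in> V" for ik unfolding g_def by (intro V_trunc f) auto
  have "AE y in M. \<forall>i\<in>{..<n}. norm (T f y) \<le> (\<Sum>k\<in>{2, 3, 4}. norm (T (g (i, k)) y))"
  proof (intro AE_finite_allI)
    fix i assume i: "i \<in> {..<n}"
    show "AE y in M. norm (T f y) \<le> (\<Sum>k\<in>{2, 3, 4}. norm (T (g (i, k)) y))"
      unfolding g_def fst_conv snd_conv e_def
      using i f near_shells[OF R z, of i] disjoint_near_shells[OF R, of "z i"]
      by (intro T_partition supp_in_mono[OF f(2)]) auto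
  qed simp
  then have "AE y in M. y \<in> ball x (R / 2) \<longrightarrow>
      norm (T f y) \<le> (\<Sum>ik\<in>I. indicator (ball (z (fst ik)) e) y * norm (T (g ik) y))"
  proof (eventually_elim, intro impI)
    fix y assume le: "\<forall>i\<in>{..<n}. norm (T f y) \<le> (\<Sum>k\<in>{2, 3, 4}. norm (T (g (i, k)) y))"
      and "y \<in> ball x (R / 2)"
    then obtain i where "i < n" "y \<in> D i" using D(4) by auto
    then have i: "i < n" "y \<in> ball (z i) e" using D(2) by blast+
    have "norm (T f y) \<le> (\<Sum>k\<in>{2, 3, 4}. norm (T (g (i, k)) y))" using le i by auto
    also have "\<dots> = (\<Sum>k\<in>{2, 3, 4}. indicator (ball (z i) e) y * norm (T (g (i, k)) y))" using i by simp
    also have "\<dots> \<le> (\<Sum>i<n. \<Sum>k\<in>{2, 3, 4}. indicator (ball (z i) e) y * norm (T (g (i, k)) y))"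
    proof (rule member_le_sum[of i "{..<n}" "\<lambda>i. \<Sum>k\<in>{2, 3, 4}. indicator (ball (z i) e) y * norm (T (g (i, k)) y)"])
      show "0 \<le> (\<Sum>k\<in>{2, 3, 4}. indicator (ball (z i) e) y * norm (T (g (i, k)) y))" for i
        by (intro sum_nonneg mult_nonneg_nonneg indicator_pos_le norm_ge_zero)
    qed (use i in auto)
    also have "\<dots> = (\<Sum>ik\<in>I. indicator (ball (z (fst ik)) e) y * norm (T (g ik) y))"
      by (simp only: I_def sum.cartesian_product case_prod_unfold prod.collapse fst_conv snd_conv)
    finally show "norm (T f y) \<le> (\<Sum>ik\<in>I. indicator (ball (z (fst ik)) e) y * norm (T (g ik) y))" .
  qed
  then have "avg q x (R / 2) (ball x (R / 2)) (T f) \<le> (\<Sum>ik\<in>I. avg q x (R / 2) (ball (z (fst ik)) e) (T (g ik)))"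
    using R q I f gV by (intro avg_le_sum) (auto intro: T_measurable)
  also have "\<dots> \<le> (\<Sum>ik\<in>I. ennreal (C0 ^ 3 * (2 powr (4 * a) * 2 powr b) * K * W) * Z)"
  proof (rule sum_mono)
    fix ik assume "ik \<in> I"
    then obtain i k where ik: "ik = (i, k)" "i < n" "k \<in> {2, 3, 4}" by (auto simp: I_def)
    \<comment> \<open>In units of e the centres are less than 4 apart. Radius 4 is compared with 1
      for the output, and 2^(k+1), at least 8, with 16 for the input; this gives the factors C0 and
      C0^2.\<close>
    have dz: "dist (z i) x < 4 * e" using z[OF ik(2)] e by (simp add: dist_commute)
    have "avg q x (R / 2) (ball (z i) e) (T (g ik)) \<le> ennreal (C0 ^ 1) * avg q (z i) e (ball (z i) e) (T (g ik))"
      using e dz by (intro avg_change q) auto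
    moreover have "avg q (z i) e (ball (z i) e) (T (g ik))
        \<le> ennreal (K * wt a b c k (2 ^ k * e / \<tau>)) * avg p (z i) (2 * (2 ^ k * e)) UNIV (g ik)"
      using e(1) ik(3) gV[of ik] by (intro off_in_2) (auto simp: g_def ik(1))
    moreover have "avg p (z i) (2 * (2 ^ k * e)) UNIV (g ik) \<le> ennreal (C0 ^ 2) * Z"
    proof -
      have "avg p (z i) (2 * (2 ^ k * e)) UNIV (g ik) \<le> avg p (z i) (2 * (2 ^ k * e)) UNIV f"
        unfolding g_def avg_trunc using e f by (intro avg_mono p V_measurable) auto
      also have "\<dots> \<le> ennreal (C0 ^ 2) * Z"
        unfolding Z_def using e dz ik(3) by (intro avg_change p) (auto simp: dist_commute)
      finally show ?thesis .
    qed
    ultimately have "avg q x (R / 2) (ball (z i) e) (T (g ik))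
      \<le> ennreal (C0 ^ 1 * ((K * wt a b c k (2 ^ k * e / \<tau>)) * C0 ^ 2)) * Z"
      using C0_ge_1 pos by (blast intro: ennreal_mult_le_trans order_refl mult_nonneg_nonneg less_imp_le
          zero_le_power order_trans[OF zero_le_one] wt_nonneg)
    also have "\<dots> \<le> ennreal (C0 ^ 3 * (2 powr (4 * a) * 2 powr b) * K * W) * Z"
    proof (intro mult_right_mono ennreal_leI)
      have "C0 ^ 3 * K * wt a b c k (2 ^ k * e / \<tau>) \<le> C0 ^ 3 * K * (2 powr (4 * a) * 2 powr b * W)"
        unfolding W_def e_def using C0_ge_1 pos R ik(3) by (intro mult_left_mono wt_near_le) auto
      then show "C0 ^ 1 * ((K * wt a b c k (2 ^ k * e / \<tau>)) * C0 ^ 2) \<le> C0 ^ 3 * (2 powr (4 * a) * 2 powr b) * K * W"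
        by (simp add: mult_ac power2_eq_square power3_eq_cube)
    qed auto
    finally show "avg q x (R / 2) (ball (z (fst ik)) e) (T (g ik))
        \<le> ennreal (C0 ^ 3 * (2 powr (4 * a) * 2 powr b) * K * W) * Z"
      by (simp add: ik(1))
  qed
  also have "\<dots> = ennreal (3 * real n * (C0 ^ 3 * (2 powr (4 * a) * 2 powr b) * K * W)) * Z"
    using C0_ge_1 pos by (subst sum_ennreal_mult_const) (auto simp: I_def W_def mult.commute)
  also have "\<dots> \<le> ennreal (K1 * W) * Z"
  proof (intro mult_right_mono ennreal_leI)
    have "real n * C0 ^ 3 \<le> C0 ^ 5 * C0 ^ 5"
      using C0_ge_1 n by (intro mult_mono power_increasing) auto
    then have "real n * C0 ^ 3 * (3 * (2 powr (4 * a) * 2 powr b) * K * W)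
        \<le> C0 ^ 5 * C0 ^ 5 * (3 * (2 powr (4 * a) * 2 powr b) * K * W)"
      using pos by (intro mult_right_mono) (auto simp: W_def)
    then show "3 * real n * (C0 ^ 3 * (2 powr (4 * a) * 2 powr b) * K * W) \<le> K1 * W"
      by (simp add: K1_def mult_ac power_add[symmetric])
  qed auto
  finally show ?thesis by (simp add: W_def Z_def)
qed


text \<open>Here the input is divided among the pieces \<open>D i\<close>, each inside a small ball.
  The image of a piece is measured on the shells about its own centre, which cover the outer
  shell.\<close>

lemma off_out_near:
  assumes R: "0 < R" and f: "f \<in> V" "supp_in (ball x (R / 2)) f"
  shows "avg q x (2 * R) (shell x R) (T f)
    \<le> ennreal (K1 * (Upsilon (R / \<tau>) powr b * exp (- (c / 4 * (R / \<tau>)\<^sup>2)))) * avg p x (R / 2) UNIV f"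
proof -
  define e where "e = R / 8"
  have e: "0 < e" "R = 8 * e" using R by (auto simp: e_def)
  obtain n and z :: "nat \<Rightarrow> 'a" and D where n: "real n \<le> C0 ^ 5" and z: "\<And>i. i < n \<Longrightarrow> z i \<in> ball x (R / 2)"
    and D: "\<And>i. i < n \<Longrightarrow> D i \<in> sets borel" "\<And>i. i < n \<Longrightarrow> D i \<subseteq> ball (z i) e"
    "disjoint_family_on D {..<n}" "ball x (R / 2) = (\<Union>i<n. D i)"
    using near_cover[OF R, of x] unfolding e_def by metis
  define W where "W = Upsilon (R / \<tau>) powr b * exp (- (c / 4 * (R / \<tau>)\<^sup>2))"
  define Z where "Z = avg p x (R / 2) UNIV f"
  define I where "I = {..<n} \<times> {2, 3, 4::nat}"
  define S where "S ik = shell (z (fst ik)) (2 ^ snd ik * e)" for ik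
  have I: "finite I" by (simp add: I_def)
  have gV: "trunc (D i) f \<in> V" if "i < n" for i using that by (intro V_trunc f D)
  have "AE y in M. norm (T f y) \<le> (\<Sum>i\<in>{..<n}. norm (T (trunc (D i) f) y))"
    using f D by (intro T_partition) auto
  then have "AE y in M. y \<in> shell x R \<longrightarrow>
      norm (T f y) \<le> (\<Sum>ik\<in>I. indicator (S ik) y * norm (T (trunc (D (fst ik)) f) y))"
  proof (eventually_elim, intro impI)
    fix y assume le: "norm (T f y) \<le> (\<Sum>i\<in>{..<n}. norm (T (trunc (D i) f) y))" and y: "y \<in> shell x R"
    note le
    also have "(\<Sum>i\<in>{..<n}. norm (T (trunc (D i) f) y))
        \<le> (\<Sum>i\<in>{..<n}. \<Sum>k\<in>{2, 3, 4}. indicator (S (i, k)) y * norm (T (trunc (D i) f) y))"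
    proof (rule sum_mono)
      fix i assume "i \<in> {..<n}"
      then have "i < n" by simp
      from subsetD[OF near_shells[OF R z[OF this]] y]
      obtain k where k: "k \<in> {2, 3, 4::nat}" "y \<in> shell (z i) (2 ^ k * (R / 8))"
        by blast
      from k(2) have k: "k \<in> {2, 3, 4::nat}" "y \<in> S (i, k)"
        using k(1) by (simp_all add: S_def e_def)
      then have "norm (T (trunc (D i) f) y) = indicator (S (i, k)) y * norm (T (trunc (D i) f) y)" by simp
      also have "\<dots> \<le> (\<Sum>k\<in>{2, 3, 4}. indicator (S (i, k)) y * norm (T (trunc (D i) f) y))"
        by (rule member_le_sum[OF k(1)]) simp_all
      finally show "norm (T (trunc (D i) f) y) \<le> (\<Sum>k\<in>{2, 3, 4}. indicator (S (i, k)) y * norm (T (trunc (D i) f) y))" .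
    qed
    also have "\<dots> = (\<Sum>ik\<in>I. indicator (S ik) y * norm (T (trunc (D (fst ik)) f) y))"
      by (simp only: I_def sum.cartesian_product case_prod_unfold prod.collapse fst_conv snd_conv)
    finally show "norm (T f y) \<le> (\<Sum>ik\<in>I. indicator (S ik) y * norm (T (trunc (D (fst ik)) f) y))" .
  qed
  then have "avg q x (2 * R) (shell x R) (T f) \<le> (\<Sum>ik\<in>I. avg q x (2 * R) (S ik) (T (trunc (D (fst ik)) f)))"
    using R q I f gV by (intro avg_le_sum) (auto intro: T_measurable simp: S_def I_def)
  also have "\<dots> \<le> (\<Sum>ik\<in>I. ennreal (C0 ^ 5 * (2 powr (4 * a) * 2 powr b) * K * W) * Z)"
  proof (rule sum_mono)
    fix ik assume "ik \<in> I"
    then obtain i k where ik: "ik = (i, k)" "i < n" "k \<in> {2, 3, 4}" by (auto simp: I_def)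
    \<comment> \<open>In units of e, radius 16 is compared with at most 32 for the output and 1 with
      4 for the input; this gives C0^2 and C0^3.\<close>
    have dz: "dist (z i) x < 4 * e" using z[OF ik(2)] e by (simp add: dist_commute)
    have Sik: "S ik = shell (z i) (2 ^ k * e)" by (simp add: S_def ik(1))
    have "avg q x (2 * R) (S ik) (T (trunc (D i) f))
        \<le> ennreal (C0 ^ 2) * avg q (z i) (2 * (2 ^ k * e)) (shell (z i) (2 ^ k * e)) (T (trunc (D i) f))"
      unfolding Sik using e dz ik(3) by (intro avg_change q) auto
    moreover have "avg q (z i) (2 * (2 ^ k * e)) (shell (z i) (2 ^ k * e)) (T (trunc (D i) f))
        \<le> ennreal (K * wt a b c k (2 ^ k * e / \<tau>)) * avg p (z i) e UNIV (trunc (D i) f)"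
      using e(1) ik(2,3) gV[of i] supp_in_mono[OF supp_in_trunc[of "D i" f] D(2)]
      by (intro off_out_2) auto
    moreover have "avg p (z i) e UNIV (trunc (D i) f) \<le> ennreal (C0 ^ 3) * Z"
    proof -
      have "avg p (z i) e UNIV (trunc (D i) f) \<le> avg p (z i) e UNIV f"
        unfolding avg_trunc using e f D(1) ik(2) by (intro avg_mono p V_measurable) auto
      also have "\<dots> \<le> ennreal (C0 ^ 3) * Z"
        unfolding Z_def using e dz by (intro avg_change p) (auto simp: dist_commute)
      finally show ?thesis .
    qed
    ultimately have "avg q x (2 * R) (S ik) (T (trunc (D i) f))
      \<le> ennreal (C0 ^ 2 * ((K * wt a b c k (2 ^ k * e / \<tau>)) * C0 ^ 3)) * Z"
      using C0_ge_1 pos by (blast intro: ennreal_mult_le_trans order_refl mult_nonneg_nonneg less_imp_le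
          zero_le_power order_trans[OF zero_le_one] wt_nonneg)
    also have "\<dots> \<le> ennreal (C0 ^ 5 * (2 powr (4 * a) * 2 powr b) * K * W) * Z"
    proof (intro mult_right_mono ennreal_leI)
      have "C0 ^ 5 * K * wt a b c k (2 ^ k * e / \<tau>) \<le> C0 ^ 5 * K * (2 powr (4 * a) * 2 powr b * W)"
        unfolding W_def e_def using C0_ge_1 pos R ik(3) by (intro mult_left_mono wt_near_le) auto
      moreover have "C0 ^ 2 * ((K * w) * C0 ^ 3) = C0 ^ 5 * K * w" for w
        by algebra
      ultimately show "C0 ^ 2 * ((K * wt a b c k (2 ^ k * e / \<tau>)) * C0 ^ 3) \<le> C0 ^ 5 * (2 powr (4 * a) * 2 powr b) * K * W"
        by (simp add: mult_ac)
    qed auto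
    finally show "avg q x (2 * R) (S ik) (T (trunc (D (fst ik)) f))
        \<le> ennreal (C0 ^ 5 * (2 powr (4 * a) * 2 powr b) * K * W) * Z"
      by (simp add: ik(1))
  qed
  also have "\<dots> = ennreal (3 * real n * (C0 ^ 5 * (2 powr (4 * a) * 2 powr b) * K * W)) * Z"
    using C0_ge_1 pos by (subst sum_ennreal_mult_const) (auto simp: I_def W_def mult.commute)
  also have "\<dots> \<le> ennreal (K1 * W) * Z"
  proof (intro mult_right_mono ennreal_leI)
    have le: "real n * C0 ^ 5 \<le> C0 ^ 5 * C0 ^ 5"
      using C0_ge_1 n by (intro mult_right_mono) auto
    have "real n * C0 ^ 5 * (3 * (2 powr (4 * a) * 2 powr b) * K * W)
        \<le> C0 ^ 5 * C0 ^ 5 * (3 * (2 powr (4 * a) * 2 powr b) * K * W)"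
      using pos by (intro mult_right_mono[OF le]) (auto simp: W_def)
    then show "3 * real n * (C0 ^ 5 * (2 powr (4 * a) * 2 powr b) * K * W) \<le> K1 * W"
      by (simp add: K1_def mult_ac power_add[symmetric])
  qed auto
  finally show ?thesis by (simp add: W_def Z_def)
qed

lemma wt_mono_const:
  assumes "1 \<le> j" "0 < u"
  shows "K1 * (Upsilon u powr b * exp (- (c / 4 * u\<^sup>2))) \<le> K1 * wt a b (c / 4) j u"
    and "K * wt a b c j u \<le> K1 * wt a b (c / 4) j u"
proof -
  have K1: "0 < K1" using K1_ge pos by simp
  have "1 \<le> (2::real) powr (real j * a)" using pos by (intro ge_one_powr_ge_zero) auto
  then have "1 * (Upsilon u powr b * exp (- (c / 4 * u\<^sup>2))) \<le> wt a b (c / 4) j u"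
    unfolding wt_def mult.assoc by (intro mult_right_mono) auto
  then show "K1 * (Upsilon u powr b * exp (- (c / 4 * u\<^sup>2))) \<le> K1 * wt a b (c / 4) j u"
    using K1 by simp
  have "wt a b c j u \<le> wt a b (c / 4) j u"
    unfolding wt_def using pos by (intro mult_left_mono) (auto intro!: mult_right_mono)
  then show "K * wt a b c j u \<le> K1 * wt a b (c / 4) j u"
    using K1_ge pos K1 by (intro mult_mono) auto
qed

text \<open>For j = 1 the ball is the half ball belonging to R = 2 r, so the two covering estimates
  apply. For larger j the given estimates are weakened to the same constants.\<close>

lemma od_estimates_level_1: "od_estimates p q 1 a b K1 (c / 4) \<tau> V T"
  unfolding od_estimates_def
proof (intro conjI allI impI)
  fix x r f
  assume *: "0 < r" "f \<in> V" "supp_in (ball x r) f"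
  have "K * Upsilon (r / \<tau>) powr b \<le> K1 * Upsilon (r / \<tau>) powr b"
    using K1_ge by (intro mult_right_mono) auto
  then show "avg q x r (ball x r) (T f) \<le> ennreal (K1 * Upsilon (r / \<tau>) powr b) * avg p x r UNIV f"
    using on_diag[OF *] by (rule ennreal_mult_le_trans1[OF _ order_refl, rotated])
next
  fix x r f and j :: nat
  assume *: "0 < r" "1 \<le> j" "f \<in> V" "supp_in (shell x (2 ^ j * r)) f"
  have u: "0 < 2 ^ j * r / \<tau>" using * pos by simp
  show "avg q x r (ball x r) (T f)
      \<le> ennreal (K1 * wt a b (c / 4) j (2 ^ j * r / \<tau>)) * avg p x (2 * (2 ^ j * r)) UNIV f"
  proof (cases "j = 1")
    case True
    then have eq: "2 ^ j * r = 2 * r" by simp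
    have "avg q x r (ball x r) (T f)
      \<le> ennreal (K1 * (Upsilon (2 * r / \<tau>) powr b * exp (- (c / 4 * (2 * r / \<tau>)\<^sup>2)))) * avg p x (2 * (2 * r)) UNIV f"
      using off_in_near[of "2 * r" f x] * eq by simp
    then show ?thesis
      unfolding eq using * u[unfolded eq] by (intro ennreal_mult_le_trans1[OF _ order_refl wt_mono_const(1)])
  next
    case False
    then have "avg q x r (ball x r) (T f)
      \<le> ennreal (K * wt a b c j (2 ^ j * r / \<tau>)) * avg p x (2 * (2 ^ j * r)) UNIV f"
      using * by (intro off_in_2) auto
    then show ?thesis using * u by (intro ennreal_mult_le_trans1[OF _ order_refl wt_mono_const(2)])
  qed
next
  fix x r f and j :: nat
  assume *: "0 < r" "1 \<le> j" "f \<in> V" "supp_in (ball x r) f"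
  have u: "0 < 2 ^ j * r / \<tau>" using * pos by simp
  show "avg q x (2 * (2 ^ j * r)) (shell x (2 ^ j * r)) (T f)
      \<le> ennreal (K1 * wt a b (c / 4) j (2 ^ j * r / \<tau>)) * avg p x r UNIV f"
  proof (cases "j = 1")
    case True
    then have eq: "2 ^ j * r = 2 * r" by simp
    have "avg q x (2 * (2 * r)) (shell x (2 * r)) (T f)
      \<le> ennreal (K1 * (Upsilon (2 * r / \<tau>) powr b * exp (- (c / 4 * (2 * r / \<tau>)\<^sup>2)))) * avg p x r UNIV f"
      using off_out_near[of "2 * r" f x] * eq by simp
    then show ?thesis
      unfolding eq using * u[unfolded eq] by (intro ennreal_mult_le_trans1[OF _ order_refl wt_mono_const(1)])
  next
    case False
    then have "avg q x (2 * (2 ^ j * r)) (shell x (2 ^ j * r)) (T f)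
      \<le> ennreal (K * wt a b c j (2 ^ j * r / \<tau>)) * avg p x r UNIV f"
      using * by (intro off_out_2) auto
    then show ?thesis using * u by (intro ennreal_mult_le_trans1[OF _ order_refl wt_mono_const(2)])
  qed
qed

section \<open>Bounds between a ball and arbitrary dyadic shells, without decay\<close>

lemma off_in:
  assumes "0 < r" "1 \<le> j" "f \<in> V" "supp_in (shell x (2 ^ j * r)) f"
  shows "avg q x r (ball x r) (T f)
    \<le> ennreal (K1 * wt a b (c / 4) j (2 ^ j * r / \<tau>)) * avg p x (2 * (2 ^ j * r)) UNIV f"
  using od_estimates_level_1 assms unfolding od_estimates_def by blast

lemma off_out:
  assumes "0 < r" "1 \<le> j" "f \<in> V" "supp_in (ball x r) f"
  shows "avg q x (2 * (2 ^ j * r)) (shell x (2 ^ j * r)) (T f)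
    \<le> ennreal (K1 * wt a b (c / 4) j (2 ^ j * r / \<tau>)) * avg p x r UNIV f"
  using od_estimates_level_1 assms unfolding od_estimates_def by blast

text \<open>C0^2 pays for passing to the ball of radius 4 R when the shell is close, 4^b for
  changing the argument of \<open>Upsilon\<close> by a factor between 1/2 and 4.\<close>

definition K2 :: real where "K2 = C0 ^ 2 * K1 * 4 powr b"

lemma K2_bounds:
  assumes "0 < v"
  shows "1 \<le> s \<Longrightarrow> s \<le> 4 \<Longrightarrow>
      C0 ^ 2 * K * Upsilon (s * v) powr b \<le> K2 * 2 powr (real i * a) * Upsilon v powr b"
    and "K1 * wt a b (c / 4) (i - 2) (v / 2) \<le> K2 * 2 powr (real i * a) * Upsilon v powr b"
proof -
  have K1: "0 < K1" using K1_ge pos by simp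
  have two: "1 \<le> (2::real) powr (real i * a)" using pos by (intro ge_one_powr_ge_zero) auto
  have C: "1 \<le> C0 ^ 2" using C0_ge_1 by (rule one_le_power)
  {
    assume s: "1 \<le> s" "s \<le> 4"
    have "Upsilon (s * v) powr b \<le> Upsilon s powr b * Upsilon v powr b"
      using s assms pos by (intro Upsilon_powr_mult_le) auto
    also have "\<dots> \<le> 4 powr b * Upsilon v powr b"
      using s pos by (intro mult_right_mono powr_mono2) (auto simp: Upsilon_ge_1_eq)
    finally have "C0 ^ 2 * K * Upsilon (s * v) powr b \<le> C0 ^ 2 * K1 * (4 powr b * Upsilon v powr b)"
      using C0_ge_1 K1_ge K1 pos by (intro mult_mono) auto
    also have "\<dots> = 1 * (K2 * Upsilon v powr b)" by (simp add: K2_def mult_ac)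
    also have "\<dots> \<le> 2 powr (real i * a) * (K2 * Upsilon v powr b)"
      using two K1 by (intro mult_right_mono) (auto simp: K2_def)
    finally show "C0 ^ 2 * K * Upsilon (s * v) powr b \<le> K2 * 2 powr (real i * a) * Upsilon v powr b"
      by (simp add: mult_ac)
  }
  have "Upsilon (1 / 2 * v) powr b \<le> Upsilon (1 / 2) powr b * Upsilon v powr b"
    using assms pos by (intro Upsilon_powr_mult_le) auto
  also have "\<dots> \<le> 4 powr b * Upsilon v powr b"
    using pos by (intro mult_right_mono powr_mono2) (auto simp: Upsilon_def)
  finally have U: "Upsilon (v / 2) powr b \<le> 4 powr b * Upsilon v powr b" by simp
  have "wt a b (c / 4) (i - 2) (v / 2) \<le> 2 powr (real i * a) * (4 powr b * Upsilon v powr b) * 1"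
    unfolding wt_def using U pos by (intro mult_mono powr_mono) auto
  then have "K1 * wt a b (c / 4) (i - 2) (v / 2) \<le> 1 * (K1 * (2 powr (real i * a) * (4 powr b * Upsilon v powr b)))"
    using K1 by simp
  also have "\<dots> \<le> C0 ^ 2 * (K1 * (2 powr (real i * a) * (4 powr b * Upsilon v powr b)))"
    using C K1 by (intro mult_right_mono) auto
  finally show "K1 * wt a b (c / 4) (i - 2) (v / 2) \<le> K2 * 2 powr (real i * a) * Upsilon v powr b"
    by (simp add: K2_def mult_ac)
qed

text \<open>For i \<le> 2 both the shell and the support of \<open>f\<close> lie in the ball of
  radius 4 R, where the diagonal estimate applies. Beyond, the index relative to the ball of radius
  2 R is i - 2, at least 1. The Gaussian factor is given up: in a composition the other operator
  supplies it.\<close>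

lemma ball_to_shell:
  assumes R: "0 < R" and f: "f \<in> V" "supp_in (ball x (2 * R)) f"
  shows "avg q x (2 ^ i * R) (shell x (2 ^ i * (R / 2))) (T f)
    \<le> ennreal (K2 * 2 powr (real i * a) * Upsilon (2 ^ i * R / \<tau>) powr b) * avg p x (2 * R) UNIV f"
proof -
  have v: "0 < 2 ^ i * R / \<tau>" using R pos by simp
  show ?thesis
  proof (cases "i \<le> 2")
    case True
    then have i: "i \<in> {0, 1, 2}" by auto
    define s :: real where "s = 4 / 2 ^ i"
    have s: "1 \<le> s" "s \<le> 4" using i by (auto simp: s_def)
    have "avg q x (2 ^ i * R) (shell x (2 ^ i * (R / 2))) (T f)
        \<le> ennreal (C0 ^ 2) * avg q x (4 * R) (shell x (2 ^ i * (R / 2))) (T f)"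
      using R i by (intro avg_change q) auto
    also have "\<dots> \<le> ennreal (C0 ^ 2) * avg q x (4 * R) (ball x (4 * R)) (T f)"
      using R i f by (intro mult_left_mono avg_mono q T_measurable) (auto simp: shell_def)
    finally have 1: "avg q x (2 ^ i * R) (shell x (2 ^ i * (R / 2))) (T f)
        \<le> ennreal (C0 ^ 2) * avg q x (4 * R) (ball x (4 * R)) (T f)" .
    have "avg q x (4 * R) (ball x (4 * R)) (T f)
        \<le> ennreal (K * Upsilon (4 * R / \<tau>) powr b) * avg p x (4 * R) UNIV f"
      using R f by (intro on_diag supp_in_mono[OF f(2)]) auto
    moreover have "avg p x (4 * R) UNIV f \<le> avg p x (2 * R) UNIV f"
      using R by (intro avg_superball p) auto
    ultimately have 2: "avg q x (4 * R) (ball x (4 * R)) (T f)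
        \<le> ennreal (K * Upsilon (4 * R / \<tau>) powr b) * avg p x (2 * R) UNIV f"
      by (rule ennreal_mult_le_trans1) simp
    have eq: "4 * R / \<tau> = s * (2 ^ i * R / \<tau>)" by (simp add: s_def)
    have "C0 ^ 2 * (K * Upsilon (4 * R / \<tau>) powr b) \<le> K2 * 2 powr (real i * a) * Upsilon (2 ^ i * R / \<tau>) powr b"
      unfolding eq using K2_bounds(1)[OF v s, of i] by (simp only: mult.assoc)
    then show ?thesis
      using C0_ge_1 by (intro ennreal_mult_le_trans[OF 1 2]) auto
  next
    case False
    have eq: "2 ^ (i - 2) * (2 * R) = 2 ^ i * (R / 2)"
      using False by (simp add: power_diff)
    have eq': "2 * (2 ^ i * (R / 2)) = 2 ^ i * R" "2 ^ i * (R / 2) / \<tau> = 2 ^ i * R / \<tau> / 2"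
      by simp_all
    have "avg q x (2 ^ i * R) (shell x (2 ^ i * (R / 2))) (T f)
      \<le> ennreal (K1 * wt a b (c / 4) (i - 2) (2 ^ i * R / \<tau> / 2)) * avg p x (2 * R) UNIV f"
      using off_out[of "2 * R" "i - 2" f x] R False f unfolding eq eq' by simp
    then show ?thesis
      by (rule ennreal_mult_le_trans1[OF _ order_refl K2_bounds(2)[OF v]])
  qed
qed

text \<open>The mirror image of \<open>ball_to_shell\<close>, with the same division into near
  shells inside the ball of radius 4 R and far shells of index i - 2.\<close>

lemma shell_to_ball:
  assumes R: "0 < R" and f: "f \<in> V" "supp_in (shell x (2 ^ i * (R / 2))) f"
  shows "avg q x (2 * R) (ball x (2 * R)) (T f)
    \<le> ennreal (K2 * 2 powr (real i * a) * Upsilon (2 ^ i * R / \<tau>) powr b) * avg p x (2 ^ i * R) UNIV f"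
proof -
  have v: "0 < 2 ^ i * R / \<tau>" using R pos by simp
  show ?thesis
  proof (cases "i \<le> 2")
    case True
    then have i: "i \<in> {0, 1, 2}" by auto
    define s :: real where "s = 4 / 2 ^ i"
    have s: "1 \<le> s" "s \<le> 4" using i by (auto simp: s_def)
    have "avg q x (2 * R) (ball x (2 * R)) (T f) \<le> ennreal (C0 ^ 2) * avg q x (4 * R) (ball x (2 * R)) (T f)"
      using R by (intro avg_change q) auto
    also have "\<dots> \<le> ennreal (C0 ^ 2) * avg q x (4 * R) (ball x (4 * R)) (T f)"
      using R f by (intro mult_left_mono avg_mono q T_measurable) auto
    finally have 1: "avg q x (2 * R) (ball x (2 * R)) (T f)
        \<le> ennreal (C0 ^ 2) * avg q x (4 * R) (ball x (4 * R)) (T f)" .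
    have "avg q x (4 * R) (ball x (4 * R)) (T f)
        \<le> ennreal (K * Upsilon (4 * R / \<tau>) powr b) * avg p x (4 * R) UNIV f"
      using R f i by (intro on_diag supp_in_mono[OF f(2)]) (auto simp: shell_def)
    moreover have "avg p x (4 * R) UNIV f \<le> avg p x (2 ^ i * R) UNIV f"
      using R i by (intro avg_superball p) auto
    ultimately have 2: "avg q x (4 * R) (ball x (4 * R)) (T f)
        \<le> ennreal (K * Upsilon (4 * R / \<tau>) powr b) * avg p x (2 ^ i * R) UNIV f"
      by (rule ennreal_mult_le_trans1) simp
    have eq: "4 * R / \<tau> = s * (2 ^ i * R / \<tau>)" by (simp add: s_def)
    have "C0 ^ 2 * (K * Upsilon (4 * R / \<tau>) powr b) \<le> K2 * 2 powr (real i * a) * Upsilon (2 ^ i * R / \<tau>) powr b"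
      unfolding eq using K2_bounds(1)[OF v s, of i] by (simp only: mult.assoc)
    then show ?thesis
      using C0_ge_1 by (intro ennreal_mult_le_trans[OF 1 2]) auto
  next
    case False
    have eq: "2 ^ (i - 2) * (2 * R) = 2 ^ i * (R / 2)"
      using False by (simp add: power_diff)
    have eq': "2 * (2 ^ i * (R / 2)) = 2 ^ i * R" "2 ^ i * (R / 2) / \<tau> = 2 ^ i * R / \<tau> / 2"
      by simp_all
    have "avg q x (2 * R) (ball x (2 * R)) (T f)
      \<le> ennreal (K1 * wt a b (c / 4) (i - 2) (2 ^ i * R / \<tau> / 2)) * avg p x (2 ^ i * R) UNIV f"
      using off_in[of "2 * R" "i - 2" f x] R False f unfolding eq eq' by simp
    then show ?thesis
      by (rule ennreal_mult_le_trans1[OF _ order_refl K2_bounds(2)[OF v]])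
  qed
qed

end

section \<open>Composition\<close>

locale annular_od_operator = od_operator +
  assumes T_annular: "g \<in> V \<Longrightarrow> 0 < R \<Longrightarrow> AE y in M. ennreal (norm (T g y))
    \<le> ennreal (norm (T (trunc (ball x R) g) y)) + (\<Sum>i. ennreal (norm (T (trunc (shell x (2 ^ i * R)) g) y)))"
begin

lemma avg_T_annular:
  assumes "1 \<le> s" "0 < r" "0 < R" "g \<in> V" "E \<in> sets borel"
  shows "avg s x r E (T g) \<le> avg s x r E (T (trunc (ball y R) g))
    + (\<Sum>i. avg s x r E (T (trunc (shell y (2 ^ i * R)) g)))"
  using assms by (intro avg_suminf_le T_annular T_measurable V_trunc) auto

end

section \<open>Products of off-diagonal factors\<close>

lemma wt_mult_wt:
  "wt a b c j u * wt a' b' c' j u = wt (a + a') (b + b') (c + c') j u"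
  by (simp add: wt_def powr_add[symmetric] exp_add[symmetric] algebra_simps)

lemma wt_mono_c: "c \<le> c' \<Longrightarrow> wt a b c' j u \<le> wt a b c j u"
  unfolding wt_def by (intro mult_left_mono) (auto intro!: mult_right_mono)

lemma Upsilon_half_le:
  assumes "0 < u" "0 \<le> b"
  shows "Upsilon (u / 2) powr b \<le> 2 powr b * Upsilon u powr b"
    and "Upsilon (2 * u) powr b \<le> 2 powr b * Upsilon u powr b"
  using Upsilon_powr_mult_le[of "1 / 2" u b] Upsilon_powr_mult_le[of 2 u b] assms
  by (simp_all add: Upsilon_def)

lemma Upsilon_powr_mono: "0 < u \<Longrightarrow> b \<le> e \<Longrightarrow> Upsilon u powr b \<le> Upsilon u powr e"
  using Upsilon_ge_1[of u] by (intro powr_mono) auto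

text \<open>The contribution of the intermediate ball: one operator acts on its diagonal, at scale
  u/2, the other between it and the adjacent shell, at scale u. \<open>P\<close> is the price of
  passing between the small ball and the intermediate one.\<close>

lemma near_wt_le:
  assumes u: "0 < u" and P: "P \<le> 2 powr (real j * \<alpha>)" and b: "0 \<le> b" "b + b' \<le> e" and c: "c0 \<le> c1"
  shows "P * Upsilon (u / 2) powr b * (Upsilon u powr b' * exp (- (c1 * u\<^sup>2))) \<le> 2 powr b * wt \<alpha> e c0 j u"
proof -
  have "P * Upsilon (u / 2) powr b * (Upsilon u powr b' * exp (- (c1 * u\<^sup>2)))
      \<le> 2 powr (real j * \<alpha>) * (2 powr b * Upsilon u powr b) * (Upsilon u powr b' * exp (- (c0 * u\<^sup>2)))"
    using P Upsilon_half_le(1)[OF u b(1)] c by (intro mult_mono) (auto intro!: mult_right_mono)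
  also have "\<dots> = 2 powr b * (2 powr (real j * \<alpha>) * Upsilon u powr (b + b') * exp (- (c0 * u\<^sup>2)))"
    by (simp add: powr_add)
  also have "\<dots> \<le> 2 powr b * wt \<alpha> e c0 j u"
    unfolding wt_def using Upsilon_powr_mono[OF u b(2)] by (intro mult_left_mono mult_right_mono) auto
  finally show ?thesis .
qed

text \<open>One operator has index j - 1 + i and decay, the other has index i and none. Of 2^((j +
  i) a) the part in j leaves the sum, while the part in i joins 2^(i a'). Hence it is a + a' that
  competes with b + b' in the series.\<close>

lemma far_wt_le:
  assumes v: "0 < v" and pos: "0 < a" "0 \<le> b'" and c: "c0 \<le> c1"
  shows "wt a b c1 (j - 1 + i) v * (2 powr (real i * a') * Upsilon (2 * v) powr b')
    \<le> 2 powr b' * 2 powr (real j * a) * wt (a + a') (b + b') c0 i v"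
proof -
  have "2 powr (real (j - 1 + i) * a) \<le> 2 powr (real (j + i) * a)"
    using pos by (intro powr_mono mult_right_mono) auto
  then have "wt a b c1 (j - 1 + i) v \<le> 2 powr (real (j + i) * a) * Upsilon v powr b * exp (- (c0 * v\<^sup>2))"
    unfolding wt_def using c by (intro mult_mono) (auto intro!: mult_right_mono)
  then have "wt a b c1 (j - 1 + i) v * (2 powr (real i * a') * Upsilon (2 * v) powr b')
      \<le> 2 powr (real (j + i) * a) * Upsilon v powr b * exp (- (c0 * v\<^sup>2)) * (2 powr (real i * a') * (2 powr b' * Upsilon v powr b'))"
    using Upsilon_half_le(2)[OF v pos(2)] by (intro mult_mono) auto
  also have "\<dots> = 2 powr b' * 2 powr (real j * a) * wt (a + a') (b + b') c0 i v"
    by (simp add: wt_def powr_add distrib_left distrib_right)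
  finally show ?thesis .
qed

text \<open>The far shells start at half the radius, so the series is evaluated at u/2. Together
  with the half of \<open>c0\<close> consumed by the summation this leaves c0/8.\<close>

lemma far_sum_wt_le:
  assumes u: "0 < u" and "a \<le> \<alpha>" "0 \<le> e" "0 \<le> G"
  shows "2 powr (real j * a) * (G * Upsilon (u / 2) powr e * exp (- (c0 / 2 * (u / 2)\<^sup>2)))
    \<le> G * 2 powr e * wt \<alpha> e (c0 / 8) j u"
proof -
  have "2 powr (real j * a) * (G * Upsilon (u / 2) powr e * exp (- (c0 / 2 * (u / 2)\<^sup>2)))
      \<le> 2 powr (real j * \<alpha>) * (G * (2 powr e * Upsilon u powr e) * exp (- (c0 / 2 * (u / 2)\<^sup>2)))"
    using assms Upsilon_half_le(1)[OF u assms(3)]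
    by (intro mult_mono mult_right_mono mult_left_mono powr_mono) auto
  also have "\<dots> = G * 2 powr e * wt \<alpha> e (c0 / 8) j u"
    by (simp add: wt_def power_divide)
  finally show ?thesis .
qed

lemma ennreal_add_mult_le:
  assumes "x \<le> ennreal k * z" "y \<le> ennreal l * z" "0 \<le> k" "0 \<le> l"
  shows "x + y \<le> ennreal (k + l) * z"
  using add_mono[OF assms(1,2)] assms(3,4) by (simp add: distrib_right)

text \<open>\<open>G\<close> is the constant of the series bound for the combined factor; as a
  parameter it keeps the constants of the three estimates explicit and free of \<tau>. The output
  exponent is called \<open>s\<close>, since \<open>r\<close> denotes a radius.\<close>

locale od_composition = doubling_space M C0 +
  T: annular_od_operator M C0 V T q s a b K c \<tau> + S: od_operator M C0 W S p q a' b' L d \<tau>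
  for M :: "'a::metric_space measure" and C0
    and V :: "('a \<Rightarrow> 'b::{real_normed_field, second_countable_topology}) set" and T q s a b K c \<tau>
    and W :: "('a \<Rightarrow> 'b) set" and S p a' b' L d +
  fixes e \<alpha> c0 G :: real
  assumes e: "b + b' \<le> e" and \<alpha>: "a \<le> \<alpha>" "a' \<le> \<alpha>" "dim_quot D s \<le> \<alpha>"
    and c0: "0 < c0" "c0 \<le> c / 4" "c0 \<le> d / 4"
    and G: "0 < G" "\<And>u n. 0 < u \<Longrightarrow>
      (\<Sum>i<n. wt (a + a') (b + b') c0 i (2 ^ i * u)) \<le> G * Upsilon u powr e * exp (- (c0 / 2 * u\<^sup>2))"
begin

lemma consts_pos: "0 < T.K1" "0 < S.K1" "0 < T.K2" "0 < S.K2"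
  using T.K1_ge S.K1_ge T.pos S.pos C0_ge_1 by (auto simp: T.K2_def S.K2_def)

lemma e_pos: "0 < e"
  using e T.pos S.pos by linarith

text \<open>With the intermediate ball of radius 2 r, all remaining shells have index at least 1 as
  seen from the ball of radius r, and both operators decay there. The average that
  \<open>S.off_out\<close> produces on a shell is literally the one that \<open>T.off_in\<close>
  takes as input.\<close>

lemma compose_diag:
  assumes r: "0 < r" and f: "f \<in> W" "S f \<in> V" "supp_in (ball x r) f"
  shows "avg s x r (ball x r) (T (S f))
    \<le> ennreal ((C0 * (K * 2 powr b) * (L * 2 powr b') + T.K1 * S.K1 * G) * Upsilon (r / \<tau>) powr e) * avg p x r UNIV f"
proof -
  define u where "u = r / \<tau>"
  have u: "0 < u" using r T.pos by (simp add: u_def)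
  define g where "g = S f"
  have g: "g \<in> V" using f by (simp add: g_def)
  define Z where "Z = avg p x r UNIV f"
  have "avg s x r (ball x r) (T (trunc (ball x (2 * r)) g))
      \<le> ennreal (C0 * (K * 2 powr b) * (L * 2 powr b') * Upsilon u powr e) * Z"
  proof -
    have "avg s x r (ball x r) (T (trunc (ball x (2 * r)) g))
        \<le> ennreal (C0 ^ 1) * avg s x (2 * r) (ball x r) (T (trunc (ball x (2 * r)) g))"
      using r by (intro avg_change T.q) auto
    also have "\<dots> \<le> ennreal (C0 ^ 1) * avg s x (2 * r) (ball x (2 * r)) (T (trunc (ball x (2 * r)) g))"
      using r g by (intro mult_left_mono avg_mono T.q T.T_measurable T.V_trunc) auto
    finally have 1: "avg s x r (ball x r) (T (trunc (ball x (2 * r)) g))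
        \<le> ennreal C0 * avg s x (2 * r) (ball x (2 * r)) (T (trunc (ball x (2 * r)) g))"
      by simp
    have 2: "avg s x (2 * r) (ball x (2 * r)) (T (trunc (ball x (2 * r)) g))
        \<le> ennreal (K * Upsilon (2 * u) powr b) * avg q x (2 * r) (ball x (2 * r)) g"
      using T.on_diag[of "2 * r" "trunc (ball x (2 * r)) g" x] r g
      by (simp add: avg_trunc T.V_trunc u_def)
    have "avg q x (2 * r) (ball x (2 * r)) g \<le> ennreal (L * Upsilon (2 * u) powr b') * avg p x (2 * r) UNIV f"
      using S.on_diag[of "2 * r" f x] r f supp_in_mono[OF f(3) subset_ball[of r "2 * r" x]]
      by (simp add: g_def u_def)
    moreover have "avg p x (2 * r) UNIV f \<le> Z"
      unfolding Z_def using r by (intro avg_superball S.p) auto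
    ultimately have 3: "avg q x (2 * r) (ball x (2 * r)) g \<le> ennreal (L * Upsilon (2 * u) powr b') * Z"
      by (rule ennreal_mult_le_trans1) simp
    have "K * Upsilon (2 * u) powr b * (L * Upsilon (2 * u) powr b')
        \<le> K * (2 powr b * Upsilon u powr b) * (L * (2 powr b' * Upsilon u powr b'))"
      using T.pos S.pos Upsilon_half_le(2)[OF u, of b] Upsilon_half_le(2)[OF u, of b']
      by (intro mult_mono) auto
    also have "\<dots> = K * 2 powr b * (L * 2 powr b') * Upsilon u powr (b + b')"
      by (simp add: powr_add)
    also have "\<dots> \<le> K * 2 powr b * (L * 2 powr b') * Upsilon u powr e"
      using Upsilon_powr_mono[OF u e] T.pos S.pos by (intro mult_left_mono) auto
    finally have "C0 * (K * Upsilon (2 * u) powr b * (L * Upsilon (2 * u) powr b'))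
        \<le> C0 * (K * 2 powr b * (L * 2 powr b') * Upsilon u powr e)"
      using C0_ge_1 by (intro mult_left_mono) auto
    then show ?thesis
      using T.pos S.pos C0_ge_1
      by (intro ennreal_mult_le_trans[OF 1 ennreal_mult_le_trans[OF 2 3 _ order_refl]]) (auto simp: mult.assoc)
  qed
  moreover have "(\<Sum>i. avg s x r (ball x r) (T (trunc (shell x (2 ^ i * (2 * r))) g)))
      \<le> ennreal (T.K1 * S.K1 * G * Upsilon u powr e) * Z"
  proof (rule ennreal_suminf_le_mult)
    \<comment> \<open>The shells start at radius 2 r, so the i-th one has index i + 1. The absent
      term of index 0 is added when the series bound is used.\<close>
    define t where "t i = T.K1 * S.K1 * wt (a + a') (b + b') c0 (Suc i) (2 ^ Suc i * u)" for i
    show "0 \<le> t i" for i using consts_pos by (simp add: t_def)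
    show "(\<Sum>i<n. t i) \<le> T.K1 * S.K1 * G * Upsilon u powr e" for n
    proof -
      have "(\<Sum>i<n. t i) = T.K1 * S.K1 * (\<Sum>i<n. wt (a + a') (b + b') c0 (Suc i) (2 ^ Suc i * u))"
        by (simp add: t_def sum_distrib_left)
      also have "\<dots> \<le> T.K1 * S.K1 * (\<Sum>i<Suc n. wt (a + a') (b + b') c0 i (2 ^ i * u))"
        unfolding sum.lessThan_Suc_shift using consts_pos by (intro mult_left_mono) auto
      also have "\<dots> \<le> T.K1 * S.K1 * (G * Upsilon u powr e * exp (- (c0 / 2 * u\<^sup>2)))"
        using consts_pos by (intro mult_left_mono G u) auto
      also have "\<dots> \<le> T.K1 * S.K1 * (G * Upsilon u powr e * 1)"
        using consts_pos G c0 by (intro mult_left_mono) auto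
      finally show ?thesis by (simp add: mult.assoc)
    qed
    fix i
    define v where "v = 2 ^ Suc i * u"
    have eq: "2 ^ i * (2 * r) = 2 ^ Suc i * r" "2 ^ Suc i * r / \<tau> = v" by (simp_all add: v_def u_def)
    have 1: "avg s x r (ball x r) (T (trunc (shell x (2 ^ Suc i * r)) g))
        \<le> ennreal (T.K1 * wt a b (c / 4) (Suc i) v) * avg q x (2 * (2 ^ Suc i * r)) (shell x (2 ^ Suc i * r)) g"
      using T.off_in[of r "Suc i" "trunc (shell x (2 ^ Suc i * r)) g" x] r g
      by (simp add: avg_trunc T.V_trunc v_def u_def)
    have 2: "avg q x (2 * (2 ^ Suc i * r)) (shell x (2 ^ Suc i * r)) g
        \<le> ennreal (S.K1 * wt a' b' (d / 4) (Suc i) v) * Z"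
      using S.off_out[of r "Suc i" f x] r f by (simp add: g_def Z_def v_def u_def)
    have "wt a b (c / 4) (Suc i) v * wt a' b' (d / 4) (Suc i) v \<le> wt (a + a') (b + b') c0 (Suc i) v"
      unfolding wt_mult_wt using c0 by (intro wt_mono_c) auto
    then have "T.K1 * S.K1 * (wt a b (c / 4) (Suc i) v * wt a' b' (d / 4) (Suc i) v) \<le> t i"
      unfolding t_def v_def using consts_pos by (intro mult_left_mono) auto
    then show "avg s x r (ball x r) (T (trunc (shell x (2 ^ i * (2 * r))) g)) \<le> ennreal (t i) * Z"
      unfolding eq using consts_pos by (intro ennreal_mult_le_trans[OF 1 2]) (auto simp: mult_ac)
  qed
  ultimately have total: "avg s x r (ball x r) (T (trunc (ball x (2 * r)) g)) +
      (\<Sum>i. avg s x r (ball x r) (T (trunc (shell x (2 ^ i * (2 * r))) g)))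
    \<le> ennreal (C0 * (K * 2 powr b) * (L * 2 powr b') * Upsilon u powr e + T.K1 * S.K1 * G * Upsilon u powr e) * Z"
    using T.pos S.pos C0_ge_1 consts_pos G by (intro ennreal_add_mult_le) auto
  have "avg s x r (ball x r) (T g) \<le> avg s x r (ball x r) (T (trunc (ball x (2 * r)) g)) +
      (\<Sum>i. avg s x r (ball x r) (T (trunc (shell x (2 ^ i * (2 * r))) g)))"
    using r g by (intro T.avg_T_annular T.q) auto
  from order_trans[OF this total] show ?thesis
    by (simp add: g_def u_def Z_def distrib_right)
qed

text \<open>On the half ball \<open>S\<close> crosses from the adjacent shell and \<open>T\<close>
  acts diagonally. Outside it the shells may touch or contain the support of \<open>f\<close>, so
  \<open>S\<close> is used without decay, but they are far from the target ball, so that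
  \<open>T\<close> decays with index at least j - 1.\<close>

lemma compose_in:
  assumes r: "0 < r" and j: "2 \<le> j" and f: "f \<in> W" "S f \<in> V" "supp_in (shell x (2 ^ j * r)) f"
  shows "avg s x r (ball x r) (T (S f))
    \<le> ennreal ((K * S.K1 * 2 powr a' * 2 powr b + T.K1 * S.K2 * 2 powr b' * G * 2 powr e)
        * wt \<alpha> e (c0 / 8) j (2 ^ j * r / \<tau>)) * avg p x (2 * (2 ^ j * r)) UNIV f"
proof -
  define R where "R = 2 ^ j * r"
  have R: "0 < R" using r by (simp add: R_def)
  have half: "2 ^ (j - 1) * r = R / 2" using j by (simp add: R_def power_diff)
  define u where "u = R / \<tau>"
  have u: "0 < u" using R T.pos by (simp add: u_def)
  define g where "g = S f"
  have g: "g \<in> V" using f by (simp add: g_def)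
  define Z where "Z = avg p x (2 * R) UNIV f"
  have "avg s x r (ball x r) (T (trunc (ball x (R / 2)) g))
      \<le> ennreal (K * S.K1 * 2 powr a' * 2 powr b * wt \<alpha> e (c0 / 8) j u) * Z"
  proof -
    \<comment> \<open>The averages to be compared belong to the radii r and R/2 = 2^(j - 1) r, which
      are j - 1 doublings apart.\<close>
    define P where "P = (2::real) powr (real (j - 1) * dim_quot D s)"
    have "real (j - 1) * dim_quot D s \<le> real (j - 1) * \<alpha>"
      using \<alpha> by (intro mult_left_mono) auto
    also have "\<dots> \<le> real j * \<alpha>" using \<alpha> T.pos by (intro mult_right_mono) auto
    finally have P: "0 \<le> P" "P \<le> 2 powr (real j * \<alpha>)" by (simp_all add: P_def)
    have "avg s x r (ball x r) (T (trunc (ball x (R / 2)) g))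
        \<le> ennreal P * avg s x (R / 2) (ball x r) (T (trunc (ball x (R / 2)) g))"
      unfolding P_def half[symmetric] using r by (intro avg_dilate T.q)
    also have "\<dots> \<le> ennreal P * avg s x (R / 2) (ball x (R / 2)) (T (trunc (ball x (R / 2)) g))"
    proof (intro mult_left_mono avg_mono T.q T.T_measurable T.V_trunc g)
      have "r * 1 \<le> r * 2 ^ (j - 1)" using r by (intro mult_left_mono) auto
      then show "ball x r \<subseteq> ball x (R / 2)" using half by (intro subset_ball) (simp add: mult.commute)
    qed (use R in auto)
    finally have 1: "avg s x r (ball x r) (T (trunc (ball x (R / 2)) g))
        \<le> ennreal P * avg s x (R / 2) (ball x (R / 2)) (T (trunc (ball x (R / 2)) g))" .
    have 2: "avg s x (R / 2) (ball x (R / 2)) (T (trunc (ball x (R / 2)) g))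
        \<le> ennreal (K * Upsilon (u / 2) powr b) * avg q x (R / 2) (ball x (R / 2)) g"
      using T.on_diag[of "R / 2" "trunc (ball x (R / 2)) g" x] R g
      by (simp add: avg_trunc T.V_trunc u_def mult.commute)
    have 3: "avg q x (R / 2) (ball x (R / 2)) g \<le> ennreal (S.K1 * wt a' b' (d / 4) 1 u) * Z"
      using S.off_in[of "R / 2" 1 f x] R f by (simp add: g_def Z_def u_def R_def[symmetric])
    have "P * (K * Upsilon (u / 2) powr b * (S.K1 * wt a' b' (d / 4) 1 u))
        = K * S.K1 * 2 powr a' * (P * Upsilon (u / 2) powr b * (Upsilon u powr b' * exp (- (d / 4 * u\<^sup>2))))"
      by (simp add: wt_def)
    also have "\<dots> \<le> K * S.K1 * 2 powr a' * (2 powr b * wt \<alpha> e (c0 / 8) j u)"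
      using P u e T.pos S.pos c0 consts_pos by (intro mult_left_mono near_wt_le) auto
    finally show ?thesis
      using T.pos P by (intro ennreal_mult_le_trans[OF 1 ennreal_mult_le_trans[OF 2 3 _ order_refl]])
        (auto simp: mult.assoc)
  qed
  moreover have "(\<Sum>i. avg s x r (ball x r) (T (trunc (shell x (2 ^ i * (R / 2))) g)))
      \<le> ennreal (T.K1 * S.K2 * 2 powr b' * G * 2 powr e * wt \<alpha> e (c0 / 8) j u) * Z"
  proof (rule ennreal_suminf_le_mult)
    define t where "t i = T.K1 * S.K2 * (2 powr b' * 2 powr (real j * a) * wt (a + a') (b + b') c0 i (2 ^ i * (u / 2)))" for i
    show "0 \<le> t i" for i using consts_pos by (simp add: t_def)
    show "(\<Sum>i<n. t i) \<le> T.K1 * S.K2 * 2 powr b' * G * 2 powr e * wt \<alpha> e (c0 / 8) j u" for n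
    proof -
      have "(\<Sum>i<n. t i)
          = T.K1 * S.K2 * 2 powr b' * (2 powr (real j * a) * (\<Sum>i<n. wt (a + a') (b + b') c0 i (2 ^ i * (u / 2))))"
        by (simp add: t_def sum_distrib_left mult.assoc)
      also have "\<dots> \<le> T.K1 * S.K2 * 2 powr b' * (2 powr (real j * a) * (G * Upsilon (u / 2) powr e * exp (- (c0 / 2 * (u / 2)\<^sup>2))))"
        using consts_pos u by (intro mult_left_mono G) auto
      also have "\<dots> \<le> T.K1 * S.K2 * 2 powr b' * (G * 2 powr e * wt \<alpha> e (c0 / 8) j u)"
        using consts_pos u \<alpha> e_pos G by (intro mult_left_mono far_sum_wt_le) auto
      finally show ?thesis by (simp add: mult.assoc)
    qed
    fix i
    define v where "v = 2 ^ i * (u / 2)"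
    have v: "0 < v" using u by (simp add: v_def)
    have j1: "1 \<le> j - 1 + i" using j by simp
    \<comment> \<open>Seen from the ball of radius r, the i-th shell outside the half ball has index
      j - 1 + i.\<close>
    have eq: "2 ^ (j - 1 + i) * r = 2 ^ i * (R / 2)"
      using half by (simp add: power_add mult_ac)
    have 1: "avg s x r (ball x r) (T (trunc (shell x (2 ^ i * (R / 2))) g))
        \<le> ennreal (T.K1 * wt a b (c / 4) (j - 1 + i) v) * avg q x (2 ^ i * R) (shell x (2 ^ i * (R / 2))) g"
      using T.off_in[OF r j1, of "trunc (shell x (2 ^ i * (R / 2))) g" x] g unfolding eq
      by (simp add: avg_trunc T.V_trunc v_def u_def mult.commute)
    have "supp_in (ball x (2 * R)) f"
      using f(3) shell_subset_ball unfolding R_def by (rule supp_in_mono)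
    from S.ball_to_shell[OF R f(1) this, of i]
    have 2: "avg q x (2 ^ i * R) (shell x (2 ^ i * (R / 2))) g
        \<le> ennreal (S.K2 * (2 powr (real i * a') * Upsilon (2 * v) powr b')) * Z"
      by (simp add: g_def Z_def v_def u_def mult.assoc)
    have "T.K1 * S.K2 * (wt a b (c / 4) (j - 1 + i) v * (2 powr (real i * a') * Upsilon (2 * v) powr b')) \<le> t i"
      unfolding t_def v_def[symmetric] using T.pos S.pos consts_pos v c0
      by (intro mult_left_mono far_wt_le) auto
    then show "avg s x r (ball x r) (T (trunc (shell x (2 ^ i * (R / 2))) g)) \<le> ennreal (t i) * Z"
      using consts_pos by (intro ennreal_mult_le_trans[OF 1 2]) (auto simp: mult_ac)
  qed
  ultimately have total: "avg s x r (ball x r) (T (trunc (ball x (R / 2)) g)) +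
      (\<Sum>i. avg s x r (ball x r) (T (trunc (shell x (2 ^ i * (R / 2))) g)))
    \<le> ennreal (K * S.K1 * 2 powr a' * 2 powr b * wt \<alpha> e (c0 / 8) j u
        + T.K1 * S.K2 * 2 powr b' * G * 2 powr e * wt \<alpha> e (c0 / 8) j u) * Z"
    using T.pos S.pos C0_ge_1 consts_pos G by (intro ennreal_add_mult_le) auto
  have "avg s x r (ball x r) (T g) \<le> avg s x r (ball x r) (T (trunc (ball x (R / 2)) g)) +
      (\<Sum>i. avg s x r (ball x r) (T (trunc (shell x (2 ^ i * (R / 2))) g)))"
    using r R g by (intro T.avg_T_annular T.q) auto
  from order_trans[OF this total] show ?thesis
    by (simp add: g_def u_def Z_def R_def distrib_right)
qed

text \<open>The roles are exchanged: now \<open>S\<close> decays away from the small source ball,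
  and \<open>T\<close> may have to act between neighbouring shells and is used without decay. On the
  half ball \<open>S\<close> acts diagonally and \<open>T\<close> crosses to the adjacent shell. The
  source average only decreases when normalised by the half ball, so this passage is free.\<close>

lemma compose_out:
  assumes r: "0 < r" and j: "2 \<le> j" and f: "f \<in> W" "S f \<in> V" "supp_in (ball x r) f"
  shows "avg s x (2 * (2 ^ j * r)) (shell x (2 ^ j * r)) (T (S f))
    \<le> ennreal ((T.K1 * L * 2 powr a * 2 powr b' + T.K2 * S.K1 * 2 powr b * G * 2 powr e)
        * wt \<alpha> e (c0 / 8) j (2 ^ j * r / \<tau>)) * avg p x r UNIV f"
proof -
  define R where "R = 2 ^ j * r"
  have R: "0 < R" using r by (simp add: R_def)
  have half: "2 ^ (j - 1) * r = R / 2" using j by (simp add: R_def power_diff)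
  have "r * 1 \<le> r * 2 ^ (j - 1)" using r by (intro mult_left_mono) auto
  then have r_le: "r \<le> R / 2" using half by (simp add: mult.commute)
  define u where "u = R / \<tau>"
  have u: "0 < u" using R T.pos by (simp add: u_def)
  define g where "g = S f"
  have g: "g \<in> V" using f by (simp add: g_def)
  define Z where "Z = avg p x r UNIV f"
  have "avg s x (2 * R) (shell x R) (T (trunc (ball x (R / 2)) g))
      \<le> ennreal (T.K1 * L * 2 powr a * 2 powr b' * wt \<alpha> e (c0 / 8) j u) * Z"
  proof -
    have 1: "avg s x (2 * R) (shell x R) (T (trunc (ball x (R / 2)) g))
        \<le> ennreal (T.K1 * wt a b (c / 4) 1 u) * avg q x (R / 2) (ball x (R / 2)) g"
      using T.off_out[of "R / 2" 1 "trunc (ball x (R / 2)) g" x] R g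
      by (simp add: avg_trunc T.V_trunc u_def)
    have "avg q x (R / 2) (ball x (R / 2)) g \<le> ennreal (L * Upsilon (u / 2) powr b') * avg p x (R / 2) UNIV f"
      using S.on_diag[of "R / 2" f x] R f supp_in_mono[OF f(3) subset_ball[OF r_le]]
      by (simp add: g_def u_def mult.commute)
    moreover have "avg p x (R / 2) UNIV f \<le> Z"
      unfolding Z_def using r r_le by (intro avg_superball S.p) auto
    ultimately have 2: "avg q x (R / 2) (ball x (R / 2)) g \<le> ennreal (L * Upsilon (u / 2) powr b') * Z"
      by (rule ennreal_mult_le_trans1) simp
    have "T.K1 * wt a b (c / 4) 1 u * (L * Upsilon (u / 2) powr b')
        = T.K1 * L * 2 powr a * (1 * Upsilon (u / 2) powr b' * (Upsilon u powr b * exp (- (c / 4 * u\<^sup>2))))"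
      by (simp add: wt_def)
    also have "\<dots> \<le> T.K1 * L * 2 powr a * (2 powr b' * wt \<alpha> e (c0 / 8) j u)"
    proof (intro mult_left_mono near_wt_le u)
      show "1 \<le> 2 powr (real j * \<alpha>)" using T.pos \<alpha> by (intro ge_one_powr_ge_zero) auto
    qed (use e T.pos S.pos c0 consts_pos in auto)
    finally show ?thesis
      using T.pos consts_pos by (intro ennreal_mult_le_trans[OF 1 2]) (auto simp: mult.assoc)
  qed
  moreover have "(\<Sum>i. avg s x (2 * R) (shell x R) (T (trunc (shell x (2 ^ i * (R / 2))) g)))
      \<le> ennreal (T.K2 * S.K1 * 2 powr b * G * 2 powr e * wt \<alpha> e (c0 / 8) j u) * Z"
  proof (rule ennreal_suminf_le_mult)
    define t where "t i = T.K2 * S.K1 * (2 powr b * 2 powr (real j * a') * wt (a + a') (b + b') c0 i (2 ^ i * (u / 2)))" for i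
    show "0 \<le> t i" for i using consts_pos by (simp add: t_def)
    show "(\<Sum>i<n. t i) \<le> T.K2 * S.K1 * 2 powr b * G * 2 powr e * wt \<alpha> e (c0 / 8) j u" for n
    proof -
      have "(\<Sum>i<n. t i)
          = T.K2 * S.K1 * 2 powr b * (2 powr (real j * a') * (\<Sum>i<n. wt (a + a') (b + b') c0 i (2 ^ i * (u / 2))))"
        by (simp add: t_def sum_distrib_left mult.assoc)
      also have "\<dots> \<le> T.K2 * S.K1 * 2 powr b * (2 powr (real j * a') * (G * Upsilon (u / 2) powr e * exp (- (c0 / 2 * (u / 2)\<^sup>2))))"
        using consts_pos u by (intro mult_left_mono G) auto
      also have "\<dots> \<le> T.K2 * S.K1 * 2 powr b * (G * 2 powr e * wt \<alpha> e (c0 / 8) j u)"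
        using consts_pos u \<alpha> e_pos G by (intro mult_left_mono far_sum_wt_le) auto
      finally show ?thesis by (simp add: mult.assoc)
    qed
    fix i
    define v where "v = 2 ^ i * (u / 2)"
    have v: "0 < v" using u by (simp add: v_def)
    have j1: "1 \<le> j - 1 + i" using j by simp
    have eq: "2 ^ (j - 1 + i) * r = 2 ^ i * (R / 2)"
      using half by (simp add: power_add mult_ac)
    have "avg s x (2 * R) (shell x R) (T (trunc (shell x (2 ^ i * (R / 2))) g))
        \<le> avg s x (2 * R) (ball x (2 * R)) (T (trunc (shell x (2 ^ i * (R / 2))) g))"
      using R g by (intro avg_mono T.q T.T_measurable T.V_trunc shell_subset_ball) auto
    also have "\<dots> \<le> ennreal (T.K2 * (2 powr (real i * a) * Upsilon (2 * v) powr b)) * avg q x (2 ^ i * R) (shell x (2 ^ i * (R / 2))) g"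
      using T.shell_to_ball[OF R, of "trunc (shell x (2 ^ i * (R / 2))) g" x i] g
      by (simp add: avg_trunc T.V_trunc v_def u_def mult.assoc)
    finally have 1: "avg s x (2 * R) (shell x R) (T (trunc (shell x (2 ^ i * (R / 2))) g))
        \<le> ennreal (T.K2 * (2 powr (real i * a) * Upsilon (2 * v) powr b)) * avg q x (2 ^ i * R) (shell x (2 ^ i * (R / 2))) g" .
    have 2: "avg q x (2 ^ i * R) (shell x (2 ^ i * (R / 2))) g
        \<le> ennreal (S.K1 * wt a' b' (d / 4) (j - 1 + i) v) * Z"
      using S.off_out[OF r j1, of f x] f unfolding eq
      by (simp add: g_def Z_def v_def u_def mult.commute)
    have "T.K2 * S.K1 * (wt a' b' (d / 4) (j - 1 + i) v * (2 powr (real i * a) * Upsilon (2 * v) powr b)) \<le> t i"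
      unfolding t_def v_def[symmetric] add.commute[of a a'] add.commute[of b b']
      using T.pos S.pos consts_pos v c0 by (intro mult_left_mono far_wt_le) auto
    then show "avg s x (2 * R) (shell x R) (T (trunc (shell x (2 ^ i * (R / 2))) g)) \<le> ennreal (t i) * Z"
      using consts_pos by (intro ennreal_mult_le_trans[OF 1 2]) (auto simp: mult_ac)
  qed
  ultimately have total: "avg s x (2 * R) (shell x R) (T (trunc (ball x (R / 2)) g)) +
      (\<Sum>i. avg s x (2 * R) (shell x R) (T (trunc (shell x (2 ^ i * (R / 2))) g)))
    \<le> ennreal (T.K1 * L * 2 powr a * 2 powr b' * wt \<alpha> e (c0 / 8) j u
        + T.K2 * S.K1 * 2 powr b * G * 2 powr e * wt \<alpha> e (c0 / 8) j u) * Z"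
    using T.pos S.pos C0_ge_1 consts_pos G by (intro ennreal_add_mult_le) auto
  have "avg s x (2 * R) (shell x R) (T g) \<le> avg s x (2 * R) (shell x R) (T (trunc (ball x (R / 2)) g)) +
      (\<Sum>i. avg s x (2 * R) (shell x R) (T (trunc (shell x (2 ^ i * (R / 2))) g)))"
    using R g by (intro T.avg_T_annular T.q) auto
  from order_trans[OF this total] show ?thesis
    by (simp add: g_def u_def Z_def R_def distrib_right)
qed

end

context doubling_space
begin

text \<open>\<open>C\<close> and \<open>c0\<close> are obtained before the operators and \<tau>,
  which expresses the uniformity in t.\<close>

lemma od_estimates_compose:
  fixes a b c K a' b' d L e \<alpha> :: real and p q s :: ennreal
  assumes e: "a + a' \<le> e" "b + b' \<le> e" "a + a' \<noteq> b + b' \<or> a + a' < e"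
    and \<alpha>: "a \<le> \<alpha>" "a' \<le> \<alpha>" "dim_quot D s \<le> \<alpha>"
    and pos: "0 < a" "0 < b" "0 < K" "0 < c" "0 < a'" "0 < b'" "0 < L" "0 < d"
  obtains C c0 where "0 < C" "0 < c0"
    "\<And>(V :: ('a \<Rightarrow> 'b::{real_normed_field, second_countable_topology}) set) T W S \<tau>.
      annular_od_operator M C0 V T q s a b K c \<tau> \<Longrightarrow> od_operator M C0 W S p q a' b' L d \<tau> \<Longrightarrow>
      od_estimates p s 2 \<alpha> e C c0 \<tau> {f \<in> W. S f \<in> V} (T \<circ> S)"
proof -
  define c1 where "c1 = min c d / 4"
  have c1: "0 < c1" "c1 \<le> c / 4" "c1 \<le> d / 4" using pos by (auto simp: c1_def)
  obtain G where G: "0 < G" "\<And>u n. 0 < u \<Longrightarrow>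
    (\<Sum>i<n. wt (a + a') (b + b') c1 i (2 ^ i * u)) \<le> G * Upsilon u powr e * exp (- (c1 / 2 * u\<^sup>2))"
    using sum_Upsilon_le[of "b + b'" c1 "a + a'" e] e c1 pos unfolding wt_def by auto
  \<comment> \<open>These four numbers are \<open>K1\<close> and \<open>K2\<close> of the two
    operators, written out because no operator is fixed yet.\<close>
  define k1 where "k1 = 3 * C0 ^ 10 * (2 powr (4 * a) * 2 powr b) * K"
  define l1 where "l1 = 3 * C0 ^ 10 * (2 powr (4 * a') * 2 powr b') * L"
  define k2 where "k2 = C0 ^ 2 * k1 * 4 powr b"
  define l2 where "l2 = C0 ^ 2 * l1 * 4 powr b'"
  have C0: "0 < C0" using C0_ge_1 by simp
  have kl: "0 < k1" "0 < l1" "0 < k2" "0 < l2"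
    using pos C0 by (simp_all add: k1_def l1_def k2_def l2_def)
  define X1 where "X1 = C0 * (K * 2 powr b) * (L * 2 powr b') + k1 * l1 * G"
  define X2 where "X2 = K * l1 * 2 powr a' * 2 powr b + k1 * l2 * 2 powr b' * G * 2 powr e"
  define X3 where "X3 = k1 * L * 2 powr a * 2 powr b' + k2 * l1 * 2 powr b * G * 2 powr e"
  have X: "0 < X1" "0 < X2" "0 < X3"
    using pos C0 kl G(1) unfolding X1_def X2_def X3_def by (auto intro!: add_pos_pos mult_pos_pos)
  show ?thesis
  proof (rule that[of "X1 + X2 + X3" "c1 / 8"])
    fix V W :: "('a \<Rightarrow> 'b) set" and T S \<tau>
    assume T: "annular_od_operator M C0 V T q s a b K c \<tau>" and S: "od_operator M C0 W S p q a' b' L d \<tau>"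
    interpret T: annular_od_operator M C0 V T q s a b K c \<tau> by fact
    interpret S: od_operator M C0 W S p q a' b' L d \<tau> by fact
    interpret od_composition M C0 V T q s a b K c \<tau> W S p a' b' L d e \<alpha> c1 G
      using e \<alpha> c1 G by unfold_locales auto
    have eqs: "T.K1 = k1" "S.K1 = l1" "T.K2 = k2" "S.K2 = l2"
      by (simp_all add: T.K1_def S.K1_def T.K2_def S.K2_def k1_def l1_def k2_def l2_def)
    show "od_estimates p s 2 \<alpha> e (X1 + X2 + X3) (c1 / 8) \<tau> {f \<in> W. S f \<in> V} (T \<circ> S)"
      unfolding od_estimates_def
    proof (intro conjI allI impI)
      fix x r f assume "0 < r" "f \<in> {f \<in> W. S f \<in> V}" "supp_in (ball x r) f"
      then show "avg s x r (ball x r) ((T \<circ> S) f)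
          \<le> ennreal ((X1 + X2 + X3) * Upsilon (r / \<tau>) powr e) * avg p x r UNIV f"
        using X by (auto intro!: ennreal_mult_le_trans1[OF compose_diag order_refl] mult_right_mono
            simp: eqs X1_def[symmetric])
    next
      fix x r f and j :: nat assume "0 < r" "2 \<le> j" "f \<in> {f \<in> W. S f \<in> V}" "supp_in (shell x (2 ^ j * r)) f"
      then show "avg s x r (ball x r) ((T \<circ> S) f)
          \<le> ennreal ((X1 + X2 + X3) * wt \<alpha> e (c1 / 8) j (2 ^ j * r / \<tau>)) * avg p x (2 * (2 ^ j * r)) UNIV f"
        using X by (auto intro!: ennreal_mult_le_trans1[OF compose_in order_refl] mult_right_mono
            simp: eqs X2_def[symmetric])
    next
      fix x r f and j :: nat assume "0 < r" "2 \<le> j" "f \<in> {f \<in> W. S f \<in> V}" "supp_in (ball x r) f"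
      then show "avg s x (2 * (2 ^ j * r)) (shell x (2 ^ j * r)) ((T \<circ> S) f)
          \<le> ennreal ((X1 + X2 + X3) * wt \<alpha> e (c1 / 8) j (2 ^ j * r / \<tau>)) * avg p x r UNIV f"
        using X by (auto intro!: ennreal_mult_le_trans1[OF compose_out order_refl] mult_right_mono
            simp: eqs X3_def[symmetric])
    qed
  qed (use X c1 in auto)
qed

end

section \<open>Uniform boundedness\<close>

context doubling_space
begin

text \<open>The balls about \<open>x\<close> exhaust the space: monotone convergence settles finite
  p, a countable union of null sets p = \<infinity>. This reduces a global norm to balls, for which
  finite partitions are available.\<close>

lemma eLp_le_of_balls:
  assumes p: "1 \<le> p" and [measurable]: "F \<in> borel_measurable M"
    and le: "\<And>n. eLp M p (\<lambda>y. indicator (ball x (real n)) y * F y) \<le> v"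
  shows "eLp M p F \<le> v"
proof -
  have [measurable]: "ball x (real n) \<in> sets borel" for n by simp
  have meas: "(\<lambda>y. indicator (ball x (real n)) y * F y) \<in> borel_measurable M" for n
    by measurable
  have large: "\<exists>n. y \<in> ball x (real n)" for y
    using reals_Archimedean2[of "dist x y"] by auto
  have "if p = \<infinity> then AE y in M. F y \<le> v
     else (\<integral>\<^sup>+y. epowr (F y) (enn2real p) \<partial>M) \<le> epowr v (enn2real p)"
  proof (cases "p = \<infinity>")
    case True
    have "AE y in M. indicator (ball x (real n)) y * F y \<le> v" for n
      using iffD1[OF eLp_le_iff[OF p meas] le[of n]] True by simp
    then have "AE y in M. \<forall>n. indicator (ball x (real n)) y * F y \<le> v"
      by (simp add: AE_all_countable)
    moreover have "F y \<le> v" if "\<forall>n. indicator (ball x (real n)) y * F y \<le> v" for y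
    proof -
      obtain n where "y \<in> ball x (real n)" using large by blast
      with that[rule_format, of n] show ?thesis by simp
    qed
    ultimately have "AE y in M. F y \<le> v" by (rule eventually_mono)
    then show ?thesis using True by simp
  next
    case False
    define P where "P = enn2real p"
    define H where "H n y = indicator (ball x (real n)) y * epowr (F y) P" for n y
    have "H n \<in> borel_measurable M" for n
      unfolding H_def by measurable
    have H: "H n y = epowr (indicator (ball x (real n)) y * F y) P" for n y
      by (auto simp: H_def indicator_def)
    have "epowr (F y) P = (SUP n. H n y)" for y
    proof (rule antisym)
      obtain n where "y \<in> ball x (real n)" using large by blast
      then have "epowr (F y) P = H n y" by (simp add: H_def)
      then show "epowr (F y) P \<le> (SUP n. H n y)" by (metis SUP_upper UNIV_I)
    qed (auto intro!: SUP_least simp: H_def indicator_def)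
    then have "(\<integral>\<^sup>+y. epowr (F y) P \<partial>M) = (\<integral>\<^sup>+y. (SUP n. H n y) \<partial>M)" by simp
    also have "\<dots> = (SUP n. \<integral>\<^sup>+y. H n y \<partial>M)"
    proof (rule nn_integral_monotone_convergence_SUP)
      show "incseq H" by (auto simp: incseq_def le_fun_def H_def indicator_def)
    qed fact
    also have "\<dots> \<le> epowr v P"
    proof (rule SUP_least)
      fix n show "(\<integral>\<^sup>+y. H n y \<partial>M) \<le> epowr v P"
        using iffD1[OF eLp_le_iff[OF p meas] le[of n]] False by (simp add: H P_def)
    qed
    finally show ?thesis using False by (simp add: P_def)
  qed
  then show ?thesis using p by (simp add: eLp_le_iff)
qed

lemma sum_indicator_disjoint:
  fixes m j :: nat
  assumes "disjoint_family_on A {..<m}" "j < m" "y \<in> A j"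
  shows "(\<Sum>i<m. indicator (A i) y * F i) = (F j :: ennreal)"
proof -
  have "(\<Sum>i<m. indicator (A i) y * F i) = (\<Sum>i<m. if i = j then F i else 0)"
    using assms by (intro sum.cong refl) (auto simp: disjoint_family_on_def indicator_def)
  also have "\<dots> = F j" using assms(2) by (subst sum.delta) auto
  finally show ?thesis .
qed

text \<open>Since the \<open>A i\<close> are disjoint, the p-th power of the sum is the sum of the
  p-th powers. The overlap bound for the \<open>Q i\<close> then gives the constant k N^(1/p), which
  is at most k N. For p = \<infinity> at most one summand is nonzero at each point.\<close>

lemma eLp_patch:
  fixes m :: nat and F :: "nat \<Rightarrow> 'a \<Rightarrow> ennreal"
  assumes p: "1 \<le> p" and A: "\<And>i. i < m \<Longrightarrow> A i \<in> sets borel" "disjoint_family_on A {..<m}"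
    and F: "\<And>i. i < m \<Longrightarrow> F i \<in> borel_measurable M"
    and Q: "\<And>i. i < m \<Longrightarrow> Q i \<in> sets borel"
    and [measurable]: "h \<in> borel_measurable M"
    and k: "0 \<le> k"
    and le: "\<And>i. i < m \<Longrightarrow> eLp M p (\<lambda>y. indicator (A i) y * F i y) \<le> ennreal k * eLp M p (\<lambda>y. indicator (Q i) y * h y)"
    and N: "1 \<le> N" "\<And>y. (\<Sum>i<m. indicator (Q i) y) \<le> N"
  shows "eLp M p (\<lambda>y. \<Sum>i<m. indicator (A i) y * F i y) \<le> ennreal (k * N) * eLp M p h"
proof -
  have AF [measurable]: "(\<lambda>y. indicator (A i) y * F i y) \<in> borel_measurable M" if "i < m" for i
  proof -
    note [measurable] = A(1)[OF that] F[OF that]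
    show ?thesis by measurable
  qed
  then have meas: "(\<lambda>y. \<Sum>i<m. indicator (A i) y * F i y) \<in> borel_measurable M"
    by (intro borel_measurable_sum) auto
  have Qh [measurable]: "(\<lambda>y. indicator (Q i) y * h y) \<in> borel_measurable M" if "i < m" for i
  proof -
    note [measurable] = Q[OF that]
    show ?thesis by measurable
  qed
  have "if p = \<infinity> then AE y in M. (\<Sum>i<m. indicator (A i) y * F i y) \<le> ennreal (k * N) * eLp M p h
     else (\<integral>\<^sup>+y. epowr (\<Sum>i<m. indicator (A i) y * F i y) (enn2real p) \<partial>M) \<le> epowr (ennreal (k * N) * eLp M p h) (enn2real p)"
  proof (cases "p = \<infinity>")
    case True
    have "AE y in M. \<forall>i\<in>{..<m}. indicator (A i) y * F i y \<le> ennreal (k * N) * eLp M p h"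
    proof (intro AE_finite_allI)
      fix i assume "i \<in> {..<m}"
      then have i: "i < m" by simp
      have "eLp M p (\<lambda>y. indicator (Q i) y * h y) \<le> eLp M p h"
        using i by (intro eLp_mono_AE p Qh AE_I2) (auto simp: indicator_def)
      moreover have "k \<le> k * N" using mult_left_mono[OF N(1) k] by simp
      ultimately have "eLp M p (\<lambda>y. indicator (A i) y * F i y) \<le> ennreal (k * N) * eLp M p h"
        by (rule ennreal_mult_le_trans1[OF le[OF i]])
      then show "AE y in M. indicator (A i) y * F i y \<le> ennreal (k * N) * eLp M p h"
        using True AF[OF i] p by (simp add: eLp_le_iff)
    qed simp
    then have "AE y in M. (\<Sum>i<m. indicator (A i) y * F i y) \<le> ennreal (k * N) * eLp M p h"
    proof eventually_elim
      case (elim y)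
      show ?case
      proof (cases "\<exists>j<m. y \<in> A j")
        case True
        then obtain j where j: "j < m" "y \<in> A j" by auto
        have "indicator (A j) y * F j y \<le> ennreal (k * N) * eLp M p h" using elim j(1) by blast
        then show ?thesis using j(2) unfolding sum_indicator_disjoint[OF A(2) j] by simp
      next
        case False
        then have "(\<Sum>i<m. indicator (A i) y * F i y) = 0" by (intro sum.neutral) auto
        then show ?thesis by simp
      qed
    qed
    then show ?thesis using True by simp
  next
    case False
    define P where "P = enn2real p"
    have P: "1 \<le> P" using enn2real_pos_exponent[OF p False] by (simp add: P_def)
    have eLp_P: "epowr (eLp M p H) P = (\<integral>\<^sup>+y. epowr (H y) P \<partial>M)" for H
      using False P by (simp add: eLp_def P_def epowr_epowr')
    have "epowr (\<Sum>i<m. indicator (A i) y * F i y) P = (\<Sum>i<m. epowr (indicator (A i) y * F i y) P)" for y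
    proof -
      have eq: "epowr (indicator (A i) y * F i y) P = indicator (A i) y * epowr (F i y) P" for i
        by (auto simp: indicator_def)
      show ?thesis
      proof (cases "\<exists>j<m. y \<in> A j")
        case True
        then obtain j where j: "j < m" "y \<in> A j" by auto
        show ?thesis unfolding eq by (simp only: sum_indicator_disjoint[OF A(2) j])
      next
        case False
        then have zero: "(\<Sum>i<m. indicator (A i) y * G i) = 0" for G :: "nat \<Rightarrow> ennreal"
          by (intro sum.neutral) auto
        show ?thesis unfolding eq zero by simp
      qed
    qed
    then have "(\<integral>\<^sup>+y. epowr (\<Sum>i<m. indicator (A i) y * F i y) P \<partial>M)
        = (\<integral>\<^sup>+y. (\<Sum>i<m. epowr (indicator (A i) y * F i y) P) \<partial>M)"
      by (simp only:)
    also have "\<dots> = (\<Sum>i<m. \<integral>\<^sup>+y. epowr (indicator (A i) y * F i y) P \<partial>M)"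
      by (rule nn_integral_sum) (simp add: AF borel_measurable_epowr)
    also have "\<dots> \<le> (\<Sum>i<m. ennreal (k powr P) * (\<integral>\<^sup>+y. epowr (indicator (Q i) y * h y) P \<partial>M))"
    proof (rule sum_mono)
      fix i assume "i \<in> {..<m}"
      then have "epowr (eLp M p (\<lambda>y. indicator (A i) y * F i y)) P
          \<le> epowr (ennreal k * eLp M p (\<lambda>y. indicator (Q i) y * h y)) P"
        using le[of i] P by (intro epowr_mono) auto
      then show "(\<integral>\<^sup>+y. epowr (indicator (A i) y * F i y) P \<partial>M)
          \<le> ennreal (k powr P) * (\<integral>\<^sup>+y. epowr (indicator (Q i) y * h y) P \<partial>M)"
        using P k by (simp add: eLp_P epowr_mult epowr_ennreal)
    qed
    also have "\<dots> = ennreal (k powr P) * (\<integral>\<^sup>+y. (\<Sum>i<m. epowr (indicator (Q i) y * h y) P) \<partial>M)"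
      using Qh by (subst nn_integral_sum) (auto simp: sum_distrib_left)
    also have "\<dots> \<le> ennreal (k powr P) * (\<integral>\<^sup>+y. ennreal N * epowr (h y) P \<partial>M)"
    proof (intro mult_left_mono nn_integral_mono)
      fix y
      have "(\<Sum>i<m. epowr (indicator (Q i) y * h y) P) = (\<Sum>i<m. ennreal (indicator (Q i) y) * epowr (h y) P)"
        by (intro sum.cong refl) (auto simp: indicator_def)
      also have "\<dots> = ennreal (\<Sum>i<m. indicator (Q i) y) * epowr (h y) P"
        by (simp add: sum_distrib_right[symmetric])
      also have "\<dots> \<le> ennreal N * epowr (h y) P"
        by (intro mult_right_mono ennreal_leI N) auto
      finally show "(\<Sum>i<m. epowr (indicator (Q i) y * h y) P) \<le> ennreal N * epowr (h y) P" .
    qed simp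
    also have "\<dots> = ennreal (k powr P * N) * (\<integral>\<^sup>+y. epowr (h y) P \<partial>M)"
      using N by (simp add: nn_integral_cmult ennreal_mult mult.assoc)
    also have "\<dots> \<le> ennreal ((k * N) powr P) * (\<integral>\<^sup>+y. epowr (h y) P \<partial>M)"
    proof (intro mult_right_mono ennreal_leI)
      have "N powr 1 \<le> N powr P" using N P by (intro powr_mono) auto
      then show "k powr P * N \<le> (k * N) powr P"
        using N(1) by (simp add: powr_mult mult_left_mono)
    qed simp
    also have "\<dots> = epowr (ennreal (k * N) * eLp M p h) P"
      using P k N by (simp add: epowr_mult epowr_ennreal eLp_P)
    finally show ?thesis using False by (simp add: P_def)
  qed
  then show ?thesis by (simp only: eLp_le_iff[OF p meas])
qed

text \<open>Both sides have the same exponent, so the normalising factors cancel once the input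
  average is also normalised by the ball of radius r.\<close>

lemma eLp_le_of_avg_le:
  assumes "1 \<le> p" "0 < r" "r \<le> R" "avg p x r E h \<le> ennreal k * avg p x R F g"
  shows "eLp M p (\<lambda>y. indicator E y * ennreal (norm (h y))) \<le> ennreal k * eLp M p (\<lambda>y. indicator F y * ennreal (norm (g y)))"
proof -
  define v where "v = ennreal (rvol p x r)"
  have v: "v \<noteq> 0" "v \<noteq> top" "0 < v" "v < top" using rvol_pos[OF assms(2), of p x] by (auto simp: v_def)
  have "avg p x R F g \<le> avg p x r F g"
    using assms by (intro avg_superball) auto
  with assms(4) have "avg p x r E h \<le> ennreal k * avg p x r F g"
    by (rule ennreal_mult_le_trans1) simp
  then have "avg p x r E h * v \<le> ennreal k * avg p x r F g * v" by (rule mult_right_mono) simp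
  then show ?thesis
    using v unfolding avg_def v_def[symmetric]
    by (simp add: mult.assoc ennreal_divide_times)
qed

lemma uniform_bound:
  fixes a b c K :: real and p :: ennreal
  assumes pos: "0 < a" "0 < b" "0 < K" "0 < c"
  obtains X where "0 \<le> X"
    "\<And>(V :: ('a \<Rightarrow> 'b::{real_normed_field, second_countable_topology}) set) T \<tau> f.
      annular_od_operator M C0 V T p p a b K c \<tau> \<Longrightarrow> f \<in> V \<Longrightarrow>
      eLp M p (\<lambda>y. ennreal (norm (T f y))) \<le> ennreal X * eLp M p (\<lambda>y. ennreal (norm (f y)))"
proof -
  \<comment> \<open>The overlap C0^(k + 4) = C0^4 2^(k D) raises the first exponent to a + D. The
    exponent a + D + b + 1 exceeds both a + D and b, as the series bound asks, and at u = 1 the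
    power of \<open>Upsilon\<close> equals 1.\<close>
  obtain G where G: "0 < G" "\<And>u n. 0 < u \<Longrightarrow> (\<Sum>i<n. wt (a + D) b (c / 4) i (2 ^ i * u))
      \<le> G * Upsilon u powr (a + D + b + 1) * exp (- (c / 4 / 2 * u\<^sup>2))"
    using sum_Upsilon_le[of b "c / 4" "a + D" "a + D + b + 1"] pos D_nonneg unfolding wt_def by auto
  have G1: "(\<Sum>i<n. wt (a + D) b (c / 4) i (2 ^ i)) \<le> G" for n
  proof -
    have "(\<Sum>i<n. wt (a + D) b (c / 4) i (2 ^ i)) \<le> G * exp (- (c / 4 / 2))"
      using G(2)[of 1 n] by (simp add: Upsilon_def)
    also have "\<dots> \<le> G" using G(1) pos by simp
    finally show ?thesis .
  qed
  define k1 where "k1 = 3 * C0 ^ 10 * (2 powr (4 * a) * 2 powr b) * K"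
  \<comment> \<open>The central piece, k = 0, comes without decay; exp (c/4) compensates the
    Gaussian factor that \<open>wt\<close> contains at u = 1.\<close>
  define H where "H = k1 + C0 * (K * 2 powr b) * exp (c / 4)"
  have k1: "0 \<le> k1" using pos C0_ge_1 by (simp add: k1_def)
  have H: "0 \<le> H" "k1 \<le> H" using k1 pos C0_ge_1 by (auto simp: H_def)
  show ?thesis
  proof (rule that[of "H * C0 ^ 4 * G"])
    show "0 \<le> H * C0 ^ 4 * G" using H G C0_ge_1 by simp
    fix V :: "('a \<Rightarrow> 'b) set" and T \<tau> f
    assume "annular_od_operator M C0 V T p p a b K c \<tau>" and f: "f \<in> V"
    interpret annular_od_operator M C0 V T p p a b K c \<tau> by fact
    note [measurable] = V_measurable[OF f] T_measurable[OF f]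
    have K1: "K1 = k1" by (simp add: K1_def k1_def)
    have \<tau>: "0 < \<tau>" using pos(5) by auto
    show "eLp M p (\<lambda>y. ennreal (norm (T f y))) \<le> ennreal (H * C0 ^ 4 * G) * eLp M p (\<lambda>y. ennreal (norm (f y)))"
      (is "_ \<le> _ * ?Z")
    proof (rule eLp_le_of_balls[OF p])
      fix x n
      obtain m :: nat and z A where z: "inj_on z {..<m}" "z ` {..<m} \<subseteq> ball x (real n)" "separated \<tau> (z ` {..<m})"
        and A: "\<And>i. i < m \<Longrightarrow> A i \<in> sets M" "\<And>i. i < m \<Longrightarrow> A i \<subseteq> ball (z i) \<tau>"
        "disjoint_family_on A {..<m}" "ball x (real n) = (\<Union>i<m. A i)"
        using ball_partition[OF \<tau>, of x "real n"] by metis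
      \<comment> \<open>The central piece has radius 2 \<tau>, so that all shells after it have
        index at least 1 relative to the ball of radius \<tau>.\<close>
      define P where "P k i = (if k = 0 then ball (z i) (2 * \<tau>) else shell (z i) (2 ^ k * \<tau>))" for k :: nat and i
      have P_sets: "P k i \<in> sets borel" and P_sub: "P k i \<subseteq> ball (z i) (2 ^ (k + 1) * \<tau>)" for k i
        using shell_subset_ball[of "z i" "2 ^ k * \<tau>"] by (auto simp: P_def mult.assoc)
      define g where "g k i = trunc (P k i) f" for k i
      have g: "g k i \<in> V" for k i unfolding g_def by (intro V_trunc f P_sets)
      note [measurable] = T_measurable[OF g]
      define F where "F k i y = ennreal (norm (T (g k i) y))" for k i y
      have F [measurable]: "F k i \<in> borel_measurable M" for k i unfolding F_def by measurable
      have "AE y in M. \<forall>i\<in>{..<m}. ennreal (norm (T f y)) \<le> (\<Sum>k. F k i y)"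
      proof (intro AE_finite_allI)
        fix i
        have R: "0 < 2 * \<tau>" using \<tau> by simp
        have "(\<Sum>k. F k i y) = ennreal (norm (T (trunc (ball (z i) (2 * \<tau>)) f) y))
            + (\<Sum>k. ennreal (norm (T (trunc (shell (z i) (2 ^ k * (2 * \<tau>))) f) y)))" for y
          unfolding suminf_ennreal_Suc_shift[of "\<lambda>k. F k i y"]
          by (simp add: F_def g_def P_def mult.assoc mult.left_commute[of _ 2])
        then show "AE y in M. ennreal (norm (T f y)) \<le> (\<Sum>k. F k i y)"
          using T_annular[OF f R, of "z i"] by simp
      qed simp
      then have "AE y in M. indicator (ball x (real n)) y * ennreal (norm (T f y))
          \<le> (\<Sum>k. \<Sum>i<m. indicator (A i) y * F k i y)"
      proof eventually_elim
        case (elim y)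
        show ?case
        proof (cases "y \<in> ball x (real n)")
          case True
          then obtain j where j: "j < m" "y \<in> A j" using A(4) by auto
          have "(\<Sum>i<m. indicator (A i) y * F k i y) = F k j y" for k
            by (rule sum_indicator_disjoint[OF A(3) j])
          then show ?thesis using elim j True by auto
        qed simp
      qed
      then have "eLp M p (\<lambda>y. indicator (ball x (real n)) y * ennreal (norm (T f y)))
          \<le> eLp M p (\<lambda>y. \<Sum>k. \<Sum>i<m. indicator (A i) y * F k i y)"
      proof (rule eLp_mono_AE[OF p, rotated])
        have [measurable]: "ball x (real n) \<in> sets borel" by simp
        show "(\<lambda>y. indicator (ball x (real n)) y * ennreal (norm (T f y))) \<in> borel_measurable M"
          by measurable
      qed
      also have "\<dots> \<le> (\<Sum>k. eLp M p (\<lambda>y. \<Sum>i<m. indicator (A i) y * F k i y))"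
        using A(1) F by (intro eLp_suminf_le p borel_measurable_sum borel_measurable_times_ennreal borel_measurable_indicator) auto
      also have "\<dots> \<le> ennreal (H * C0 ^ 4 * G) * ?Z"
      proof (rule ennreal_suminf_le_mult)
        fix k
        define q where "q = H * wt a b (c / 4) k (2 ^ k)"
        have q: "0 \<le> q" using H by (simp add: q_def)
        define N where "N = C0 ^ (k + 4)"
        show "eLp M p (\<lambda>y. \<Sum>i<m. indicator (A i) y * F k i y) \<le> ennreal (q * N) * ?Z"
        proof (rule eLp_patch[OF p _ A(3) F, where Q = "\<lambda>i. ball (z i) (2 ^ (k + 1) * \<tau>)"])
          fix i assume i: "i < m"
          have "avg p (z i) \<tau> (ball (z i) \<tau>) (T (g k i)) \<le> ennreal q * avg p (z i) (2 * (2 ^ k * \<tau>)) UNIV (g k i)"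
          proof (cases "k = 0")
            case True
            have "avg p (z i) \<tau> (ball (z i) \<tau>) (T (g k i)) \<le> ennreal (C0 ^ 1) * avg p (z i) (2 * \<tau>) (ball (z i) \<tau>) (T (g k i))"
              using \<tau> by (intro avg_change p) auto
            also have "\<dots> \<le> ennreal (C0 ^ 1) * avg p (z i) (2 * \<tau>) (ball (z i) (2 * \<tau>)) (T (g k i))"
              using \<tau> g by (intro mult_left_mono avg_mono p T_measurable) auto
            finally have 1: "avg p (z i) \<tau> (ball (z i) \<tau>) (T (g k i)) \<le> ennreal C0 * avg p (z i) (2 * \<tau>) (ball (z i) (2 * \<tau>)) (T (g k i))"
              by simp
            have 2: "avg p (z i) (2 * \<tau>) (ball (z i) (2 * \<tau>)) (T (g k i)) \<le> ennreal (K * 2 powr b) * avg p (z i) (2 * \<tau>) UNIV (g k i)"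
              using on_diag[of "2 * \<tau>" "g k i" "z i"] \<tau> g[of k i] True by (simp add: g_def P_def Upsilon_def)
            have "C0 * (K * 2 powr b) = C0 * (K * 2 powr b) * exp (c / 4) * exp (- (c / 4))"
              by (simp add: mult.assoc exp_minus)
            also have "\<dots> \<le> H * exp (- (c / 4))" using k1 by (intro mult_right_mono) (auto simp: H_def)
            also have "\<dots> = q" by (simp add: q_def wt_def Upsilon_def True)
            finally show ?thesis
              using True C0_ge_1 ennreal_mult_le_trans[OF 1 2, of q] by simp
          next
            case False
            then have "avg p (z i) \<tau> (ball (z i) \<tau>) (T (g k i))
                \<le> ennreal (K1 * wt a b (c / 4) k (2 ^ k * \<tau> / \<tau>)) * avg p (z i) (2 * (2 ^ k * \<tau>)) UNIV (g k i)"
              using \<tau> g[of k i] by (intro off_in) (auto simp: g_def P_def)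
            then show ?thesis
            proof (rule ennreal_mult_le_trans1)
              show "K1 * wt a b (c / 4) k (2 ^ k * \<tau> / \<tau>) \<le> q"
                using \<tau> H unfolding K1 q_def by (simp add: mult_right_mono)
            qed simp
          qed
          moreover have "\<tau> * 1 \<le> \<tau> * (2 * 2 ^ k)"
            using \<tau> one_le_power[of "2::real" "Suc k"] by (intro mult_left_mono) auto
          ultimately have "eLp M p (\<lambda>y. indicator (ball (z i) \<tau>) y * ennreal (norm (T (g k i) y)))
              \<le> ennreal q * eLp M p (\<lambda>y. indicator UNIV y * ennreal (norm (g k i y)))"
            using \<tau> by (intro eLp_le_of_avg_le p) (auto simp: mult_ac)
          moreover have "eLp M p (\<lambda>y. indicator UNIV y * ennreal (norm (g k i y)))
              \<le> eLp M p (\<lambda>y. indicator (ball (z i) (2 ^ (k + 1) * \<tau>)) y * ennreal (norm (f y)))"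
          proof (intro eLp_mono_AE p AE_I2)
            have [measurable]: "g k i \<in> borel_measurable M" by (intro V_measurable g)
            show "(\<lambda>y. indicator UNIV y * ennreal (norm (g k i y))) \<in> borel_measurable M" by measurable
            show "indicator UNIV y * ennreal (norm (g k i y))
              \<le> indicator (ball (z i) (2 ^ (k + 1) * \<tau>)) y * ennreal (norm (f y))" for y
              using P_sub[of k i] by (auto simp: g_def trunc_def indicator_def)
          qed
          ultimately have "eLp M p (\<lambda>y. indicator (ball (z i) \<tau>) y * ennreal (norm (T (g k i) y)))
              \<le> ennreal q * eLp M p (\<lambda>y. indicator (ball (z i) (2 ^ (k + 1) * \<tau>)) y * ennreal (norm (f y)))"
            by (rule ennreal_mult_le_trans1) simp
          moreover have "eLp M p (\<lambda>y. indicator (A i) y * F k i y)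
              \<le> eLp M p (\<lambda>y. indicator (ball (z i) \<tau>) y * ennreal (norm (T (g k i) y)))"
          proof (intro eLp_mono_AE p AE_I2)
            show "(\<lambda>y. indicator (A i) y * F k i y) \<in> borel_measurable M"
              using A(1)[OF i] F by (intro borel_measurable_times_ennreal borel_measurable_indicator) auto
            show "indicator (A i) y * F k i y \<le> indicator (ball (z i) \<tau>) y * ennreal (norm (T (g k i) y))" for y
              using A(2)[OF i] by (auto simp: F_def indicator_def)
          qed
          ultimately show "eLp M p (\<lambda>y. indicator (A i) y * F k i y)
              \<le> ennreal q * eLp M p (\<lambda>y. indicator (ball (z i) (2 ^ (k + 1) * \<tau>)) y * ennreal (norm (f y)))"
            by (rule order_trans[rotated])
        next
          fix y
          \<comment> \<open>The centres of the balls that contain \<open>y\<close> lie within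
            2^(k+1) \<tau> of \<open>y\<close> and are \<tau>-separated, so the volume count with k
            + 1 in place of k bounds their number.\<close>
          define I where "I = {i. i < m \<and> y \<in> ball (z i) (2 ^ (k + 1) * \<tau>)}"
          have I: "finite I" "I \<subseteq> {..<m}" by (auto simp: I_def)
          have "(\<Sum>i<m. indicator (ball (z i) (2 ^ (k + 1) * \<tau>)) y) = (\<Sum>i\<in>I. 1 :: real)"
            using I by (intro sum.mono_neutral_cong_right) (auto simp: I_def)
          also have "\<dots> = real (card (z ` I))"
            using card_image[OF inj_on_subset[OF z(1) I(2)]] by simp
          also have "\<dots> \<le> C0 ^ (k + 1 + 3)"
          proof (rule card_separated_le[OF \<tau>])
            show "separated \<tau> (z ` I)" using z(3) I(2) by (auto simp: separated_def)
            show "z ` I \<subseteq> ball y (2 ^ (k + 1) * \<tau>)" by (auto simp: I_def dist_commute)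
          qed (use I in auto)
          finally show "(\<Sum>i<m. indicator (ball (z i) (2 ^ (k + 1) * \<tau>)) y) \<le> N"
            by (simp add: N_def add.commute)
        next
          show "1 \<le> N" unfolding N_def using C0_ge_1 by (rule one_le_power)
        qed (use A q in auto)
      next
        show "0 \<le> H * wt a b (c / 4) k (2 ^ k) * C0 ^ (k + 4)" for k
          using H C0_ge_1 by simp
      next
        fix l
        have "H * wt a b (c / 4) k (2 ^ k) * C0 ^ (k + 4) = H * C0 ^ 4 * wt (a + D) b (c / 4) k (2 ^ k)" for k
        proof -
          have "C0 ^ k = C0 powr real k" using C0_ge_1 by (simp add: powr_realpow)
          also have "\<dots> = (2 powr D) powr real k" by (simp add: C0_eq[symmetric])
          also have "\<dots> = 2 powr (real k * D)" by (simp add: powr_powr mult.commute)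
          finally show ?thesis by (simp add: wt_def power_add powr_add distrib_left)
        qed
        then have "(\<Sum>k<l. H * wt a b (c / 4) k (2 ^ k) * C0 ^ (k + 4)) = H * C0 ^ 4 * (\<Sum>k<l. wt (a + D) b (c / 4) k (2 ^ k))"
          by (simp only: sum_distrib_left)
        also have "\<dots> \<le> H * C0 ^ 4 * G"
          using H C0_ge_1 by (intro mult_left_mono G1) auto
        finally show "(\<Sum>k<l. H * wt a b (c / 4) k (2 ^ k) * C0 ^ (k + 4)) \<le> H * C0 ^ 4 * G" .
      qed
      finally show "eLp M p (\<lambda>y. indicator (ball x (real n)) y * ennreal (norm (T f y)))
          \<le> ennreal (H * C0 ^ 4 * G) * ?Z" .
    qed measurable
  qed
qed

end

section \<open>The theorem\<close>

lemma ball_UN_nat: "(\<Union>n::nat. ball x (2 ^ n * r)) = UNIV" if "0 < r" for x :: "'a::metric_space"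
proof -
  have "y \<in> (\<Union>n::nat. ball x (2 ^ n * r))" for y
  proof -
    obtain n where "dist x y / r < 2 ^ n" using real_arch_pow[of 2 "dist x y / r"] by auto
    then show ?thesis using that by (auto simp: field_simps)
  qed
  then show ?thesis by auto
qed

text \<open>If one ball were null, doubling would make all its dilates null, and they exhaust the
  space. The doubling constants are the nonnegative upper bounds of the volume ratios, so their
  infimum is one of them and \<open>LEAST\<close> is attained. It is at least 1 because volumes grow
  with the radius.\<close>

lemma homogeneous_type_imp_doubling_space:
  fixes M :: "'a::metric_space measure"
  assumes M: "homogeneous_type M" and nz: "emeasure M (space M) \<noteq> 0"
  shows "doubling_space M (LEAST C. doubling_const M C)"
proof -
  have sets: "sets M = sets borel"
    and fin: "\<And>x r. 0 < r \<Longrightarrow> emeasure M (ball x r) < \<infinity>"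
    and ex: "\<exists>C. doubling_const M C"
    using M by (auto simp: homogeneous_type_def)
  have space: "space M = UNIV" using sets_eq_imp_space_eq[OF sets] by simp
  have pos: "0 < emeasure M (ball x r)" if r: "0 < r" for x r
  proof (rule ccontr)
    assume "\<not> 0 < emeasure M (ball x r)"
    then have zero: "emeasure M (ball x r) = 0" by simp
    obtain C where C: "doubling_const M C" using ex by auto
    have "emeasure M (ball x (2 ^ n * r)) = 0" for n
    proof (induction n)
      case (Suc n)
      have "emeasure M (ball x (2 * (2 ^ n * r))) \<le> ennreal C * emeasure M (ball x (2 ^ n * r))"
        using C r unfolding doubling_const_def by (metis mult_pos_pos zero_less_numeral zero_less_power)
      then show ?case using Suc by (simp add: mult.assoc)
    qed (use zero in simp)
    then have "emeasure M (\<Union>n::nat. ball x (2 ^ n * r)) = 0"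
      using sets by (intro emeasure_UN_eq_0) auto
    then show False using nz by (simp add: ball_UN_nat[OF r] space)
  qed
  define m where "m x r = measure M (ball x r)" for x r
  have em: "emeasure M (ball x r) = ennreal (m x r)" if "0 < r" for x r
    using fin[OF that] by (simp add: m_def emeasure_eq_ennreal_measure less_top)
  have m_pos: "0 < m x r" if "0 < r" for x r
    using pos[OF that] em[OF that] by simp
  define S where "S = {C. doubling_const M C}"
  have S_iff: "C \<in> S \<longleftrightarrow> 0 \<le> C \<and> (\<forall>x r. 0 < r \<longrightarrow> m x (2 * r) / m x r \<le> C)" for C
  proof -
    have "emeasure M (ball x (2 * r)) \<le> ennreal C * emeasure M (ball x r) \<longleftrightarrow> m x (2 * r) / m x r \<le> C"
      if "0 < r" "0 \<le> C" for x r
    proof -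
      have "emeasure M (ball x (2 * r)) \<le> ennreal C * emeasure M (ball x r) \<longleftrightarrow> m x (2 * r) \<le> C * m x r"
        using that m_pos[of r x] by (simp add: em ennreal_mult[symmetric])
      then show ?thesis using m_pos[OF that(1), of x] by (simp add: pos_divide_le_eq)
    qed
    then show ?thesis by (auto simp: S_def doubling_const_def)
  qed
  have S: "S \<noteq> {}" "bdd_below S"
    using ex S_iff by (auto simp: S_def intro!: bdd_belowI[of _ 0])
  define C1 where "C1 = Inf S"
  have "m x (2 * r) / m x r \<le> C1" if "0 < r" for x r
    unfolding C1_def using S(1) S_iff that by (intro cInf_greatest) auto
  moreover have "0 \<le> C1"
    unfolding C1_def using S(1) S_iff by (intro cInf_greatest) auto
  ultimately have C1: "C1 \<in> S" by (simp add: S_iff)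
  have least: "(LEAST C. doubling_const M C) = C1"
    using C1 cInf_lower[OF _ S(2)] by (intro Least_equality) (auto simp: S_def C1_def)
  have "1 \<le> m x 2 / m x 1" for x
  proof -
    have "emeasure M (ball x 1) \<le> emeasure M (ball x 2)"
      using sets by (intro emeasure_mono subset_ball) auto
    then show ?thesis using m_pos[of 1 x] m_pos[of 2 x] by (simp add: em)
  qed
  then have "1 \<le> C1" using C1 by (auto simp: S_iff) (metis mult_1_right order_trans zero_less_one)
  then show ?thesis
    unfolding least using sets fin pos C1
    by unfold_locales (auto simp: S_def doubling_const_def)
qed

text \<open>For the zero measure every integral vanishes, and a quotient with numerator 0 is 0 in
  the extended reals, even 0/0. Measurability matters for p = \<infinity>, where
  \<open>esssup\<close> of a nonmeasurable function would be infinite.\<close>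

lemma Lp_average_null:
  assumes "emeasure M (space M) = 0" "g \<in> borel_measurable M" "E \<in> sets M"
  shows "Lp_average M p B E g = 0"
proof -
  have null: "AE x in M. P x" for P
    by (rule AE_I[of _ _ "space M"]) (use assms(1) in auto)
  show ?thesis
  proof (cases "p = \<infinity>")
    case True
    have "(\<lambda>x. ennreal (norm (g x)) * indicator E x) \<in> borel_measurable M"
      using assms(2,3) by measurable
    then have "esssup M (\<lambda>x. ennreal (norm (g x)) * indicator E x) \<le> 0"
      by (rule esssup_I) (rule null)
    then show ?thesis using True by (simp add: Lp_average_def)
  next
    case False
    have "(\<integral>\<^sup>+x\<in>E. ennreal (norm (g x) powr enn2real p) \<partial>M) = (\<integral>\<^sup>+x. 0 \<partial>M)"
      by (rule nn_integral_cong_AE) (rule null)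
    then show ?thesis using False by (simp add: Lp_average_def)
  qed
qed

lemma Lp_enorm_null:
  assumes "emeasure M (space M) = 0" "g \<in> borel_measurable M" "1 \<le> p"
  shows "Lp_enorm M p g = 0"
proof -
  have null: "AE x in M. P x" for P
    by (rule AE_I[of _ _ "space M"]) (use assms(1) in auto)
  have "Lp_enorm M p g \<le> eLp M p (\<lambda>x. 0)"
    unfolding Lp_enorm_eq_eLp using assms by (intro eLp_mono_AE null) auto
  then show ?thesis by simp
qed

section \<open>Translation of the definitions into estimates at scale \<open>sqrt t\<close>\<close>

lemma exp_dyadic_eq: "0 < t \<Longrightarrow> exp (- (c * 4 ^ j * r\<^sup>2 / t)) = exp (- (c * (2 ^ j * r / sqrt t)\<^sup>2))"
proof -
  assume "0 < t"
  moreover have "(2 ^ j)\<^sup>2 = (4::real) ^ j" by (simp add: power2_eq_square flip: power_mult_distrib)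
  ultimately show ?thesis by (simp add: power_divide power_mult_distrib mult.assoc)
qed

text \<open>A function supported in \<open>E\<close> is its own truncation. This also covers domains
  such as \<open>comp_domain\<close>, which need not be stable under truncation.\<close>

lemma all_trunc_iff:
  "(\<forall>f. trunc E f \<in> V \<longrightarrow> Q (trunc E f)) \<longleftrightarrow> (\<forall>f. f \<in> V \<longrightarrow> supp_in E f \<longrightarrow> Q f)"
  by (metis supp_in_trunc supp_in_trunc_eq)

context doubling_space
begin

lemma off_diagonal_with_iff:
  fixes V :: "real \<Rightarrow> ('a \<Rightarrow> 'b::real_normed_field) set"
  assumes p: "1 \<le> p" and q: "1 \<le> q"
  shows "off_diagonal_with M p q V T a b \<longleftrightarrow> 0 < a \<and> 0 < b \<and>
    (\<exists>c>0. \<exists>C>0. \<forall>t>0. od_estimates p q 2 a b C c (sqrt t) (V t) (T t))"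
proof -
  have "(\<forall>x. \<forall>r>0.
        (\<forall>f. trunc (ball x r) f \<in> V t \<longrightarrow>
           Lp_average M q (ball x r) (ball x r) (T t (trunc (ball x r) f)) \<le>
             ennreal (C * Upsilon (r / sqrt t) powr b) *
             Lp_average M p (ball x r) (ball x r) f) \<and>
        (\<forall>j\<ge>2.
           (\<forall>f. trunc (annulus x r j) f \<in> V t \<longrightarrow>
              Lp_average M q (ball x r) (ball x r) (T t (trunc (annulus x r j) f)) \<le>
                ennreal (C * 2 powr (real j * a) * Upsilon (2 ^ j * r / sqrt t) powr b *
                         exp (- (c * 4 ^ j * r\<^sup>2 / t))) *
                Lp_average M p (ball x (2 ^ (j + 1) * r)) (annulus x r j) f) \<and>
           (\<forall>f. trunc (ball x r) f \<in> V t \<longrightarrow>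
              Lp_average M q (ball x (2 ^ (j + 1) * r)) (annulus x r j)
                  (T t (trunc (ball x r) f)) \<le>
                ennreal (C * 2 powr (real j * a) * Upsilon (2 ^ j * r / sqrt t) powr b *
                         exp (- (c * 4 ^ j * r\<^sup>2 / t))) *
                Lp_average M p (ball x r) (ball x r) f)))
      \<longleftrightarrow> od_estimates p q 2 a b C c (sqrt t) (V t) (T t)" (is "?L \<longleftrightarrow> _") if t: "0 < t" for t c C
  proof -
    have wt: "C * 2 powr (real j * a) * Upsilon (2 ^ j * r / sqrt t) powr b * exp (- (c * 4 ^ j * r\<^sup>2 / t))
        = C * wt a b c j (2 ^ j * r / sqrt t)" for j r
      unfolding wt_def exp_dyadic_eq[OF t] by (simp only: mult.assoc)
    have "?L \<longleftrightarrow> (\<forall>x. \<forall>r>0.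
        (\<forall>f. trunc (ball x r) f \<in> V t \<longrightarrow>
           avg q x r (ball x r) (T t (trunc (ball x r) f)) \<le>
             ennreal (C * Upsilon (r / sqrt t) powr b) * avg p x r UNIV (trunc (ball x r) f)) \<and>
        (\<forall>j\<ge>2.
           (\<forall>f. trunc (shell x (2 ^ j * r)) f \<in> V t \<longrightarrow>
              avg q x r (ball x r) (T t (trunc (shell x (2 ^ j * r)) f)) \<le>
                ennreal (C * wt a b c j (2 ^ j * r / sqrt t)) *
                avg p x (2 * (2 ^ j * r)) UNIV (trunc (shell x (2 ^ j * r)) f)) \<and>
           (\<forall>f. trunc (ball x r) f \<in> V t \<longrightarrow>
              avg q x (2 * (2 ^ j * r)) (shell x (2 ^ j * r)) (T t (trunc (ball x r) f)) \<le>
                ennreal (C * wt a b c j (2 ^ j * r / sqrt t)) *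
                avg p x r UNIV (trunc (ball x r) f))))"
      unfolding wt annulus_eq_shell avg_trunc
      by (simp add: Lp_average_eq_avg p q mult.assoc cong: conj_cong)
    also have "\<dots> \<longleftrightarrow> od_estimates p q 2 a b C c (sqrt t) (V t) (T t)"
      unfolding od_estimates_def
        all_trunc_iff[where Q = "\<lambda>f. avg q x r (ball x r) (T t f) \<le>
             ennreal (C * Upsilon (r / sqrt t) powr b) * avg p x r UNIV f" for x r]
        all_trunc_iff[where Q = "\<lambda>f. avg q x r (ball x r) (T t f) \<le>
             ennreal (C * wt a b c j (2 ^ j * r / sqrt t)) * avg p x (2 * (2 ^ j * r)) UNIV f" for x r j]
        all_trunc_iff[where Q = "\<lambda>f. avg q x (2 * (2 ^ j * r)) (shell x (2 ^ j * r)) (T t f) \<le>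
             ennreal (C * wt a b c j (2 ^ j * r / sqrt t)) * avg p x r UNIV f" for x r j]
      by blast
    finally show ?thesis .
  qed
  then show ?thesis unfolding off_diagonal_with_def by auto
qed

lemma od_operatorI:
  fixes V :: "('a \<Rightarrow> 'b::{real_normed_field, second_countable_topology}) set"
  assumes V: "Lp_subspace M p V" and T: "sublinear_family M V T" and t: "0 < t"
    and p: "1 \<le> p" "1 \<le> q" and pos: "0 < a" "0 < b" "0 < C" "0 < c"
    and od: "od_estimates p q 2 a b C c (sqrt t) V (T t)"
  shows "od_operator M C0 V (T t) p q a b C c (sqrt t)"
proof unfold_locales
  have zero: "(\<lambda>x. 0) \<in> V" using V by (auto simp: Lp_subspace_def)
  have "AE x in M. norm (T t (\<lambda>y. c * f y) x) = norm c * norm (T t f x)" if "f \<in> V" for c f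
    using T[unfolded sublinear_family_def, rule_format, OF t] that by blast
  from this[OF zero, of 0] show "AE y in M. T t (\<lambda>x. 0) y = 0" by simp
  show "(\<lambda>x. 0) \<in> V" by fact
  show "f \<in> borel_measurable M" if "f \<in> V" for f
    using V that by (auto simp: Lp_subspace_def Lp_def)
  show "(\<lambda>x. f x + g x) \<in> V" if "f \<in> V" "g \<in> V" for f g
    using V that by (auto simp: Lp_subspace_def)
  show "trunc E f \<in> V" if "f \<in> V" "E \<in> sets borel" for f E
    using V that by (auto simp: Lp_subspace_def)
  show "T t f \<in> borel_measurable M" if "f \<in> V" for f
    using T t that by (auto simp: sublinear_family_def)
  show "AE y in M. norm (T t (\<lambda>x. f x + g x) y) \<le> norm (T t f y) + norm (T t g y)"
    if "f \<in> V" "g \<in> V" for f g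
    using T t that by (auto simp: sublinear_family_def)
qed (use p pos t od in auto)

lemma annular_od_operatorI:
  fixes V :: "('a \<Rightarrow> 'b::{real_normed_field, second_countable_topology}) set"
  assumes "od_operator M C0 V (T t) p q a b C c (sqrt t)" and T: "annular_subadditive M V T" and t: "0 < t"
  shows "annular_od_operator M C0 V (T t) p q a b C c (sqrt t)"
proof -
  interpret od_operator M C0 V "T t" p q a b C c "sqrt t" by fact
  show ?thesis
  proof
    fix g and x :: 'a and R :: real
    assume g: "g \<in> V" and R: "0 < R"
    \<comment> \<open>The decomposition is taken for the radius R/4, as its central piece is the
      ball of four times the radius.\<close>
    have "annulus x (R / 4) (i + 2) = shell x (2 ^ i * R)" for i
      by (simp add: annulus_eq_shell power_add)
    moreover have "AE y in M. ennreal (norm (T t g y)) \<le>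
          ennreal (norm (T t (trunc (ball x (4 * (R / 4))) g) y)) +
          (\<Sum>j. ennreal (norm (T t (trunc (annulus x (R / 4) (j + 2)) g) y)))"
      using T t g R unfolding annular_subadditive_def by (meson divide_pos_pos zero_less_numeral)
    ultimately show "AE y in M. ennreal (norm (T t g y)) \<le>
          ennreal (norm (T t (trunc (ball x R) g) y)) +
          (\<Sum>i. ennreal (norm (T t (trunc (shell x (2 ^ i * R)) g) y)))"
      by simp
  qed
qed

end

lemma bounded_of_off_diagonal:
  fixes M :: "'a::metric_space measure"
    and V :: "('a \<Rightarrow> 'b::{real_normed_field, second_countable_topology}) set"
  assumes M: "homogeneous_type M" and p: "1 \<le> p" and V: "Lp_subspace M p V"
    and T: "sublinear_family M V T" "annular_subadditive M V T" "off_diagonal M p p (\<lambda>t. V) T"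
  shows "\<exists>C::real. \<forall>t>0. \<forall>f\<in>V. T t f \<in> Lp M p \<and> Lp_enorm M p (T t f) \<le> ennreal C * Lp_enorm M p f"
proof -
  have meas: "T t f \<in> borel_measurable M" if "0 < t" "f \<in> V" for t f
    using T(1) that by (auto simp: sublinear_family_def)
  show ?thesis
  proof (cases "emeasure M (space M) = 0")
    case True
    then show ?thesis using meas p by (auto simp: Lp_def Lp_enorm_null)
  next
    case False
    interpret doubling_space M "LEAST C. doubling_const M C"
      by (rule homogeneous_type_imp_doubling_space[OF M False])
    obtain a b c K where pos: "0 < a" "0 < b" "0 < c" "0 < K"
      and od: "\<And>t. 0 < t \<Longrightarrow> od_estimates p p 2 a b K c (sqrt t) V (T t)"
      using T(3) p unfolding off_diagonal_def by (auto simp: off_diagonal_with_iff)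
    obtain X where X: "\<And>(V :: ('a \<Rightarrow> 'b) set) T \<tau> f.
      annular_od_operator M (LEAST C. doubling_const M C) V T p p a b K c \<tau> \<Longrightarrow> f \<in> V \<Longrightarrow>
      eLp M p (\<lambda>y. ennreal (norm (T f y))) \<le> ennreal X * eLp M p (\<lambda>y. ennreal (norm (f y)))"
      by (rule uniform_bound[OF pos(1,2,4,3)]) (rule that)
    have "T t f \<in> Lp M p \<and> Lp_enorm M p (T t f) \<le> ennreal X * Lp_enorm M p f" if "0 < t" "f \<in> V" for t f
    proof -
      have le: "Lp_enorm M p (T t f) \<le> ennreal X * Lp_enorm M p f"
        unfolding Lp_enorm_eq_eLp
        using that pos p V T by (intro X[OF annular_od_operatorI[OF od_operatorI[OF V T(1)]]] od) auto
      have "Lp_enorm M p f < \<infinity>" using V that by (auto simp: Lp_subspace_def Lp_def)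
      then have "ennreal X * Lp_enorm M p f < \<infinity>" by (simp add: ennreal_mult_less_top)
      then show ?thesis using le meas[OF that] by (auto simp: Lp_def intro: order_le_less_trans)
    qed
    then show ?thesis by blast
  qed
qed

text \<open>Stated for every second exponent that the series bound admits, so that existence of some
  exponents, the stated exponent and all larger ones follow from it alike.\<close>

lemma off_diagonal_compose:
  fixes M :: "'a::metric_space measure"
    and V W :: "('a \<Rightarrow> 'b::{real_normed_field, second_countable_topology}) set"
  assumes M: "homogeneous_type M" and pqr: "1 \<le> p" "p \<le> q" "q \<le> r"
    and V: "Lp_subspace M q V" and T: "sublinear_family M V T" "annular_subadditive M V T"
    and W: "Lp_subspace M p W" and S: "sublinear_family M W S"
    and odT: "off_diagonal_with M q r (\<lambda>t. V) T a b" and odS: "off_diagonal_with M p q (\<lambda>t. W) S a' b'"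
    and \<alpha>: "a \<le> \<alpha>" "a' \<le> \<alpha>" "dim_quot (doubling_order M) r \<le> \<alpha>"
    and e: "a + a' \<le> e" "b + b' \<le> e" "a + a' \<noteq> b + b' \<or> a + a' < e"
  shows "off_diagonal_with M p r (comp_domain V W S) (\<lambda>t. T t \<circ> S t) \<alpha> e"
proof -
  have exps: "0 < a" "0 < b" "0 < a'" "0 < b'" using odT odS by (auto simp: off_diagonal_with_def)
  have pos: "0 < \<alpha>" "0 < e" using exps \<alpha> e by auto
  have q: "1 \<le> q" "1 \<le> r" using pqr by auto
  show ?thesis
  proof (cases "emeasure M (space M) = 0")
    case True
    have sets: "sets M = sets borel" using M by (simp add: homogeneous_type_def)
    have "(T t \<circ> S t) f \<in> borel_measurable M" if "0 < t" "f \<in> comp_domain V W S t" for t f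
      using that T by (auto simp: comp_domain_def sublinear_family_def)
    then have "Lp_average M r B E ((T t \<circ> S t) f) = 0"
      if "0 < t" "f \<in> comp_domain V W S t" "E \<in> sets borel" for B E t f
      using Lp_average_null[OF True] that sets by blast
    \<comment> \<open>All left-hand sides vanish, so both constants may be taken to be 1.\<close>
    then show ?thesis
      using pos unfolding off_diagonal_with_def annulus_eq_shell
      by (intro conjI exI[of _ 1]) auto
  next
    case False
    interpret doubling_space M "LEAST C. doubling_const M C"
      by (rule homogeneous_type_imp_doubling_space[OF M False])
    have D: "doubling_order M = D" by (simp add: D_def doubling_order_def)
    obtain c K where T_od: "0 < c" "0 < K" "\<And>t. 0 < t \<Longrightarrow> od_estimates q r 2 a b K c (sqrt t) V (T t)"
      using odT q by (auto simp: off_diagonal_with_iff)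
    obtain d L where S_od: "0 < d" "0 < L" "\<And>t. 0 < t \<Longrightarrow> od_estimates p q 2 a' b' L d (sqrt t) W (S t)"
      using odS q pqr by (auto simp: off_diagonal_with_iff)
    obtain C c0 where C: "0 < C" "0 < c0" "\<And>(V :: ('a \<Rightarrow> 'b) set) T W S \<tau>.
      annular_od_operator M (LEAST C. doubling_const M C) V T q r a b K c \<tau> \<Longrightarrow>
      od_operator M (LEAST C. doubling_const M C) W S p q a' b' L d \<tau> \<Longrightarrow>
      od_estimates p r 2 \<alpha> e C c0 \<tau> {f \<in> W. S f \<in> V} (T \<circ> S)"
      by (rule od_estimates_compose[OF e \<alpha>(1,2) \<alpha>(3)[unfolded D] exps(1,2) T_od(2,1) exps(3,4) S_od(2,1)])
        (rule that)
    have "od_estimates p r 2 \<alpha> e C c0 (sqrt t) (comp_domain V W S t) (T t \<circ> S t)" if t: "0 < t" for t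
      unfolding comp_domain_def
      using t exps T_od S_od q pqr(1)
      by (intro C annular_od_operatorI[OF od_operatorI[OF V T(1)] T(2)] od_operatorI[OF W S]) auto
    then show ?thesis using pos C(1,2) q pqr(1) by (auto simp: off_diagonal_with_iff)
  qed
qed

text \<open>If a + a' = b + b' and a differs from b, then the larger of a and b is paired with the
  smaller of a' and b'. The sum of the maxima therefore exceeds the common value, and the
  logarithmic case of the series is avoided.\<close>

lemma max_add_max_strict:
  fixes a b a' b' x :: real
  assumes "a \<noteq> b" "0 \<le> x" "a' + x \<noteq> b'"
  shows "a + a' \<noteq> b + b' \<or> a + a' < max a b + max (a' + x) b'"
  using assms by (auto simp: max_def)

lemma dim_quot_nonneg: "homogeneous_type M \<Longrightarrow> 0 \<le> dim_quot (doubling_order M) p"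
proof (cases "emeasure M (space M) = 0")
  case True
  assume M: "homogeneous_type M"
  have "doubling_const M C \<longleftrightarrow> 0 \<le> C" for C
    using M emeasure_space[of M] True by (auto simp: doubling_const_def emeasure_eq_0_AE)
  \<comment> \<open>The default \<open>ln 0 = 0\<close> makes the doubling order of the zero measure
    0.\<close>
  then have "(LEAST C. doubling_const M C) = 0" by (intro Least_equality) auto
  then show ?thesis by (simp add: dim_quot_def doubling_order_def log_def)
next
  case False
  assume M: "homogeneous_type M"
  interpret doubling_space M "LEAST C. doubling_const M C"
    by (rule homogeneous_type_imp_doubling_space[OF M False])
  show ?thesis using D_nonneg by (simp add: dim_quot_def D_def doubling_order_def)
qed

theorem theorem2p3:
  fixes M :: "'a::metric_space measure"
  assumes "homogeneous_type M"
  shows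
    "(\<forall>(p::ennreal) (V :: ('a \<Rightarrow> 'b::{real_normed_field, second_countable_topology}) set) T.
        1 \<le> p \<longrightarrow>
        Lp_subspace M p V \<longrightarrow> sublinear_family M V T \<longrightarrow> annular_subadditive M V T \<longrightarrow>
        off_diagonal M p p (\<lambda>t. V) T \<longrightarrow>
        (\<exists>C::real. \<forall>t>0. \<forall>f\<in>V.
            T t f \<in> Lp M p \<and> Lp_enorm M p (T t f) \<le> ennreal C * Lp_enorm M p f))
     \<and>
     (\<forall>(p::ennreal) (q::ennreal) (r::ennreal) (V :: ('a \<Rightarrow> 'b) set) (W :: ('a \<Rightarrow> 'b) set) T S.
        1 \<le> p \<longrightarrow> p \<le> q \<longrightarrow> q \<le> r \<longrightarrow>
        Lp_subspace M q V \<longrightarrow> sublinear_family M V T \<longrightarrow> annular_subadditive M V T \<longrightarrow>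
        Lp_subspace M p W \<longrightarrow> sublinear_family M W S \<longrightarrow>
        (off_diagonal M q r (\<lambda>t. V) T \<longrightarrow>
         off_diagonal M p q (\<lambda>t. W) S \<longrightarrow>
         off_diagonal M p r (comp_domain V W S) (\<lambda>t. T t \<circ> S t))
        \<and>
        (\<forall>\<theta>\<^sub>1 \<theta>\<^sub>2 \<gamma>\<^sub>1 \<gamma>\<^sub>2.
          off_diagonal_with M q r (\<lambda>t. V) T \<theta>\<^sub>1 \<theta>\<^sub>2 \<longrightarrow>
          off_diagonal_with M p q (\<lambda>t. W) S \<gamma>\<^sub>1 \<gamma>\<^sub>2 \<longrightarrow>
          (let D = doubling_order M;
               \<alpha>\<^sub>1 = max \<theta>\<^sub>1 (max \<gamma>\<^sub>1 (dim_quot D r));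
               \<alpha>\<^sub>2 = max \<theta>\<^sub>1 \<theta>\<^sub>2 + max (\<gamma>\<^sub>1 + dim_quot D q) \<gamma>\<^sub>2
           in if \<theta>\<^sub>1 \<noteq> \<theta>\<^sub>2 \<and> \<gamma>\<^sub>1 + dim_quot D q \<noteq> \<gamma>\<^sub>2
              then off_diagonal_with M p r (comp_domain V W S) (\<lambda>t. T t \<circ> S t) \<alpha>\<^sub>1 \<alpha>\<^sub>2
              else (\<forall>\<alpha>>\<alpha>\<^sub>2. off_diagonal_with M p r (comp_domain V W S) (\<lambda>t. T t \<circ> S t) \<alpha>\<^sub>1 \<alpha>))))"
proof (intro conjI allI impI)
  fix p :: ennreal and V :: "('a \<Rightarrow> 'b) set" and T
  assume "1 \<le> p" "Lp_subspace M p V" "sublinear_family M V T" "annular_subadditive M V T"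
    "off_diagonal M p p (\<lambda>t. V) T"
  then show "\<exists>C::real. \<forall>t>0. \<forall>f\<in>V. T t f \<in> Lp M p \<and> Lp_enorm M p (T t f) \<le> ennreal C * Lp_enorm M p f"
    by (rule bounded_of_off_diagonal[OF assms])
next
  fix p q r :: ennreal and V W :: "('a \<Rightarrow> 'b) set" and T S
  assume *: "1 \<le> p" "p \<le> q" "q \<le> r" "Lp_subspace M q V" "sublinear_family M V T" "annular_subadditive M V T"
    "Lp_subspace M p W" "sublinear_family M W S"
  note compose = off_diagonal_compose[OF assms *]
  {
    assume "off_diagonal M q r (\<lambda>t. V) T" "off_diagonal M p q (\<lambda>t. W) S"
    then obtain a b a' b' where
      od: "off_diagonal_with M q r (\<lambda>t. V) T a b" "off_diagonal_with M p q (\<lambda>t. W) S a' b'"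
      unfolding off_diagonal_def by blast
    \<comment> \<open>Some exponents suffice here; adding 1 puts the second one strictly above both
      sums.\<close>
    have "off_diagonal_with M p r (comp_domain V W S) (\<lambda>t. T t \<circ> S t)
        (max a (max a' (dim_quot (doubling_order M) r))) (max (a + a') (b + b') + 1)"
      by (rule compose[OF od]) auto
    then show "off_diagonal M p r (comp_domain V W S) (\<lambda>t. T t \<circ> S t)"
      unfolding off_diagonal_def by blast
  }
  fix a b a' b'
  assume od: "off_diagonal_with M q r (\<lambda>t. V) T a b" "off_diagonal_with M p q (\<lambda>t. W) S a' b'"
  define x where "x = dim_quot (doubling_order M) q"
  have x: "0 \<le> x" unfolding x_def by (rule dim_quot_nonneg[OF assms])
  have le: "a + a' \<le> max a b + max (a' + x) b'" "b + b' \<le> max a b + max (a' + x) b'"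
    using x by (auto simp: max_def)
  show "let D = doubling_order M;
           \<alpha>\<^sub>1 = max a (max a' (dim_quot D r));
           \<alpha>\<^sub>2 = max a b + max (a' + dim_quot D q) b'
       in if a \<noteq> b \<and> a' + dim_quot D q \<noteq> b'
          then off_diagonal_with M p r (comp_domain V W S) (\<lambda>t. T t \<circ> S t) \<alpha>\<^sub>1 \<alpha>\<^sub>2
          else (\<forall>\<alpha>>\<alpha>\<^sub>2. off_diagonal_with M p r (comp_domain V W S) (\<lambda>t. T t \<circ> S t) \<alpha>\<^sub>1 \<alpha>)"
    unfolding Let_def x_def[symmetric]
  proof (split if_split, intro conjI impI allI)
    assume "a \<noteq> b \<and> a' + x \<noteq> b'"
    then show "off_diagonal_with M p r (comp_domain V W S) (\<lambda>t. T t \<circ> S t)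
        (max a (max a' (dim_quot (doubling_order M) r))) (max a b + max (a' + x) b')"
      using le max_add_max_strict[of a b x a' b'] x by (intro compose[OF od]) auto
  next
    fix \<alpha> assume "max a b + max (a' + x) b' < \<alpha>"
    \<comment> \<open>Any number beyond the stated value is strictly larger than a + a', so the
      strict alternative applies whether or not the sums coincide.\<close>
    then show "off_diagonal_with M p r (comp_domain V W S) (\<lambda>t. T t \<circ> S t)
        (max a (max a' (dim_quot (doubling_order M) r))) \<alpha>"
      using le by (intro compose[OF od]) auto
  qed
qed

end
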